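(* Let $n\ge0$, $d_n\ge1$ and $\mathcal F_n=\{f_n^1,\dots,f_n^{d_n}\}\subset\mathcal B(E_n)$ be a finite set of functions. Let $(\alpha(N))_{N\ge1}$ be a nondecreasing sequence of positive numbers with $\alpha(N)\to\infty$ and $\alpha(N)/N\to0$. Then the random sequence $\pi_{\mathcal F_n}(W_n^N)=(W^N_n(f_n^i))_{1\le i\le d_n}$ satisfies a moderate deviation principle in $\mathbb R^{d_n}$ with speed $\alpha(N)$ and with the good rate function $$I^{W_n}_{\mathcal F_n}(v)=\sup_{u\in\mathbb R^{d_n}}\Big(\langle u,v\rangle-\frac12\,\mathbb E\Big(\Big(\sum_{i=1}^{d_n}u^iW_n(f_n^i)\Big)^2\Big)\Big),\qquad v\in\mathbb R^{d_n},\quad \langle u,v\rangle=\sum_{i=1}^{d_n}u^iv^i .$$ If the covariance matrix $C_{\mathcal F_n}=\big(\mathbb E(W_n(f^i_n)W_n(f^j_n))\big)_{1\le i,j\le d_n}$ is invertible, then $I^{W_n}_{\mathcal F_n}(v)=\frac12\langle v,C_{\mathcal F_n}^{-1}v\rangle$.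
   Context: Notation. For a measurable space $(E,\mathcal E)$: $\mathcal P(E)$ is the set of probability measures, $\mathcal M(E)$ the set of finite signed measures, $\mathcal B(E)$ the bounded measurable real functions with the sup norm $\|\cdot\|$, $\mathrm{osc}(f)=\sup_{x,y}|f(x)-f(y)|$, $\mathrm{Osc}_1(E)=\{f\text{ measurable}:\mathrm{osc}(f)\le 1\}$, $\mu(f)=\int f\,d\mu$. A bounded integral operator $M$ from $E$ into $F$ is an operator $f\mapsto M(f)(x)=\int_F M(x,dy)f(y)$ from $\mathcal B(F)$ into $\mathcal B(E)$; $(\mu M)(f):=\mu(M(f))$; products of operators are compositions; $\beta(M):=\sup\{\mathrm{osc}(M(f)):f\in\mathrm{Osc}_1(F)\}$. Model. $(E_n,\mathcal E_n)_{n\ge0}$ are measurable spaces; for $n\ge1$ and $\eta\in\mathcal P(E_{n-1})$, $K_{n,\eta}$ is a Markov kernel from $E_{n-1}$ to $E_n$; $\Phi_n(\eta):=\eta K_{n,\eta}\in\mathcal P(E_n)$; $\eta_0\in\mathcal P(E_0)$ is given and $\eta_n=\Phi_n(\eta_{n-1})$. The maps $(x^i)_{1\le i\le N}\mapsto K_{n+1,\frac1N\sum_j\delta_{x^j}}(x^i,A)$ are measurable for every measurable $A\subset E_{n+1}$. For $N\ge1$, the particle system $\xi_n=(\xi_n^{1},\dots,\xi_n^{N})\in E_n^N$ is a Markov chain: $\xi_0$ consists of $N$ i.i.d. variables of law $\eta_0$, and given $\xi_0,\dots,\xi_{n-1}$ the $\xi_n^{i}$ are independent with respective laws $K_{n,\eta^N_{n-1}}(\xi_{n-1}^{i},\cdot)$,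 where $\eta^N_n:=\frac1N\sum_{j=1}^N\delta_{\xi_n^{j}}$. Set $W_n^N:=\sqrt N(\eta_n^N-\eta_n)$. Regularity class $\Upsilon(E_1,E_2)$: mappings $\Phi:\mathcal P(E_1)\to\mathcal P(E_2)$ with $\Phi(\mu)-\Phi(\eta)=(\mu-\eta)D_\eta\Phi+\mathcal R^\Phi(\mu,\eta)$ for all $\mu,\eta$, where (i) $D_\eta\Phi$ are bounded integral operators from $E_1$ into $E_2$ with $D_\eta\Phi(1)=0$ and $\sup_\eta\beta(D_\eta\Phi)<\infty$; (ii) $|\mathcal R^\Phi(\mu,\eta)(f)|\le\int|(\mu-\eta)^{\otimes2}(g)|\,R^\Phi_\eta(f,dg)$, where for each $f\in\mathcal B(E_2)$, $R^\Phi_\eta(f,\cdot)$ is a nonnegative measure on functions $g=g_1\otimes g_2$, $(g_1,g_2)\in\mathrm{Osc}_1(E_1)^2$, with $\sup_\eta\int\mathrm{osc}(g_1)\mathrm{osc}(g_2)R^\Phi_\eta(f,d(g_1\otimes g_2))\le\mathrm{osc}(f)\,\delta(R^\Phi)$ and $\delta(R^\Phi)<\infty$. Condition (K) for a family $K_\eta$, $\eta\in\mathcal P(E_1)$, of Markov kernels from $E_1$ to $E_2$: for all $f\in\mathrm{Osc}_1(E_2)$, $\|[K_\mu-K_\eta](f)\|\le\int|(\mu-\eta)(h)|\,T^K_\eta(f,dh)$ for some nonnegative measures $T^K_\eta(f,\cdot)$ on $\mathcal B(E_1)$ with $\sup_\eta\int\mathrm{osc}(h)T^K_\eta(f,dh)\le\mathrm{osc}(f)\,\delta(T^K)$,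 $\delta(T^K)<\infty$. Standing assumption (H1): for every $n\ge1$ the family $K_{n,\eta}$ satisfies (K) and $\Phi_n\in\Upsilon(E_{n-1},E_n)$. Set $\mathcal D_n:=D_{\eta_{n-1}}\Phi_n$, $\mathcal D_{p,n}:=\mathcal D_{p+1}\mathcal D_{p+2}\cdots\mathcal D_n$, $\mathcal D_{n,n}:=Id$. Limit fields. $(V_n)_{n\ge0}$ are independent centered Gaussian random fields on $\mathcal B(E_n)$ with $\mathbb E(V_n(f)V_n(g))=\int\eta_{n-1}(dx)\int K_{n,\eta_{n-1}}(x,dy)[f(y)-K_{n,\eta_{n-1}}(f)(x)][g(y)-K_{n,\eta_{n-1}}(g)(x)]$, with the convention for $n=0$ that $K_{0,\eta_{-1}}(x,dy)=\eta_0(dy)$ (so $\mathbb E(V_0(f)V_0(g))$ is the covariance of $f,g$ under $\eta_0$). Finally $W_n(f):=\sum_{p=0}^nV_p(\mathcal D_{p,n}(f))$. LDP/MDP. Let $S$ be a topological space with a $\sigma$-field $\mathcal S$. Random variables $\mathcal X^N$ with values in $(S,\mathcal S)$ satisfy an LDP with speed $\alpha(N)\to\infty$ and good rate function $I:S\to[0,\infty]$ if all level sets $\{I\le a\}$, $a<\infty$, are compact and, for every $A\in\mathcal S$ with interior $A^\circ$ and closure $\overline A$, $-\inf_{A^\circ}I\le\liminf_N\frac1{\alpha(N)}\log\mathbb P(\mathcal X^N\in A)\le\limsup_N\frac1{\alpha(N)}\log\mathbb P(\mathcal X^N\in A)\le-\inf_{\overline A}I$. A sequence $\mathcal Y^N$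 satisfies an MDP with speed $\alpha(N)$ and good rate function $I$ if $\mathcal Y^N/\sqrt{\alpha(N)}$ satisfies an LDP with speed $\alpha(N)$ and good rate function $I$.
   Formalization: The measures in (K) and in the remainder bound are given no σ-field; they are taken on σ-fields making evaluation (x,h)↦h(x) (resp. (x,y,g)↦g(x,y)) jointly measurable, and osc(h), osc(g1)osc(g2) measurable. With arbitrary σ-fields the claim can fail. *)

theory Defs
  imports "HOL-Probability.Probability"
begin

section \<open>Functions and operators on a measurable space\<close>

text \<open>Measurable spaces are given as values of type \<open>'a measure\<close>, of which only \<open>space\<close> and \<open>sets\<close>
  are used; the set of probability measures on \<open>E\<close> is \<open>space (prob_algebra E)\<close>. Functions on \<open>E\<close>
  are total HOL functions; their values outside \<open>space E\<close> are never used. Suprema of nonnegative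
  quantities are taken in \<open>ennreal\<close>, so that infinite values are not lost.\<close>

abbreviation probs :: "'a measure \<Rightarrow> 'a measure set" where
  "probs E \<equiv> space (prob_algebra E)"

definition bfun :: "'a measure \<Rightarrow> ('a \<Rightarrow> real) set" where
  "bfun E = {f. f \<in> borel_measurable E \<and> (\<exists>C. \<forall>x\<in>space E. \<bar>f x\<bar> \<le> C)}"

definition sup_norm :: "'a measure \<Rightarrow> ('a \<Rightarrow> real) \<Rightarrow> ennreal" where
  "sup_norm E f = (SUP x\<in>space E. ennreal \<bar>f x\<bar>)"

definition osc :: "'a measure \<Rightarrow> ('a \<Rightarrow> real) \<Rightarrow> ennreal" where
  "osc E f = (SUP x\<in>space E. SUP y\<in>space E. ennreal \<bar>f x - f y\<bar>)"

definition Osc1 :: "'a measure \<Rightarrow> ('a \<Rightarrow> real) set" where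
  "Osc1 E = {f. f \<in> borel_measurable E \<and> osc E f \<le> 1}"

text \<open>The action of the signed measure \<open>\<mu> - \<eta>\<close> on a function.\<close>

definition diff_int :: "'a measure \<Rightarrow> 'a measure \<Rightarrow> ('a \<Rightarrow> real) \<Rightarrow> real" where
  "diff_int \<mu> \<eta> h = (\<integral>x. h x \<partial>\<mu>) - (\<integral>x. h x \<partial>\<eta>)"

text \<open>Each finite signed measure \<open>M(x, dy)\<close> is a difference of two finite measures
  \<open>Mp x\<close>, \<open>Mm x\<close>.\<close>

definition bounded_integral_op ::
  "'a measure \<Rightarrow> 'b measure \<Rightarrow> (('b \<Rightarrow> real) \<Rightarrow> ('a \<Rightarrow> real)) \<Rightarrow> bool" where
  "bounded_integral_op E F M \<longleftrightarrow>
     (\<exists>Mp Mm. (\<forall>x\<in>space E. finite_measure (Mp x) \<and> sets (Mp x) = sets F \<and>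
                          finite_measure (Mm x) \<and> sets (Mm x) = sets F) \<and>
              (\<forall>f\<in>bfun F. \<forall>x\<in>space E. M f x = diff_int (Mp x) (Mm x) f)) \<and>
     (\<forall>f\<in>bfun F. M f \<in> bfun E)"

definition beta :: "'a measure \<Rightarrow> 'b measure \<Rightarrow> (('b \<Rightarrow> real) \<Rightarrow> ('a \<Rightarrow> real)) \<Rightarrow> ennreal" where
  "beta E F M = (SUP f\<in>Osc1 F. osc E (M f))"

section \<open>Regularity conditions\<close>

text \<open>A measure on a set of functions is any measure whose \<open>\<sigma>\<close>-field makes the evaluation map
  jointly measurable and the oscillation measurable. Measurability of each
  \<open>h \<mapsto> \<mu>(h)\<close> follows by Fubini's theorem; joint measurability cannot be replaced by
  the latter, since under the continuum hypothesis Fubini's theorem would fail for the integrals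
  over \<open>h\<close>. Without measurability, \<open>nn_integral\<close> would only be a lower integral.\<close>

definition measure_on_bfun :: "'a measure \<Rightarrow> ('a \<Rightarrow> real) measure \<Rightarrow> bool" where
  "measure_on_bfun E T \<longleftrightarrow>
     space T \<subseteq> bfun E \<and>
     (\<lambda>(x, h). h x) \<in> borel_measurable (E \<Otimes>\<^sub>M T) \<and>
     osc E \<in> borel_measurable T"

text \<open>A function \<open>g = g1 \<otimes> g2\<close> is represented by the pair \<open>(g1, g2)\<close>. Only quantities that depend
  on the function \<open>(x, y) \<mapsto> g1 x * g2 y\<close> alone enter below.\<close>

definition measure_on_tensors ::
  "'a measure \<Rightarrow> (('a \<Rightarrow> real) \<times> ('a \<Rightarrow> real)) measure \<Rightarrow> bool" where
  "measure_on_tensors E R \<longleftrightarrow>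
     space R \<subseteq> Osc1 E \<times> Osc1 E \<and>
     (\<lambda>((x, y), (g1, g2)). g1 x * g2 y) \<in> borel_measurable ((E \<Otimes>\<^sub>M E) \<Otimes>\<^sub>M R) \<and>
     (\<lambda>(g1, g2). osc E g1 * osc E g2) \<in> borel_measurable R"

definition cond_K :: "'a measure \<Rightarrow> 'b measure \<Rightarrow> ('a measure \<Rightarrow> 'a \<Rightarrow> 'b measure) \<Rightarrow> bool" where
  "cond_K E1 E2 K \<longleftrightarrow>
     (\<exists>(T :: 'a measure \<Rightarrow> ('b \<Rightarrow> real) \<Rightarrow> ('a \<Rightarrow> real) measure) (\<delta> :: ennreal). \<delta> < \<infinity> \<and>
       (\<forall>f\<in>Osc1 E2.
         (\<forall>\<eta>\<in>probs E1. measure_on_bfun E1 (T \<eta> f)) \<and>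
         (\<forall>\<mu>\<in>probs E1. \<forall>\<eta>\<in>probs E1.
            sup_norm E1 (\<lambda>x. diff_int (K \<mu> x) (K \<eta> x) f)
              \<le> (\<integral>\<^sup>+h. ennreal \<bar>diff_int \<mu> \<eta> h\<bar> \<partial>T \<eta> f)) \<and>
         (SUP \<eta>\<in>probs E1. \<integral>\<^sup>+h. osc E1 h \<partial>T \<eta> f) \<le> osc E2 f * \<delta>))"

definition remainder ::
  "('a measure \<Rightarrow> 'b measure) \<Rightarrow> ('a measure \<Rightarrow> ('b \<Rightarrow> real) \<Rightarrow> ('a \<Rightarrow> real)) \<Rightarrow>
   'a measure \<Rightarrow> 'a measure \<Rightarrow> ('b \<Rightarrow> real) \<Rightarrow> real" where
  "remainder \<Phi> D \<mu> \<eta> f = diff_int (\<Phi> \<mu>) (\<Phi> \<eta>) f - diff_int \<mu> \<eta> (D \<eta> f)"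

text \<open>\<open>upsilon E1 E2 \<Phi> D\<close>: the map \<open>\<Phi>\<close> belongs to the class \<open>\<Upsilon>(E1, E2)\<close> with first order
  operators \<open>D \<eta>\<close>. The operators are an explicit argument because \<open>\<Phi>\<close> determines \<open>D \<eta> f\<close>
  only up to additive constants. Note that \<open>(\<mu> - \<eta>)\<close> tensorised with itself maps
  \<open>g1 \<otimes> g2\<close> to the product of the two values.\<close>

definition upsilon ::
  "'a measure \<Rightarrow> 'b measure \<Rightarrow> ('a measure \<Rightarrow> 'b measure) \<Rightarrow>
   ('a measure \<Rightarrow> ('b \<Rightarrow> real) \<Rightarrow> ('a \<Rightarrow> real)) \<Rightarrow> bool" where
  "upsilon E1 E2 \<Phi> D \<longleftrightarrow>
     (\<forall>\<eta>\<in>probs E1. \<Phi> \<eta> \<in> probs E2) \<and>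
     (\<forall>\<eta>\<in>probs E1. bounded_integral_op E1 E2 (D \<eta>) \<and> (\<forall>x\<in>space E1. D \<eta> (\<lambda>_. 1) x = 0)) \<and>
     (SUP \<eta>\<in>probs E1. beta E1 E2 (D \<eta>)) < \<infinity> \<and>
     (\<exists>(R :: 'a measure \<Rightarrow> ('b \<Rightarrow> real) \<Rightarrow> (('a \<Rightarrow> real) \<times> ('a \<Rightarrow> real)) measure) (\<delta> :: ennreal).
       \<delta> < \<infinity> \<and>
       (\<forall>f\<in>bfun E2.
         (\<forall>\<eta>\<in>probs E1. measure_on_tensors E1 (R \<eta> f)) \<and>
         (\<forall>\<mu>\<in>probs E1. \<forall>\<eta>\<in>probs E1.
            ennreal \<bar>remainder \<Phi> D \<mu> \<eta> f\<bar>
              \<le> (\<integral>\<^sup>+(g1, g2). ennreal \<bar>diff_int \<mu> \<eta> g1 * diff_int \<mu> \<eta> g2\<bar> \<partial>R \<eta> f)) \<and>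
         (SUP \<eta>\<in>probs E1. \<integral>\<^sup>+(g1, g2). osc E1 g1 * osc E1 g2 \<partial>R \<eta> f) \<le> osc E2 f * \<delta>))"

section \<open>The mean field particle model\<close>

text \<open>All spaces \<open>E n\<close> live on one type; different spaces can be embedded in their disjoint sum.
  \<open>K n \<eta>\<close> is the kernel from \<open>E (n - 1)\<close> to \<open>E n\<close> for \<open>n \<ge> 1\<close>; \<open>K 0\<close> is not used.\<close>

type_synonym 'a kernels = "nat \<Rightarrow> 'a measure \<Rightarrow> 'a \<Rightarrow> 'a measure"

definition Phi :: "'a kernels \<Rightarrow> nat \<Rightarrow> 'a measure \<Rightarrow> 'a measure" where
  "Phi K n \<eta> = \<eta> \<bind> K n \<eta>"

primrec flow :: "'a kernels \<Rightarrow> 'a measure \<Rightarrow> nat \<Rightarrow> 'a measure" where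
  "flow K \<eta>0 0 = \<eta>0"
| "flow K \<eta>0 (Suc n) = Phi K (Suc n) (flow K \<eta>0 n)"

text \<open>Particles are indexed by \<open>{..<N}\<close> instead of \<open>{1..N}\<close>.\<close>

definition empirical :: "'a measure \<Rightarrow> nat \<Rightarrow> (nat \<Rightarrow> 'a) \<Rightarrow> 'a measure" where
  "empirical E N x = distr (uniform_count_measure {..<N}) E x"

definition mean_field_model :: "(nat \<Rightarrow> 'a measure) \<Rightarrow> 'a kernels \<Rightarrow> 'a measure \<Rightarrow> bool" where
  "mean_field_model E K \<eta>0 \<longleftrightarrow>
     \<eta>0 \<in> probs (E 0) \<and>
     (\<forall>n. \<forall>\<eta>\<in>probs (E n). K (Suc n) \<eta> \<in> E n \<rightarrow>\<^sub>M prob_algebra (E (Suc n))) \<and>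
     (\<forall>n. \<forall>N\<ge>1. \<forall>i<N. \<forall>A\<in>sets (E (Suc n)).
        (\<lambda>x. measure (K (Suc n) (empirical (E n) N x) (x i)) A)
          \<in> borel_measurable (\<Pi>\<^sub>M j\<in>{..<N}. E n))"

text \<open>The \<open>\<sigma>\<close>-field generated by \<open>\<xi> 0, \<dots>, \<xi> n\<close>.\<close>

definition history ::
  "(nat \<Rightarrow> 'a measure) \<Rightarrow> nat \<Rightarrow> 'w measure \<Rightarrow> (nat \<Rightarrow> 'w \<Rightarrow> nat \<Rightarrow> 'a) \<Rightarrow> nat \<Rightarrow> 'w measure" where
  "history E N P \<xi> n =
     vimage_algebra (space P) (\<lambda>\<omega>. \<lambda>p\<in>{..n}. \<xi> p \<omega>) (\<Pi>\<^sub>M p\<in>{..n}. \<Pi>\<^sub>M i\<in>{..<N}. E p)"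

text \<open>\<open>\<xi> n \<omega> i\<close> is the position of the \<open>i\<close>-th particle at time \<open>n\<close>. Conditional independence
  with the prescribed laws is stated as the product formula for the conditional probabilities of
  measurable rectangles.\<close>

definition particle_system ::
  "(nat \<Rightarrow> 'a measure) \<Rightarrow> 'a kernels \<Rightarrow> 'a measure \<Rightarrow> nat \<Rightarrow> 'w measure \<Rightarrow>
   (nat \<Rightarrow> 'w \<Rightarrow> nat \<Rightarrow> 'a) \<Rightarrow> bool" where
  "particle_system E K \<eta>0 N P \<xi> \<longleftrightarrow>
     prob_space P \<and>
     (\<forall>n. \<xi> n \<in> P \<rightarrow>\<^sub>M (\<Pi>\<^sub>M i\<in>{..<N}. E n)) \<and>
     prob_space.indep_vars P (\<lambda>_. E 0) (\<lambda>i \<omega>. \<xi> 0 \<omega> i) {..<N} \<and>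
     (\<forall>i<N. distr P (E 0) (\<lambda>\<omega>. \<xi> 0 \<omega> i) = \<eta>0) \<and>
     (\<forall>n. \<forall>A\<in>{..<N} \<rightarrow> sets (E (Suc n)).
        AE \<omega> in P.
          real_cond_exp P (history E N P \<xi> n)
            (indicator {\<omega>\<in>space P. \<forall>i<N. \<xi> (Suc n) \<omega> i \<in> A i}) \<omega>
          = (\<Prod>i<N. measure (K (Suc n) (empirical (E n) N (\<xi> n \<omega>)) (\<xi> n \<omega> i)) (A i)))"

text \<open>The fluctuation field \<open>W\<^sup>N\<^sub>n(f)\<close> of the \<open>N\<close>-particle system.\<close>

definition WN ::
  "(nat \<Rightarrow> 'a measure) \<Rightarrow> 'a kernels \<Rightarrow> 'a measure \<Rightarrow> nat \<Rightarrow> (nat \<Rightarrow> 'w \<Rightarrow> nat \<Rightarrow> 'a) \<Rightarrow>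
   nat \<Rightarrow> ('a \<Rightarrow> real) \<Rightarrow> 'w \<Rightarrow> real" where
  "WN E K \<eta>0 N \<xi> n f \<omega> = sqrt (real N) * diff_int (empirical (E n) N (\<xi> n \<omega>)) (flow K \<eta>0 n) f"

section \<open>The limiting Gaussian fields\<close>

text \<open>Degenerate Gaussian variables are allowed.\<close>

definition centered_gaussian :: "'v measure \<Rightarrow> ('v \<Rightarrow> real) \<Rightarrow> bool" where
  "centered_gaussian Q Y \<longleftrightarrow>
     Y \<in> borel_measurable Q \<and>
     (distr Q borel Y = return borel 0 \<or>
      (\<exists>\<sigma>>0. distributed Q lborel Y (\<lambda>x. ennreal (normal_density 0 \<sigma> x))))"

definition centered_gaussian_field ::
  "'v measure \<Rightarrow> 'i set \<Rightarrow> ('i \<Rightarrow> 'v \<Rightarrow> real) \<Rightarrow> bool" where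
  "centered_gaussian_field Q I Y \<longleftrightarrow>
     (\<forall>S c. finite S \<longrightarrow> S \<subseteq> I \<longrightarrow> centered_gaussian Q (\<lambda>\<omega>. \<Sum>f\<in>S. c f * Y f \<omega>))"

primrec local_cov ::
  "'a kernels \<Rightarrow> 'a measure \<Rightarrow> nat \<Rightarrow> ('a \<Rightarrow> real) \<Rightarrow> ('a \<Rightarrow> real) \<Rightarrow> real" where
  "local_cov K \<eta>0 0 f g = (\<integral>y. (f y - (\<integral>z. f z \<partial>\<eta>0)) * (g y - (\<integral>z. g z \<partial>\<eta>0)) \<partial>\<eta>0)"
| "local_cov K \<eta>0 (Suc n) f g =
     (let \<eta> = flow K \<eta>0 n; L = K (Suc n) \<eta> in
      \<integral>x. (\<integral>y. (f y - (\<integral>z. f z \<partial>L x)) * (g y - (\<integral>z. g z \<partial>L x)) \<partial>L x) \<partial>\<eta>)"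

definition limit_fields ::
  "(nat \<Rightarrow> 'a measure) \<Rightarrow> 'a kernels \<Rightarrow> 'a measure \<Rightarrow> 'v measure \<Rightarrow>
   (nat \<Rightarrow> ('a \<Rightarrow> real) \<Rightarrow> 'v \<Rightarrow> real) \<Rightarrow> bool" where
  "limit_fields E K \<eta>0 Q V \<longleftrightarrow>
     prob_space Q \<and>
     (\<forall>n. centered_gaussian_field Q (bfun (E n)) (V n)) \<and>
     prob_space.indep_vars Q (\<lambda>n. \<Pi>\<^sub>M f\<in>bfun (E n). (borel :: real measure))
       (\<lambda>n \<omega>. \<lambda>f\<in>bfun (E n). V n f \<omega>) UNIV \<and>
     (\<forall>n. \<forall>f\<in>bfun (E n). \<forall>g\<in>bfun (E n).
        (\<integral>\<omega>. V n f \<omega> * V n g \<omega> \<partial>Q) = local_cov K \<eta>0 n f g)"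

type_synonym 'a derivs = "nat \<Rightarrow> 'a measure \<Rightarrow> ('a \<Rightarrow> real) \<Rightarrow> ('a \<Rightarrow> real)"

text \<open>\<open>D n \<eta>\<close> stands for \<open>D\<^sub>\<eta> \<Phi>\<^sub>n\<close>, \<open>n \<ge> 1\<close>; \<open>semigroup_D \<dots> p n\<close> is the composition
  \<open>\<D>\<^sub>p\<^sub>+\<^sub>1 \<D>\<^sub>p\<^sub>+\<^sub>2 \<dots> \<D>\<^sub>n\<close>, the identity if \<open>p = n\<close>.\<close>

definition semigroup_D ::
  "'a kernels \<Rightarrow> 'a measure \<Rightarrow> 'a derivs \<Rightarrow> nat \<Rightarrow> nat \<Rightarrow> ('a \<Rightarrow> real) \<Rightarrow> ('a \<Rightarrow> real)" where
  "semigroup_D K \<eta>0 D p n = foldr (\<circ>) (map (\<lambda>k. D (Suc k) (flow K \<eta>0 k)) [p..<n]) id"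

definition W ::
  "'a kernels \<Rightarrow> 'a measure \<Rightarrow> 'a derivs \<Rightarrow> (nat \<Rightarrow> ('a \<Rightarrow> real) \<Rightarrow> 'v \<Rightarrow> real) \<Rightarrow>
   nat \<Rightarrow> ('a \<Rightarrow> real) \<Rightarrow> 'v \<Rightarrow> real" where
  "W K \<eta>0 D V n f \<omega> = (\<Sum>p\<le>n. V p (semigroup_D K \<eta>0 D p n f) \<omega>)"

section \<open>Large and moderate deviation principles\<close>

definition ext_ln :: "real \<Rightarrow> ereal" where
  "ext_ln x = (if x = 0 then - \<infinity> else ereal (ln x))"

definition good_rate_function :: "('s::topological_space \<Rightarrow> ereal) \<Rightarrow> bool" where
  "good_rate_function I \<longleftrightarrow> (\<forall>x. 0 \<le> I x) \<and> (\<forall>a::real. compact {x. I x \<le> ereal a})"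

text \<open>The sequences are indexed by \<open>N \<ge> 1\<close>; the \<open>N\<close>-th variable may live on its own
  probability space \<open>P N\<close>.\<close>

definition LDP ::
  "(nat \<Rightarrow> 'w measure) \<Rightarrow> 's measure \<Rightarrow> (nat \<Rightarrow> 'w \<Rightarrow> 's::topological_space) \<Rightarrow>
   (nat \<Rightarrow> real) \<Rightarrow> ('s \<Rightarrow> ereal) \<Rightarrow> bool" where
  "LDP P S Y \<alpha> I \<longleftrightarrow>
     space S = UNIV \<and>
     (\<forall>N\<ge>1. prob_space (P N) \<and> Y N \<in> P N \<rightarrow>\<^sub>M S) \<and>
     filterlim \<alpha> at_top sequentially \<and>
     good_rate_function I \<and>
     (\<forall>A\<in>sets S.
        let r = (\<lambda>N. ereal (1 / \<alpha> N) * ext_ln (measure (P N) {\<omega>\<in>space (P N). Y N \<omega> \<in> A}))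
        in - (INF x\<in>interior A. I x) \<le> liminf r \<and>
           liminf r \<le> limsup r \<and>
           limsup r \<le> - (INF x\<in>closure A. I x))"

definition MDP ::
  "(nat \<Rightarrow> 'w measure) \<Rightarrow> 's measure \<Rightarrow> (nat \<Rightarrow> 'w \<Rightarrow> 's::real_normed_vector) \<Rightarrow>
   (nat \<Rightarrow> real) \<Rightarrow> ('s \<Rightarrow> ereal) \<Rightarrow> bool" where
  "MDP P S Y \<alpha> I \<longleftrightarrow> LDP P S (\<lambda>N \<omega>. Y N \<omega> /\<^sub>R sqrt (\<alpha> N)) \<alpha> I"

definition rate_W ::
  "'a kernels \<Rightarrow> 'a measure \<Rightarrow> 'a derivs \<Rightarrow> 'v measure \<Rightarrow>
   (nat \<Rightarrow> ('a \<Rightarrow> real) \<Rightarrow> 'v \<Rightarrow> real) \<Rightarrow> nat \<Rightarrow> ('d::finite \<Rightarrow> 'a \<Rightarrow> real) \<Rightarrow>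
   real ^ 'd \<Rightarrow> ereal" where
  "rate_W K \<eta>0 D Q V n f v =
     (SUP u::real ^ 'd. ereal (u \<bullet> v - 1 / 2 *
        (\<integral>\<omega>. (\<Sum>i\<in>UNIV. u $ i * W K \<eta>0 D V n (f i) \<omega>)\<^sup>2 \<partial>Q)))"

definition cov_W ::
  "'a kernels \<Rightarrow> 'a measure \<Rightarrow> 'a derivs \<Rightarrow> 'v measure \<Rightarrow>
   (nat \<Rightarrow> ('a \<Rightarrow> real) \<Rightarrow> 'v \<Rightarrow> real) \<Rightarrow> nat \<Rightarrow> ('d::finite \<Rightarrow> 'a \<Rightarrow> real) \<Rightarrow>
   real ^ 'd ^ 'd" where
  "cov_W K \<eta>0 D Q V n f =
     (\<chi> i j. \<integral>\<omega>. W K \<eta>0 D V n (f i) \<omega> * W K \<eta>0 D V n (f j) \<omega> \<partial>Q)"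

end

theory Submission
  imports Defs
begin

text \<open>By the Gaertner-Ellis theorem it suffices to show that, for every bounded \<open>f\<close>, the sequence
  \<open>1/\<alpha>(N) log E exp(sqrt(\<alpha>(N)) W\<^sup>N\<^sub>n(f))\<close> tends to half the variance of \<open>W\<^sub>n(f)\<close>; a degenerate covariance is
  allowed, because the quadratic limit is differentiable everywhere. This is shown by induction on \<open>n\<close>.
  Given the particles at time \<open>n - 1\<close>, those at time \<open>n\<close> are independent, and a second order expansion of
  their conditional Laplace transforms produces the empirical local variance. The regularity of
  \<open>\<Phi>\<^sub>n\<close> turns the conditional mean into \<open>W\<^sup>N\<^sub>n\<^sub>-\<^sub>1(\<D>\<^sub>n f)\<close> plus a remainder. This remainder, and
  the difference between the empirical local variance and its limit, are integrals of products and absolute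
  values of fluctuations \<open>W\<^sup>N\<^sub>n\<^sub>-\<^sub>1(g)\<close>. The latter are sub-Gaussian uniformly in \<open>N\<close> and in \<open>g\<close> with
  oscillation at most 1, so both errors are negligible on the exponential scale since \<open>\<alpha>(N)/N\<close> tends to 0.\<close>

section \<open>Exponential moments\<close>

text \<open>The fluctuations enter at the scale \<open>t = s * sqrt (\<alpha> N)\<close>. An error
  that is merely small in probability is of no use there: it sits in an exponent and must have
  exponential moments of size exp (o(\<alpha> N)) for every multiple \<open>s\<close>. Such errors
  are split off by a Hoelder-type inequality, which needs the Laplace limit of the main term at all
  multiples near 1; hence the induction runs over all \<open>f\<close> and all \<open>s\<close>. The
  second order remainder is treated twice. A crude bound replaces one of its two fluctuations by the
  maximum \<open>sqrt N\<close>; what is left is linear, so sub-Gaussian bounds pass from one time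
  to the next with constants free of \<open>N\<close>. Only then are exponential moments of squares
  available, and they give the sharp statement: at scale \<open>t\<close> the remainder is
  \<open>sqrt (\<alpha> N / N)\<close> times a variable that has, at a fixed small parameter, an
  exponential moment bounded in \<open>N\<close>. Integrals over the unknown families of test
  functions are moved outside the exponential by convexity, after each test function has been
  divided by its oscillation.\<close>

lemma exp_quadratic_remainder:
  fixes y :: real
  assumes "\<bar>y\<bar> \<le> 1"
  shows "\<bar>exp y - (1 + y + y\<^sup>2 / 2)\<bar> \<le> \<bar>y\<bar> ^ 3 / 2"
proof -
  obtain t where t: "\<bar>t\<bar> \<le> \<bar>y\<bar>" "exp y = (\<Sum>m<3. y ^ m / fact m) + exp t / fact 3 * y ^ 3"
    using Maclaurin_exp_le[of y 3] by blast
  have "exp t \<le> exp 1"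
    using t(1) assms by simp
  also have "\<dots> \<le> (3::real)"
    using exp_le by simp
  \<comment> \<open>The bound 3 for \<open>exp 1\<close> turns the Lagrange factor 1/6 into
    1/2.\<close>
  finally have e: "exp t / 6 \<le> 1 / 2"
    by simp
  have "exp y - (1 + y + y\<^sup>2 / 2) = exp t / 6 * y ^ 3"
    unfolding t(2) by (simp add: eval_nat_numeral)
  then have "\<bar>exp y - (1 + y + y\<^sup>2 / 2)\<bar> = exp t / 6 * \<bar>y\<bar> ^ 3"
    by (simp only: abs_mult power_abs) simp
  also have "\<dots> \<le> 1 / 2 * \<bar>y\<bar> ^ 3"
    using e by (intro mult_right_mono) auto
  finally show ?thesis by simp
qed

text \<open>Third order precision is what the use for \<open>N\<close> particles requires: with
  \<theta> of order \<open>sqrt (\<alpha> N / N)\<close> the errors add up to \<alpha> N times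
  \<open>sqrt (\<alpha> N / N)\<close>, which is small compared with \<alpha> N. The linear term
  vanishes because \<open>h\<close> is centred.\<close>

lemma (in prob_space) ln_mgf_expansion:
  fixes h :: "'a \<Rightarrow> real"
  assumes h[measurable]: "h \<in> borel_measurable M"
    and bound: "\<And>x. x \<in> space M \<Longrightarrow> \<bar>h x - expectation h\<bar> \<le> c"
    and \<theta>: "\<bar>\<theta>\<bar> * c \<le> 1 / 2"
  shows "0 < expectation (\<lambda>x. exp (\<theta> * (h x - expectation h)))"
    and "\<bar>ln (expectation (\<lambda>x. exp (\<theta> * (h x - expectation h))))
            - \<theta>\<^sup>2 / 2 * expectation (\<lambda>x. (h x - expectation h)\<^sup>2)\<bar> \<le> 2 * (\<bar>\<theta>\<bar> * c) ^ 3"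
proof -
  let ?m = "expectation h"
  define g where "g = (\<lambda>x. h x - ?m)"
  have [measurable]: "g \<in> borel_measurable M" unfolding g_def by simp
  have gb: "x \<in> space M \<Longrightarrow> \<bar>g x\<bar> \<le> c" for x unfolding g_def using bound by simp
  have c0: "0 \<le> c" using gb not_empty by force
  define y where "y = \<bar>\<theta>\<bar> * c"
  have y: "0 \<le> y" "y \<le> 1 / 2" using c0 \<theta> by (auto simp: y_def)
  have ty: "x \<in> space M \<Longrightarrow> \<bar>\<theta> * g x\<bar> \<le> y" for x
    unfolding y_def abs_mult by (intro mult_left_mono gb) auto
  have "x \<in> space M \<Longrightarrow> \<bar>h x\<bar> \<le> c + \<bar>?m\<bar>" for x using gb[of x] unfolding g_def by linarith
  then have ih: "integrable M h" by (intro integrable_const_bound[where B = "c + \<bar>?m\<bar>"]) auto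
  have ig: "integrable M g" using ih unfolding g_def by auto
  have ig2: "integrable M (\<lambda>x. (g x)\<^sup>2)"
    using gb by (intro integrable_const_bound[where B = "c\<^sup>2"]) (auto simp: abs_le_square_iff[symmetric] c0)
  have ie: "integrable M (\<lambda>x. exp (\<theta> * g x))"
    using ty by (intro integrable_const_bound[where B = "exp y"]) (auto dest: abs_le_D1)
  have g0: "expectation g = 0" unfolding g_def using ih by (simp add: prob_space)
  let ?V = "expectation (\<lambda>x. (g x)\<^sup>2)"
  define e where "e = expectation (\<lambda>x. exp (\<theta> * g x)) - 1 - \<theta>\<^sup>2 / 2 * ?V"
  have i1: "integrable M (\<lambda>x. 1 + \<theta> * g x + (\<theta> * g x)\<^sup>2 / 2)"
    using ig ig2 by (auto simp: power_mult_distrib)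
  have "e = expectation (\<lambda>x. exp (\<theta> * g x) - (1 + \<theta> * g x + (\<theta> * g x)\<^sup>2 / 2))"
    using ie i1 ig ig2 g0 unfolding e_def by (simp add: power_mult_distrib prob_space)
  also have "\<bar>\<dots>\<bar> \<le> expectation (\<lambda>x. \<bar>exp (\<theta> * g x) - (1 + \<theta> * g x + (\<theta> * g x)\<^sup>2 / 2)\<bar>)"
    by (rule integral_abs_bound)
  also have "\<dots> \<le> expectation (\<lambda>_. y ^ 3 / 2)"
  proof (rule integral_mono)
    fix x assume x: "x \<in> space M"
    have "\<bar>exp (\<theta> * g x) - (1 + \<theta> * g x + (\<theta> * g x)\<^sup>2 / 2)\<bar> \<le> \<bar>\<theta> * g x\<bar> ^ 3 / 2"
      using ty[OF x] y by (intro exp_quadratic_remainder) linarith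
    also have "\<dots> \<le> y ^ 3 / 2"
      using ty[OF x] by (intro divide_right_mono power_mono) auto
    finally show "\<bar>exp (\<theta> * g x) - (1 + \<theta> * g x + (\<theta> * g x)\<^sup>2 / 2)\<bar> \<le> y ^ 3 / 2" .
  qed (use ie i1 in auto)
  also have "\<dots> = y ^ 3 / 2" by (simp add: prob_space)
  finally have e: "\<bar>e\<bar> \<le> y ^ 3 / 2" .
  have V0: "0 \<le> ?V" by simp
  have "?V \<le> expectation (\<lambda>_. c\<^sup>2)"
    using gb ig2 by (intro integral_mono) (auto simp: abs_le_square_iff[symmetric] c0)
  then have "\<theta>\<^sup>2 * ?V \<le> \<theta>\<^sup>2 * c\<^sup>2" by (intro mult_left_mono) (auto simp: prob_space)
  then have V: "\<theta>\<^sup>2 / 2 * ?V \<le> y\<^sup>2 / 2" by (simp add: y_def power_mult_distrib)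
  define x where "x = \<theta>\<^sup>2 / 2 * ?V + e"
  have y32: "y ^ 3 \<le> y\<^sup>2" using y by (intro power_decreasing) auto
  have "\<bar>x\<bar> \<le> y\<^sup>2"
  proof -
    have "0 \<le> \<theta>\<^sup>2 / 2 * ?V" using V0 by simp
    then show ?thesis using V e y32 unfolding x_def by linarith
  qed
  moreover have "y\<^sup>2 \<le> 1 / 4" using power_mono[OF y(2) y(1), of 2] by (simp add: power2_eq_square)
  ultimately have xb: "\<bar>x\<bar> \<le> y\<^sup>2" "\<bar>x\<bar> \<le> 1 / 2" by auto
  have Ex: "expectation (\<lambda>x. exp (\<theta> * g x)) = 1 + x" unfolding x_def e_def by simp
  then show "0 < expectation (\<lambda>x. exp (\<theta> * (h x - expectation h)))"
    using xb(2) unfolding g_def by linarith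
  \<comment> \<open>Since \<open>x\<close> is of order y^2, the quadratic error of the logarithm is
    of order y^4, and \<open>y \<le> 1 / 2\<close> turns 2 y^4 into y^3. Together with the bound on
    \<open>e\<close> the total stays below 2 y^3.\<close>
  have "\<bar>ln (1 + x) - x\<bar> \<le> 2 * x\<^sup>2" using xb(2) by (rule abs_ln_one_plus_x_minus_x_bound)
  also have "x\<^sup>2 \<le> (y\<^sup>2)\<^sup>2" using power_mono[OF xb(1), of 2] by simp
  also have "2 * (y\<^sup>2)\<^sup>2 = (2 * y) * y ^ 3" by (simp add: power2_eq_square eval_nat_numeral)
  also have "\<dots> \<le> 1 * y ^ 3" using y by (intro mult_right_mono) auto
  finally have "\<bar>ln (1 + x) - x\<bar> \<le> y ^ 3" by simp
  moreover have "0 \<le> y ^ 3" using y by simp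
  ultimately have "\<bar>ln (1 + x) - \<theta>\<^sup>2 / 2 * ?V\<bar> \<le> 2 * y ^ 3"
    using e unfolding x_def by linarith
  then show "\<bar>ln (expectation (\<lambda>x. exp (\<theta> * (h x - expectation h))))
            - \<theta>\<^sup>2 / 2 * expectation (\<lambda>x. (h x - expectation h)\<^sup>2)\<bar> \<le> 2 * (\<bar>\<theta>\<bar> * c) ^ 3"
    unfolding Ex[symmetric] y_def g_def .
qed

text \<open>Hoeffding's lemma for the centred variable on the interval [-c, c]: its constant (2c)^2
  / 8 is c^2 / 2.\<close>

lemma (in prob_space) hoeffding_mgf:
  fixes h :: "'a \<Rightarrow> real"
  assumes h[measurable]: "h \<in> borel_measurable M"
    and bound: "\<And>x. x \<in> space M \<Longrightarrow> \<bar>h x - expectation h\<bar> \<le> c"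
  shows "(\<integral>\<^sup>+x. ennreal (exp (s * (h x - expectation h))) \<partial>M) \<le> ennreal (exp (s\<^sup>2 * c\<^sup>2 / 2))"
proof -
  have pos: "(\<integral>\<^sup>+x. ennreal (exp (l * g x)) \<partial>M) \<le> ennreal (exp (l\<^sup>2 * c\<^sup>2 / 2))"
    if l: "l > 0" and [measurable]: "g \<in> borel_measurable M"
      and gb: "\<And>x. x \<in> space M \<Longrightarrow> \<bar>g x\<bar> \<le> c" and g0: "expectation g = 0" for l g
  proof -
    interpret interval_bounded_random_variable M g "- c" c
    proof unfold_locales
      show "AE x in M. g x \<in> {- c..c}" using gb by (intro AE_I2) (force simp: abs_le_iff)
    qed simp
    show ?thesis using Hoeffdings_lemma_nn_integral_0[OF l g0] by (simp add: power2_eq_square mult_ac)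
  qed
  have "\<bar>h x\<bar> \<le> c + \<bar>expectation h\<bar>" if "x \<in> space M" for x
    using bound[OF that] by linarith
  then have ih: "integrable M h"
    by (intro integrable_const_bound[where B = "c + \<bar>expectation h\<bar>"]) auto
  consider "s > 0" | "s = 0" | "s < 0" by linarith
  then show ?thesis
  proof cases
    case 1
    then show ?thesis using ih bound by (intro pos) (auto simp: prob_space)
  next
    case 2
    then show ?thesis by (simp add: emeasure_space_1)
  next
    \<comment> \<open>A negative \<open>s\<close> is moved to the reflected variable, which obeys
      the same bound.\<close>
    case 3
    have "(\<integral>\<^sup>+x. ennreal (exp ((- s) * (expectation h - h x))) \<partial>M) \<le> ennreal (exp ((- s)\<^sup>2 * c\<^sup>2 / 2))"
      using 3 ih bound by (intro pos) (auto simp: prob_space abs_minus_commute)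
    then show ?thesis by (simp add: algebra_simps)
  qed
qed

text \<open>A discrete form of writing a Gaussian exponential as a mixture of linear ones: exp (x^2
  / (8 b)) is dominated by a series of terms exp (k x - b k^2), each controlled by the hypothesis.
  The bound depends on \<open>c\<close> alone, hence is uniform over all variables that share
  \<open>c\<close>.\<close>

lemma (in prob_space) exp_square_moment:
  assumes [measurable]: "X \<in> borel_measurable M"
    and c: "c \<ge> 1"
    and sub: "\<And>s. s \<ge> 0 \<Longrightarrow> (\<integral>\<^sup>+x. ennreal (exp (s * \<bar>X x\<bar>)) \<partial>M) \<le> ennreal (c * exp (c * s\<^sup>2))"
  shows "(\<integral>\<^sup>+x. ennreal (exp ((X x)\<^sup>2 / (8 * (c + 1)))) \<partial>M)
    \<le> ennreal (exp (2 * (c + 1)) * c * (\<Sum>k. exp (- real k)))"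
proof -
  \<comment> \<open>With one more than \<open>c\<close> the k-th term is at most a constant times
    exp (c k^2 - b k^2) = exp (- k^2), which is summable.\<close>
  define b where "b = c + 1"
  have b: "b \<ge> 2" using c by (simp add: b_def)
  have sm: "summable (\<lambda>k. exp (- real k))"
  proof -
    have "summable (\<lambda>k. (exp (-1) :: real) ^ k)" by (rule summable_geometric) auto
    then show ?thesis by (simp add: exp_of_nat_mult[symmetric])
  qed
  text \<open>With \<open>k\<close> the integer part of \<open>x / (2 b)\<close>, the exponent \<open>k x - b k\<^sup>2\<close> is quadratic in \<open>x\<close>.\<close>
  have pt: "ennreal (exp (x\<^sup>2 / (8 * b))) \<le> (\<Sum>k. ennreal (exp (2 * b) * exp (real k * x - b * (real k)\<^sup>2)))"
    if x: "x \<ge> 0" for x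
  proof -
    define k where "k = nat \<lfloor>x / (2 * b)\<rfloor>"
    have k: "real k \<le> x / (2 * b)" "x / (2 * b) - 1 \<le> real k"
      using x b unfolding k_def by (auto simp: of_nat_nat)
    have "x\<^sup>2 / (8 * b) \<le> 2 * b + (x / (2 * b) - 1) * x - b * (x / (2 * b))\<^sup>2"
    proof -
      \<comment> \<open>The exponent is largest at k = x / (2 b), with value x^2 / (4 b). Rounding
        down costs at most x, and half of that value absorbs the cost up to the constant 2
        b.\<close>
      have "2 * b + (x / (2 * b) - 1) * x - b * (x / (2 * b))\<^sup>2 - x\<^sup>2 / (8 * b) = (x - 4 * b)\<^sup>2 / (8 * b)"
        using b by (simp add: field_simps power2_eq_square)
      moreover have "0 \<le> (x - 4 * b)\<^sup>2 / (8 * b)" using b by simp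
      ultimately show ?thesis by linarith
    qed
    also have "\<dots> \<le> 2 * b + real k * x - b * (real k)\<^sup>2"
    proof -
      have "(x / (2 * b) - 1) * x \<le> real k * x" using k x by (intro mult_right_mono) auto
      moreover have "b * (real k)\<^sup>2 \<le> b * (x / (2 * b))\<^sup>2"
        using k b by (intro mult_left_mono power_mono) auto
      ultimately show ?thesis by linarith
    qed
    finally have "exp (x\<^sup>2 / (8 * b)) \<le> exp (2 * b) * exp (real k * x - b * (real k)\<^sup>2)"
      by (simp add: exp_add[symmetric] algebra_simps)
    then have "ennreal (exp (x\<^sup>2 / (8 * b))) \<le> ennreal (exp (2 * b) * exp (real k * x - b * (real k)\<^sup>2))"
      by (rule ennreal_leI)
    also have "\<dots> \<le> (\<Sum>k. ennreal (exp (2 * b) * exp (real k * x - b * (real k)\<^sup>2)))"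
    proof -
      have "sum F {k} \<le> suminf F" for F :: "nat \<Rightarrow> ennreal"
        by (rule sum_le_suminf) auto
      then show ?thesis by simp
    qed
    finally show ?thesis .
  qed
  have "(\<integral>\<^sup>+x. ennreal (exp ((X x)\<^sup>2 / (8 * b))) \<partial>M)
     \<le> (\<integral>\<^sup>+x. (\<Sum>k. ennreal (exp (2 * b) * exp (real k * \<bar>X x\<bar> - b * (real k)\<^sup>2))) \<partial>M)"
    by (rule nn_integral_mono) (use pt[OF abs_ge_zero] in \<open>simp only: power2_abs\<close>)
  also have "\<dots> = (\<Sum>k. \<integral>\<^sup>+x. ennreal (exp (2 * b) * exp (real k * \<bar>X x\<bar> - b * (real k)\<^sup>2)) \<partial>M)"
    by (rule nn_integral_suminf) simp
  also have "\<dots> \<le> (\<Sum>k. ennreal (exp (2 * b) * c * exp (- real k)))"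
  proof (intro suminf_le summableI)
    fix k
    have "(\<integral>\<^sup>+x. ennreal (exp (2 * b) * exp (real k * \<bar>X x\<bar> - b * (real k)\<^sup>2)) \<partial>M)
        = (\<integral>\<^sup>+x. ennreal (exp (2 * b - b * (real k)\<^sup>2)) * ennreal (exp (real k * \<bar>X x\<bar>)) \<partial>M)"
      by (intro nn_integral_cong) (simp add: ennreal_mult[symmetric] exp_add[symmetric] algebra_simps)
    also have "\<dots> = ennreal (exp (2 * b - b * (real k)\<^sup>2)) * (\<integral>\<^sup>+x. ennreal (exp (real k * \<bar>X x\<bar>)) \<partial>M)"
      by (rule nn_integral_cmult) simp
    also have "\<dots> \<le> ennreal (exp (2 * b - b * (real k)\<^sup>2)) * ennreal (c * exp (c * (real k)\<^sup>2))"
      by (intro mult_left_mono sub) auto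
    also have "\<dots> = ennreal (exp (2 * b) * c * exp (- (real k)\<^sup>2))"
      using c by (simp add: ennreal_mult[symmetric] exp_add[symmetric] b_def algebra_simps)
    also have "\<dots> \<le> ennreal (exp (2 * b) * c * exp (- real k))"
    proof -
      have "real k \<le> (real k)\<^sup>2" by (cases "k = 0") (auto simp: power2_eq_square)
      then show ?thesis using c by (intro ennreal_leI mult_left_mono) auto
    qed
    finally show "(\<integral>\<^sup>+x. ennreal (exp (2 * b) * exp (real k * \<bar>X x\<bar> - b * (real k)\<^sup>2)) \<partial>M)
      \<le> ennreal (exp (2 * b) * c * exp (- real k))" .
  qed
  also have "\<dots> = ennreal (exp (2 * b) * c * (\<Sum>k. exp (- real k)))"
    using c suminf_mult[OF sm, of "exp (2 * b) * c"]
    by (subst suminf_ennreal2) (auto intro!: summable_mult sm)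
  finally show ?thesis unfolding b_def .
qed

text \<open>Jensen's inequality for the probability measure proportional to \<open>w dR\<close>, followed by
  Tonelli's theorem.\<close>

lemma (in prob_space) exp_moment_mixture:
  fixes Y :: "'a \<Rightarrow> 'g \<Rightarrow> real" and w :: "'g \<Rightarrow> ennreal"
  assumes w[measurable]: "w \<in> borel_measurable R"
    and wm: "(\<integral>\<^sup>+g. w g \<partial>R) \<le> ennreal m" "0 \<le> m"
    and Y[measurable]: "(\<lambda>(\<omega>, g). Y \<omega> g) \<in> borel_measurable (M \<Otimes>\<^sub>M R)"
    and Y0: "\<And>\<omega> g. \<omega> \<in> space M \<Longrightarrow> g \<in> space R \<Longrightarrow> 0 \<le> Y \<omega> g"
    and YB: "\<And>\<omega> g. \<omega> \<in> space M \<Longrightarrow> g \<in> space R \<Longrightarrow> Y \<omega> g \<le> B * enn2real (w g)"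
    and wfin: "\<And>g. g \<in> space R \<Longrightarrow> w g < \<infinity>"
    and mom: "\<And>g. g \<in> space R \<Longrightarrow> w g \<noteq> 0 \<Longrightarrow>
       (\<integral>\<^sup>+\<omega>. ennreal (exp (s * m * (Y \<omega> g / enn2real (w g)))) \<partial>M) \<le> ennreal C"
    and C: "1 \<le> C" and s: "0 \<le> s"
    and r: "\<And>\<omega>. \<omega> \<in> space M \<Longrightarrow> ennreal \<bar>r \<omega>\<bar> \<le> (\<integral>\<^sup>+g. ennreal (Y \<omega> g) \<partial>R)"
  shows "(\<integral>\<^sup>+\<omega>. ennreal (exp (s * \<bar>r \<omega>\<bar>)) \<partial>M) \<le> ennreal C"
proof -
  \<comment> \<open>Division by 0 gives 0. Where \<open>w g\<close> vanishes, \<open>YB\<close>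
    forces \<open>Y\<close> to vanish too, so \<open>Y\<close> is \<open>w\<close> times
    \<open>q\<close> everywhere.\<close>
  define q where "q = (\<lambda>\<omega> g. Y \<omega> g / enn2real (w g))"
  have q[measurable]: "(\<lambda>(\<omega>, g). q \<omega> g) \<in> borel_measurable (M \<Otimes>\<^sub>M R)"
    unfolding q_def by measurable
  have q0: "0 \<le> q \<omega> g" if "\<omega> \<in> space M" "g \<in> space R" for \<omega> g
    using Y0[OF that] unfolding q_def by simp
  have qB: "q \<omega> g \<le> \<bar>B\<bar>" if "\<omega> \<in> space M" "g \<in> space R" for \<omega> g
  proof (cases "enn2real (w g) = 0")
    case False
    then have "0 < enn2real (w g)" by (simp add: less_le)
    then show ?thesis using YB[OF that] unfolding q_def by (simp add: divide_le_eq) (smt (verit) mult_right_mono)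
  qed (simp add: q_def)
  have Yq: "ennreal (Y \<omega> g) = w g * ennreal (q \<omega> g)" if wg: "\<omega> \<in> space M" "g \<in> space R" for \<omega> g
  proof -
    obtain a where a: "w g = ennreal a" "0 \<le> a" using wfin[OF wg(2)] by (cases "w g") auto
    show ?thesis
    proof (cases "a = 0")
      case True
      then show ?thesis using Y0[OF wg] YB[OF wg] a by simp
    next
      case False
      then show ?thesis using q0[OF wg] a unfolding q_def by (simp add: ennreal_mult[symmetric])
    qed
  qed
  obtain m' where m': "(\<integral>\<^sup>+g. w g \<partial>R) = ennreal m'" "0 \<le> m'"
    using wm by (cases "\<integral>\<^sup>+g. w g \<partial>R") (auto simp: top_unique)
  have m'm: "m' \<le> m" using wm m' by simp
  have rw: "ennreal \<bar>r \<omega>\<bar> \<le> (\<integral>\<^sup>+g. w g * ennreal (q \<omega> g) \<partial>R)" if "\<omega> \<in> space M" for \<omega>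
    using r[OF that] by (simp add: Yq[OF that] cong: nn_integral_cong_simp)
  show ?thesis
  proof (cases "m' = 0")
    \<comment> \<open>Total mass 0 cannot be normalised; the bound on \<open>r\<close> then gives r
      = 0 and a moment equal to 1.\<close>
    case True
    then have "AE g in R. w g = 0" using m' by (simp add: nn_integral_0_iff_AE)
    then have "(\<integral>\<^sup>+g. w g * ennreal (q \<omega> g) \<partial>R) = (\<integral>\<^sup>+g. 0 \<partial>R)" for \<omega>
      by (intro nn_integral_cong_AE) (auto elim: eventually_mono)
    then have "r \<omega> = 0" if "\<omega> \<in> space M" for \<omega> using rw[OF that] by simp
    then have "(\<integral>\<^sup>+\<omega>. ennreal (exp (s * \<bar>r \<omega>\<bar>)) \<partial>M) = (\<integral>\<^sup>+\<omega>. 1 \<partial>M)"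
      by (intro nn_integral_cong) simp
    then show ?thesis using C by (simp add: emeasure_space_1)
  next
    case False
    with m' have mp: "0 < m'" by simp
    \<comment> \<open>Normalised by the true mass \<open>m'\<close>; the given bound
      \<open>m\<close> replaces it only in front of a nonnegative integral.\<close>
    define \<nu> where "\<nu> = density R (\<lambda>g. w g / ennreal m')"
    have sets_\<nu>[measurable_cong, simp]: "sets \<nu> = sets R" and sp\<nu>[simp]: "space \<nu> = space R"
      unfolding \<nu>_def by auto
    have "emeasure \<nu> (space \<nu>) = (\<integral>\<^sup>+g. w g / ennreal m' \<partial>R)"
      unfolding \<nu>_def by (subst emeasure_density) (auto intro!: nn_integral_cong)
    also have "\<dots> = 1"
      using m' mp by (simp add: nn_integral_divide ennreal_divide_self)
    finally have "prob_space \<nu>" by (rule prob_spaceI)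
    then interpret \<nu>: prob_space \<nu> .
    interpret P: pair_sigma_finite M \<nu> ..
    have rb: "ennreal (exp (s * \<bar>r \<omega>\<bar>)) \<le> (\<integral>\<^sup>+g. ennreal (exp (s * m * q \<omega> g)) \<partial>\<nu>)"
      if \<omega>: "\<omega> \<in> space M" for \<omega>
    proof -
      have [measurable]: "q \<omega> \<in> borel_measurable R"
        using measurable_Pair2[OF q \<omega>] by simp
      have [measurable]: "q \<omega> \<in> borel_measurable \<nu>" by simp
      have iq: "integrable \<nu> (q \<omega>)"
        using q0[OF \<omega>] qB[OF \<omega>] by (intro \<nu>.integrable_const_bound[where B = "\<bar>B\<bar>"]) auto
      have ie: "integrable \<nu> (\<lambda>g. exp (s * m * q \<omega> g))"
        using q0[OF \<omega>] qB[OF \<omega>] s wm(2)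
        by (intro \<nu>.integrable_const_bound[where B = "exp (s * m * \<bar>B\<bar>)"]) (auto intro!: mult_left_mono)
      have E0: "0 \<le> (\<integral>g. q \<omega> g \<partial>\<nu>)"
        using q0[OF \<omega>] by (intro integral_nonneg_AE) auto
      have "(\<integral>\<^sup>+g. w g * ennreal (q \<omega> g) \<partial>R) = (\<integral>\<^sup>+g. ennreal m' * ((w g / ennreal m') * ennreal (q \<omega> g)) \<partial>R)"
      proof (intro nn_integral_cong)
        fix g assume g: "g \<in> space R"
        obtain a where a: "w g = ennreal a" "0 \<le> a" using wfin[OF g] by (cases "w g") auto
        show "w g * ennreal (q \<omega> g) = ennreal m' * ((w g / ennreal m') * ennreal (q \<omega> g))"
          using a mp by (simp add: divide_ennreal mult.assoc[symmetric] ennreal_mult[symmetric])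
      qed
      also have "\<dots> = ennreal m' * (\<integral>\<^sup>+g. ennreal (q \<omega> g) \<partial>\<nu>)"
        unfolding \<nu>_def by (subst nn_integral_density, (simp; fail), (simp; fail), rule nn_integral_cmult, simp)
      also have "\<dots> = ennreal (m' * (\<integral>g. q \<omega> g \<partial>\<nu>))"
        using q0[OF \<omega>] mp iq E0 by (subst nn_integral_eq_integral) (auto simp: ennreal_mult)
      finally have "ennreal \<bar>r \<omega>\<bar> \<le> ennreal (m' * (\<integral>g. q \<omega> g \<partial>\<nu>))"
        using rw[OF \<omega>] by simp
      then have "\<bar>r \<omega>\<bar> \<le> m' * (\<integral>g. q \<omega> g \<partial>\<nu>)"
        using mp E0 by (subst (asm) ennreal_le_iff) auto
      also have "\<dots> \<le> m * (\<integral>g. q \<omega> g \<partial>\<nu>)" using m'm E0 by (rule mult_right_mono)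
      finally have "s * \<bar>r \<omega>\<bar> \<le> s * (m * (\<integral>g. q \<omega> g \<partial>\<nu>))" using s by (rule mult_left_mono)
      also have "\<dots> = (\<integral>g. s * m * q \<omega> g \<partial>\<nu>)" by simp
      finally have "exp (s * \<bar>r \<omega>\<bar>) \<le> exp (\<integral>g. s * m * q \<omega> g \<partial>\<nu>)" by simp
      also have "\<dots> \<le> (\<integral>g. exp (s * m * q \<omega> g) \<partial>\<nu>)"
        using iq ie by (intro \<nu>.jensens_inequality[where I = UNIV]) (auto simp: exp_convex)
      finally have "ennreal (exp (s * \<bar>r \<omega>\<bar>)) \<le> ennreal (\<integral>g. exp (s * m * q \<omega> g) \<partial>\<nu>)"
        by (rule ennreal_leI)
      also have "\<dots> = (\<integral>\<^sup>+g. ennreal (exp (s * m * q \<omega> g)) \<partial>\<nu>)"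
        using ie by (intro nn_integral_eq_integral[symmetric]) auto
      finally show ?thesis .
    qed
    have "(\<integral>\<^sup>+\<omega>. ennreal (exp (s * \<bar>r \<omega>\<bar>)) \<partial>M) \<le> (\<integral>\<^sup>+\<omega>. \<integral>\<^sup>+g. ennreal (exp (s * m * q \<omega> g)) \<partial>\<nu> \<partial>M)"
      by (intro nn_integral_mono rb)
    also have "\<dots> = (\<integral>\<^sup>+g. \<integral>\<^sup>+\<omega>. ennreal (exp (s * m * q \<omega> g)) \<partial>M \<partial>\<nu>)"
      by (intro P.Fubini'[symmetric]) measurable
    also have "\<dots> \<le> (\<integral>\<^sup>+g. ennreal C \<partial>\<nu>)"
    proof (intro nn_integral_mono)
      fix g assume g: "g \<in> space \<nu>"
      show "(\<integral>\<^sup>+\<omega>. ennreal (exp (s * m * q \<omega> g)) \<partial>M) \<le> ennreal C"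
      \<comment> \<open>The moment hypothesis speaks of \<open>w g \<noteq> 0\<close> only;
        elsewhere \<open>q\<close> is 0 and the integrand is 1.\<close>
      proof (cases "w g = 0")
        case True
        then show ?thesis using C by (simp add: q_def emeasure_space_1)
      next
        case False
        then show ?thesis using mom g unfolding q_def by simp
      qed
    qed
    also have "\<dots> = ennreal C" using \<nu>.emeasure_space_1 by simp
    finally show ?thesis .
  qed
qed

section \<open>The Gaertner-Ellis theorem for quadratic limits\<close>

text \<open>Finiteness along the multiples of a kernel vector makes \<open>v\<close> orthogonal to the kernel of \<open>C\<close>,
  that is, an element of its range.\<close>

lemma quadratic_conjugate_finite_imp_range:
  fixes C :: "real ^ 'd ^ 'd"
  assumes sym: "transpose C = C"
    and bd: "\<And>u. u \<bullet> v - 1 / 2 * (u \<bullet> (C *v u)) \<le> b"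
  obtains u where "v = C *v u"
proof -
  have adj: "x \<bullet> (C *v y) = (C *v x) \<bullet> y" for x y
    using dot_lmul_matrix[of x C y] sym by (metis transpose_matrix_vector)
  have sub: "subspace (range ((*v) C))"
    by (intro linear_subspace_image) auto
  obtain y z where y: "y \<in> span (range ((*v) C))"
    and z: "\<And>w. w \<in> span (range ((*v) C)) \<Longrightarrow> orthogonal z w" and v: "v = y + z"
    using orthogonal_subspace_decomp_exists[of "range ((*v) C)" v] by metis
  have "C *v z = 0"
  proof -
    have "(C *v z) \<bullet> (C *v z) = z \<bullet> (C *v (C *v z))" by (simp add: adj)
    also have "\<dots> = 0" using z[OF span_base, of "C *v (C *v z)"] by (simp add: orthogonal_def)
    finally show ?thesis by simp
  qed
  moreover have "z \<bullet> v = z \<bullet> z"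
    using z[OF y] v by (simp add: orthogonal_def inner_add_right)
  ultimately have "t * (z \<bullet> z) \<le> b" for t
    using bd[of "t *\<^sub>R z"] by (simp add: matrix_vector_mult_scaleR)
  from this[of "(\<bar>b\<bar> + 1) / (z \<bullet> z)"] have "z \<bullet> z = 0" by (cases "z \<bullet> z = 0") auto
  then have "v = y" using v by simp
  then have "v \<in> range ((*v) C)" using y sub by (simp add: span_eq_iff[THEN iffD2])
  then show thesis using that by auto
qed

text \<open>Completing the square at \<open>w = matrix_inv C *v v\<close>: the exponent is its value
  at \<open>w\<close> minus half of the nonnegative form at \<open>u - w\<close>, so the supremum is
  attained at \<open>w\<close>.\<close>

lemma quadratic_conjugate_invertible:
  fixes C :: "real ^ 'd ^ 'd"
  assumes sym: "transpose C = C" and psd: "\<And>u. 0 \<le> u \<bullet> (C *v u)" and inv: "invertible C"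
  shows "(SUP u::real ^ 'd. ereal (u \<bullet> v - 1 / 2 * (u \<bullet> (C *v u)))) = ereal (1 / 2 * (v \<bullet> (matrix_inv C *v v)))"
proof -
  have adj: "x \<bullet> (C *v y) = (C *v x) \<bullet> y" for x y
    using dot_lmul_matrix[of x C y] sym by (metis transpose_matrix_vector)
  define w where "w = matrix_inv C *v v"
  have Cw: "C *v w = v"
  proof -
    have "C ** matrix_inv C = mat 1"
      using someI_ex[OF inv[unfolded invertible_def]] unfolding matrix_inv_def by simp
    then show ?thesis by (simp add: w_def matrix_vector_mul_assoc)
  qed
  have sq: "u \<bullet> v - 1 / 2 * (u \<bullet> (C *v u)) = 1 / 2 * (v \<bullet> w) - 1 / 2 * ((u - w) \<bullet> (C *v (u - w)))" for u
  proof -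
    have "(u - w) \<bullet> (C *v (u - w)) = u \<bullet> (C *v u) - u \<bullet> v - w \<bullet> (C *v u) + w \<bullet> v"
      by (simp add: matrix_vector_mult_diff_distrib inner_diff Cw)
    moreover have "w \<bullet> (C *v u) = u \<bullet> v" by (simp add: adj Cw inner_commute)
    ultimately show ?thesis by (simp add: inner_commute field_simps)
  qed
  show ?thesis
  proof (rule SUP_eqI)
    show "ereal (u \<bullet> v - 1 / 2 * (u \<bullet> (C *v u))) \<le> ereal (1 / 2 * (v \<bullet> (matrix_inv C *v v)))" for u
      using psd[of "u - w"] unfolding sq w_def[symmetric] by simp
    show "ereal (1 / 2 * (v \<bullet> (matrix_inv C *v v))) \<le> y"
      if "\<And>u. u \<in> UNIV \<Longrightarrow> ereal (u \<bullet> v - 1 / 2 * (u \<bullet> (C *v u))) \<le> y" for y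
      using that[of w] unfolding sq w_def[symmetric] by simp
  qed
qed

text \<open>Each level set is an intersection of closed half-spaces, one for each \<open>u\<close>,
  and the directions \<open>axis i 1\<close> and \<open>- axis i 1\<close> alone confine it to a
  cube. A degenerate \<open>C\<close> is covered; u = 0 gives nonnegativity.\<close>

lemma quadratic_conjugate_good:
  fixes C :: "real ^ 'd ^ 'd"
  shows "good_rate_function (\<lambda>v. SUP u::real ^ 'd. ereal (u \<bullet> v - 1 / 2 * (u \<bullet> (C *v u))))"
proof -
  let ?q = "\<lambda>u v. u \<bullet> v - 1 / 2 * (u \<bullet> (C *v u))"
  have "0 \<le> (SUP u. ereal (?q u v))" for v
    by (rule SUP_upper2[of 0]) auto
  moreover have "compact {v. (SUP u. ereal (?q u v)) \<le> ereal a}" for a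
  proof -
    have eq: "{v. (SUP u. ereal (?q u v)) \<le> ereal a} = (\<Inter>u. {v. ?q u v \<le> a})"
      by (auto simp: SUP_le_iff)
    have "closed (\<Inter>u. {v. ?q u v \<le> a})"
      by (intro closed_INT ballI closed_Collect_le continuous_intros)
    moreover have "bounded (\<Inter>u. {v. ?q u v \<le> a})"
    proof (rule bounded_subset[OF bounded_cbox])
      let ?b = "\<chi> i. \<bar>a\<bar> + \<bar>axis i 1 \<bullet> (C *v axis i 1)\<bar>"
      show "(\<Inter>u. {v. ?q u v \<le> a}) \<subseteq> cbox (- ?b) ?b"
      proof
        fix v assume v: "v \<in> (\<Inter>u. {v. ?q u v \<le> a})"
        have "\<bar>v $ i\<bar> \<le> \<bar>a\<bar> + \<bar>axis i 1 \<bullet> (C *v axis i 1)\<bar>" for i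
        proof -
          have "?q (axis i 1) v \<le> a" "?q (- axis i 1) v \<le> a" using v by blast+
          then have "v $ i - 1 / 2 * (axis i 1 \<bullet> (C *v axis i 1)) \<le> a"
            "- v $ i - 1 / 2 * (axis i 1 \<bullet> (C *v axis i 1)) \<le> a"
            by (auto simp: inner_axis' linear_neg[OF matrix_vector_mul_linear])
          then show ?thesis by linarith
        qed
        then have "- (\<bar>a\<bar> + \<bar>axis i 1 \<bullet> (C *v axis i 1)\<bar>) \<le> v $ i \<and> v $ i \<le> \<bar>a\<bar> + \<bar>axis i 1 \<bullet> (C *v axis i 1)\<bar>" for i
          unfolding abs_le_iff by (smt (verit))
        then show "v \<in> cbox (- ?b) ?b" by (simp add: mem_box_cart)
      qed
    qed
    ultimately show ?thesis unfolding eq by (simp add: compact_eq_bounded_closed)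
  qed
  ultimately show ?thesis unfolding good_rate_function_def by blast
qed

text \<open>The coordinate directions take care of the complement of a large cube.\<close>

lemma closed_finite_halfspace_cover:
  fixes F :: "(real ^ 'd) set" and \<Lambda> :: "real ^ 'd \<Rightarrow> real"
  assumes F: "closed F" and ex: "\<And>y. y \<in> F \<Longrightarrow> \<exists>u. l < u \<bullet> y - \<Lambda> u"
  obtains S where "finite S" "\<And>y. y \<in> F \<Longrightarrow> \<exists>u\<in>S. l < u \<bullet> y - \<Lambda> u"
proof -
  \<comment> \<open>Chosen so that outside the cube the signed unit vector of an exceeding
    coordinate already satisfies the inequality.\<close>
  define b :: "real ^ 'd" where "b = (\<chi> i. \<bar>l\<bar> + \<bar>\<Lambda> (axis i 1)\<bar> + \<bar>\<Lambda> (- axis i 1)\<bar> + 1)"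
  have c: "compact (F \<inter> cbox (- b) b)" using F by (simp add: closed_Int_compact)
  have op: "open {y. l < u \<bullet> y - \<Lambda> u}" for u
    by (intro open_Collect_less continuous_intros)
  have sub: "F \<inter> cbox (- b) b \<subseteq> (\<Union>u\<in>UNIV. {y. l < u \<bullet> y - \<Lambda> u})" using ex by auto
  obtain S0 where S0: "finite S0" "F \<inter> cbox (- b) b \<subseteq> (\<Union>u\<in>S0. {y. l < u \<bullet> y - \<Lambda> u})"
    by (rule compactE_image[OF c op sub])
  define S where "S = S0 \<union> range (\<lambda>i. axis i 1) \<union> range (\<lambda>i. - axis i 1)"
  have "finite S" unfolding S_def using S0 by simp
  moreover have "\<exists>u\<in>S. l < u \<bullet> y - \<Lambda> u" if y: "y \<in> F" for y
  proof (cases "y \<in> cbox (- b) b")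
    case True
    then show ?thesis using S0 y unfolding S_def by blast
  next
    case False
    then obtain i where "y $ i < - b $ i \<or> b $ i < y $ i"
      by (auto simp: mem_box_cart not_le)
    then show ?thesis
    proof
      assume "y $ i < - b $ i"
      then have "l < (- axis i 1) \<bullet> y - \<Lambda> (- axis i 1)" by (simp add: inner_axis' b_def)
      then show ?thesis unfolding S_def by blast
    next
      assume "b $ i < y $ i"
      then have "l < axis i 1 \<bullet> y - \<Lambda> (axis i 1)" by (simp add: inner_axis' b_def)
      then show ?thesis unfolding S_def by blast
    qed
  qed
  ultimately show thesis by (rule that)
qed

text \<open>Used with \<open>x\<close> an infimum of the rate function, which may be infinite and is
  then approached by real numbers.\<close>

lemma ereal_le_all_below:
  fixes x y :: ereal
  assumes "\<And>l. ereal l < x \<Longrightarrow> ereal l \<le> y"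
  shows "x \<le> y"
proof (rule ccontr)
  assume "\<not> x \<le> y"
  then obtain l where "y < ereal l" "ereal l < x" using ereal_dense2[of y x] by (auto simp: not_le)
  then show False using assms[of l] by simp
qed

lemma eventually_exp_bounds:
  fixes L \<alpha> :: "nat \<Rightarrow> real"
  assumes lim: "(\<lambda>N. ln (L N) / \<alpha> N) \<longlonglongrightarrow> x" and \<epsilon>: "0 < \<epsilon>"
    and pos: "eventually (\<lambda>N. 0 < L N \<and> 0 < \<alpha> N) sequentially"
  shows "eventually (\<lambda>N. exp (\<alpha> N * (x - \<epsilon>)) \<le> L N \<and> L N \<le> exp (\<alpha> N * (x + \<epsilon>))) sequentially"
proof -
  have "eventually (\<lambda>N. dist (ln (L N) / \<alpha> N) x < \<epsilon>) sequentially"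
    using lim \<epsilon> by (rule tendstoD)
  then show ?thesis using pos
  proof eventually_elim
    case (elim N)
    then have "x - \<epsilon> < ln (L N) / \<alpha> N" "ln (L N) / \<alpha> N < x + \<epsilon>" by (auto simp: dist_real_def)
    then have "\<alpha> N * (x - \<epsilon>) < ln (L N)" "ln (L N) < \<alpha> N * (x + \<epsilon>)"
      using elim by (auto simp: field_simps)
    then show ?case using elim by (metis exp_less_cancel_iff exp_ln less_imp_le)
  qed
qed

text \<open>Upper bound: finitely many half-spaces cover the closure, and each is handled by the
  exponential Markov inequality. Lower bound: the exponential tilt by some \<open>u\<close> with
  \<open>v = C *v u\<close> centres the mass at \<open>v\<close>, and differentiability of the limit
  makes half-spaces away from \<open>v\<close> negligible under the tilt. The tilted law is never
  normalised; only integrals of the exponential over events are compared.\<close>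

lemma gartner_ellis_quadratic:
  fixes Y :: "nat \<Rightarrow> 'w \<Rightarrow> real ^ 'd::finite" and C :: "real ^ 'd ^ 'd"
  assumes sym: "transpose C = C"
    and prob: "\<And>N. N \<ge> 1 \<Longrightarrow> prob_space (P N)"
    and Y: "\<And>N. N \<ge> 1 \<Longrightarrow> Y N \<in> P N \<rightarrow>\<^sub>M borel"
    and \<alpha>_pos: "\<And>N. N \<ge> 1 \<Longrightarrow> 0 < \<alpha> N" and \<alpha>: "filterlim \<alpha> at_top sequentially"
    and int: "\<And>N u. N \<ge> 1 \<Longrightarrow> integrable (P N) (\<lambda>\<omega>. exp (\<alpha> N * (u \<bullet> Y N \<omega>)))"
    and lim: "\<And>u. (\<lambda>N. ln (\<integral>\<omega>. exp (\<alpha> N * (u \<bullet> Y N \<omega>)) \<partial>P N) / \<alpha> N)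
                 \<longlonglongrightarrow> 1 / 2 * (u \<bullet> (C *v u))"
  shows "LDP P borel Y \<alpha> (\<lambda>v. SUP u::real ^ 'd. ereal (u \<bullet> v - 1 / 2 * (u \<bullet> (C *v u))))"
proof -
  define \<Lambda> where "\<Lambda> = (\<lambda>u. 1 / 2 * (u \<bullet> (C *v u)))"
  define L where "L = (\<lambda>N u. \<integral>\<omega>. exp (\<alpha> N * (u \<bullet> Y N \<omega>)) \<partial>P N)"
  define I where "I = (\<lambda>v. SUP u::real ^ 'd. ereal (u \<bullet> v - \<Lambda> u))"
  define r where "r = (\<lambda>A N. ereal (1 / \<alpha> N) * ext_ln (measure (P N) {\<omega>\<in>space (P N). Y N \<omega> \<in> A}))"
  have adj: "x \<bullet> (C *v y) = (C *v x) \<bullet> y" for x y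
    using dot_lmul_matrix[of x C y] sym by (metis transpose_matrix_vector)
  \<comment> \<open>Positivity turns the limits of \<open>ln (L N u)\<close> into two-sided bounds
    on \<open>L N u\<close>.\<close>
  have Lpos: "0 < L N u" if N: "N \<ge> 1" for N u
  proof -
    interpret prob_space "P N" using prob[OF N] .
    have "L N u \<noteq> 0"
    proof
      assume "L N u = 0"
      then have "AE \<omega> in P N. exp (\<alpha> N * (u \<bullet> Y N \<omega>)) = 0"
        unfolding L_def using int[OF N] by (subst (asm) integral_nonneg_eq_0_iff_AE) auto
      then show False by simp
    qed
    moreover have "0 \<le> L N u" unfolding L_def by simp
    ultimately show ?thesis by simp
  qed
  have ev1: "eventually (\<lambda>N. 1 \<le> N) sequentially" by (rule eventually_ge_at_top)
  have Lev: "eventually (\<lambda>N. exp (\<alpha> N * (\<Lambda> u - \<epsilon>)) \<le> L N u \<and> L N u \<le> exp (\<alpha> N * (\<Lambda> u + \<epsilon>))) sequentially"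
    if "0 < \<epsilon>" for u \<epsilon>
  proof (rule eventually_exp_bounds[OF _ that])
    show "(\<lambda>N. ln (L N u) / \<alpha> N) \<longlonglongrightarrow> \<Lambda> u" unfolding L_def \<Lambda>_def by (rule lim)
    show "eventually (\<lambda>N. 0 < L N u \<and> 0 < \<alpha> N) sequentially"
      using ev1 by eventually_elim (simp add: Lpos \<alpha>_pos)
  qed
  have \<alpha>_large: "eventually (\<lambda>N. b \<le> \<alpha> N * \<epsilon>) sequentially" if "0 < \<epsilon>" for b \<epsilon> :: real
  proof -
    have "eventually (\<lambda>N. b / \<epsilon> \<le> \<alpha> N) sequentially" using \<alpha> by (simp add: filterlim_at_top)
    then show ?thesis by eventually_elim (use that in \<open>simp add: pos_divide_le_eq\<close>)
  qed
  \<comment> \<open>Exponential Markov inequality with an extra tilt \<open>t\<close> in the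
    direction \<open>w\<close>. The upper bound uses it with u = 0 and t = 1, the lower bound around
    a nontrivial tilt \<open>u\<close>.\<close>
  have halfspace: "set_integrable (P N) {\<omega>\<in>space (P N). a \<le> w \<bullet> Y N \<omega>} (\<lambda>\<omega>. exp (\<alpha> N * (u \<bullet> Y N \<omega>)))"
    "(LINT \<omega>:{\<omega>\<in>space (P N). a \<le> w \<bullet> Y N \<omega>}|P N. exp (\<alpha> N * (u \<bullet> Y N \<omega>)))
      \<le> exp (- (\<alpha> N * t * a)) * L N (u + t *\<^sub>R w)" if N: "N \<ge> 1" and t: "0 \<le> t" for N u w a t
  proof -
    have [measurable]: "Y N \<in> borel_measurable (P N)" using Y[OF N] .
    have "{\<omega>\<in>space (P N). a \<le> w \<bullet> Y N \<omega>} \<in> sets (P N)" by measurable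
    then show si: "set_integrable (P N) {\<omega>\<in>space (P N). a \<le> w \<bullet> Y N \<omega>} (\<lambda>\<omega>. exp (\<alpha> N * (u \<bullet> Y N \<omega>)))"
      unfolding set_integrable_def using int[OF N] by (rule integrable_mult_indicator)
    show "(LINT \<omega>:{\<omega>\<in>space (P N). a \<le> w \<bullet> Y N \<omega>}|P N. exp (\<alpha> N * (u \<bullet> Y N \<omega>)))
      \<le> exp (- (\<alpha> N * t * a)) * L N (u + t *\<^sub>R w)"
      unfolding L_def integral_mult_right_zero[symmetric] set_lebesgue_integral_def
    proof (rule integral_mono)
      show "integrable (P N) (\<lambda>\<omega>. indicat_real {\<omega> \<in> space (P N). a \<le> w \<bullet> Y N \<omega>} \<omega> *\<^sub>R exp (\<alpha> N * (u \<bullet> Y N \<omega>)))"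
        using si unfolding set_integrable_def .
      show "integrable (P N) (\<lambda>\<omega>. exp (- (\<alpha> N * t * a)) * exp (\<alpha> N * ((u + t *\<^sub>R w) \<bullet> Y N \<omega>)))"
        using int[OF N] by simp
      fix \<omega>
      show "indicat_real {\<omega> \<in> space (P N). a \<le> w \<bullet> Y N \<omega>} \<omega> *\<^sub>R exp (\<alpha> N * (u \<bullet> Y N \<omega>))
        \<le> exp (- (\<alpha> N * t * a)) * exp (\<alpha> N * ((u + t *\<^sub>R w) \<bullet> Y N \<omega>))"
      proof (cases "a \<le> w \<bullet> Y N \<omega>")
        case True
        then have "\<alpha> N * t * a \<le> \<alpha> N * t * (w \<bullet> Y N \<omega>)"
          using t \<alpha>_pos[OF N] by (intro mult_left_mono) auto
        then show ?thesis
          by (auto simp: indicator_def exp_add[symmetric] inner_add_left algebra_simps)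
      qed (simp add: indicator_def)
    qed
  qed
  have upper: "limsup (r A) \<le> - (INF x\<in>closure A. I x)" if A: "A \<in> sets borel" for A
  proof -
    have "ereal l \<le> - limsup (r A)" if l: "ereal l < (INF x\<in>closure A. I x)" for l
    proof -
      have "\<exists>u. l < u \<bullet> y - \<Lambda> u" if "y \<in> closure A" for y
      proof -
        have "ereal l < I y" using l that by (meson INF_lower less_le_trans)
        then show ?thesis unfolding I_def by (simp add: less_SUP_iff)
      qed
      from closed_finite_halfspace_cover[OF closed_closure this]
      obtain S where S: "finite S" "\<And>y. y \<in> closure A \<Longrightarrow> \<exists>u\<in>S. l < u \<bullet> y - \<Lambda> u"
        by metis
      \<comment> \<open>One \<epsilon> pays for the Laplace limits, the other for the number of
        half-spaces, which is at most \<open>exp (\<alpha> N * \<epsilon>)\<close> for large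
        \<open>N\<close>.\<close>
      have bound: "limsup (r A) \<le> ereal (- l + 2 * \<epsilon>)" if \<epsilon>: "0 < \<epsilon>" for \<epsilon>
      proof (rule Limsup_bounded)
        have "eventually (\<lambda>N. \<forall>u\<in>S. L N u \<le> exp (\<alpha> N * (\<Lambda> u + \<epsilon>))) sequentially"
          using Lev[OF \<epsilon>] S(1) by (intro eventually_ball_finite ballI) (auto intro: eventually_mono[OF Lev[OF \<epsilon>]])
        then show "eventually (\<lambda>N. r A N \<le> ereal (- l + 2 * \<epsilon>)) sequentially"
          using ev1 \<alpha>_large[OF \<epsilon>, of "ln (card S + 1)"]
        proof eventually_elim
          case (elim N)
          then have N: "N \<ge> 1" by simp
          interpret prob_space "P N" using prob[OF N] .
          have [measurable]: "Y N \<in> borel_measurable (P N)" using Y[OF N] .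
          let ?H = "\<lambda>u. {\<omega>\<in>space (P N). \<Lambda> u + l \<le> u \<bullet> Y N \<omega>}"
          have "prob {\<omega>\<in>space (P N). Y N \<omega> \<in> A} \<le> prob (\<Union>u\<in>S. ?H u)"
          proof (rule finite_measure_mono)
            show "{\<omega>\<in>space (P N). Y N \<omega> \<in> A} \<subseteq> (\<Union>u\<in>S. ?H u)"
              using S(2) closure_subset[of A] by fastforce
            show "(\<Union>u\<in>S. ?H u) \<in> events" using S(1) by (intro sets.finite_UN) auto
          qed
          also have "\<dots> \<le> (\<Sum>u\<in>S. prob (?H u))"
            using S(1) by (intro finite_measure_subadditive_finite) auto
          also have "\<dots> \<le> (\<Sum>u\<in>S. exp (\<alpha> N * (- l + \<epsilon>)))"
          proof (rule sum_mono)
            fix u assume u: "u \<in> S"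
            have "prob (?H u) = (LINT \<omega>:?H u|P N. exp (\<alpha> N * (0 \<bullet> Y N \<omega>)))"
              by (simp add: set_lebesgue_integral_def)
            also have "\<dots> \<le> exp (- (\<alpha> N * 1 * (\<Lambda> u + l))) * L N (0 + 1 *\<^sub>R u)"
              by (rule halfspace(2)[OF N]) simp
            also have "\<dots> \<le> exp (- (\<alpha> N * 1 * (\<Lambda> u + l))) * exp (\<alpha> N * (\<Lambda> u + \<epsilon>))"
              using elim u by (intro mult_left_mono) auto
            also have "\<dots> = exp (\<alpha> N * (- l + \<epsilon>))" by (simp add: exp_add[symmetric] algebra_simps)
            finally show "prob (?H u) \<le> exp (\<alpha> N * (- l + \<epsilon>))" .
          qed
          also have "\<dots> \<le> exp (\<alpha> N * \<epsilon>) * exp (\<alpha> N * (- l + \<epsilon>))"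
          proof -
            have "real (card S) \<le> exp (ln (card S + 1))" by simp
            also have "\<dots> \<le> exp (\<alpha> N * \<epsilon>)" unfolding exp_le_cancel_iff using elim by simp
            finally show ?thesis by (simp add: mult_right_mono)
          qed
          also have "\<dots> = exp (\<alpha> N * (- l + 2 * \<epsilon>))" by (simp add: exp_add[symmetric] algebra_simps)
          finally have m: "prob {\<omega>\<in>space (P N). Y N \<omega> \<in> A} \<le> exp (\<alpha> N * (- l + 2 * \<epsilon>))" .
          show ?case
          proof (cases "prob {\<omega>\<in>space (P N). Y N \<omega> \<in> A} = 0")
            \<comment> \<open>Probability 0 has logarithm \<open>- \<infinity>\<close> under
              \<open>ext_ln\<close>.\<close>
            case True
            then show ?thesis using \<alpha>_pos[OF N] by (simp add: r_def ext_ln_def)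
          next
            case False
            then have "0 < prob {\<omega>\<in>space (P N). Y N \<omega> \<in> A}" by (simp add: zero_less_measure_iff)
            then have "ln (prob {\<omega>\<in>space (P N). Y N \<omega> \<in> A}) \<le> \<alpha> N * (- l + 2 * \<epsilon>)"
              using m by (metis exp_gt_zero ln_exp ln_le_cancel_iff)
            then show ?thesis using \<alpha>_pos[OF N] False
              by (simp add: r_def ext_ln_def pos_divide_le_eq mult.commute)
          qed
        qed
      qed
      have "limsup (r A) \<le> ereal (- l)"
      proof (rule ereal_le_epsilon2)
        fix e :: real assume "0 < e"
        then show "limsup (r A) \<le> ereal (- l) + ereal e" using bound[of "e / 2"] by simp
      qed
      then show ?thesis by (metis ereal_uminus_le_reorder ereal_uminus_uminus uminus_ereal.simps(1))
    qed
    then have "(INF x\<in>closure A. I x) \<le> - limsup (r A)" by (rule ereal_le_all_below)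
    then show ?thesis by (metis ereal_uminus_le_reorder ereal_uminus_uminus)
  qed
  have lower: "- I v \<le> liminf (r A)" if A: "A \<in> sets borel" and v: "v \<in> interior A" for A v
  proof (cases "I v = \<infinity>")
    case True
    then show ?thesis by simp
  next
    case False
    have I0: "0 \<le> I v" unfolding I_def by (rule SUP_upper2[of 0]) (auto simp: \<Lambda>_def)
    with False obtain b where b: "I v = ereal b" by (cases "I v") auto
    have "u \<bullet> v - \<Lambda> u \<le> b" for u
    proof -
      have "ereal (u \<bullet> v - \<Lambda> u) \<le> I v" unfolding I_def by (rule SUP_upper) simp
      then show ?thesis using b by simp
    qed
    \<comment> \<open>For finite \<open>I v\<close> the tilt exists even if \<open>C\<close> is
      singular, since \<open>v\<close> then lies in the range of \<open>C\<close>.\<close>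
    then obtain u where u: "v = C *v u"
      using quadratic_conjugate_finite_imp_range[OF sym, of v b] unfolding \<Lambda>_def by blast
    \<comment> \<open>The gradient of \<Lambda> at \<open>u\<close> is \<open>C *v u = v\<close>.
      The term linear in \<open>t\<close> therefore cancels the threshold
      \<open>w \<bullet> v\<close> of the half-spaces below and leaves
      \<open>t\<^sup>2 * \<Lambda> w - t * \<rho>\<close>.\<close>
    have tilt: "\<Lambda> (u + t *\<^sub>R w) = \<Lambda> u + t * (w \<bullet> v) + t\<^sup>2 * \<Lambda> w" for t w
    proof -
      have "(u + t *\<^sub>R w) \<bullet> (C *v (u + t *\<^sub>R w))
          = u \<bullet> (C *v u) + t * (u \<bullet> (C *v w)) + t * (w \<bullet> (C *v u)) + t\<^sup>2 * (w \<bullet> (C *v w))"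
        unfolding matrix_vector_right_distrib matrix_vector_mult_scaleR inner_add_left inner_add_right
          inner_scaleR_left inner_scaleR_right power2_eq_square by algebra
      moreover have "u \<bullet> (C *v w) = w \<bullet> (C *v u)" unfolding adj[of u w] by (rule inner_commute)
      ultimately show ?thesis unfolding \<Lambda>_def u by (simp add: field_simps)
    qed
    have bound: "ereal (- (u \<bullet> v - \<Lambda> u) - 3 * \<epsilon>) \<le> liminf (r A)" if \<epsilon>: "0 < \<epsilon>" for \<epsilon>
    proof -
      obtain \<rho>0 where \<rho>0: "0 < \<rho>0" "ball v \<rho>0 \<subseteq> A"
        using v by (auto simp: mem_interior)
      \<comment> \<open>The first entry keeps the cube inside the ball around \<open>v\<close>
        contained in \<open>A\<close>; the second keeps \<open>u \<bullet> y\<close> below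
        \<open>u \<bullet> v + \<epsilon>\<close> on the cube.\<close>
      define \<rho> where "\<rho> = min (\<rho>0 / (2 * CARD('d))) (\<epsilon> / ((norm u + 1) * CARD('d)))"
      have \<rho>: "0 < \<rho>" using \<rho>0 \<epsilon> unfolding \<rho>_def by (simp add: add_nonneg_pos)
      define S where "S = (range (\<lambda>i. axis i 1) \<union> range (\<lambda>i. - axis i 1) :: (real ^ 'd) set)"
      have S: "finite S" unfolding S_def by simp
      text \<open>Outside of these half-spaces, \<open>Y\<close> lies in the cube of side \<open>2 \<rho>\<close> around \<open>v\<close>.\<close>
      have near: "y \<in> A" "u \<bullet> y \<le> u \<bullet> v + \<epsilon>" if "\<And>w. w \<in> S \<Longrightarrow> w \<bullet> y < w \<bullet> v + \<rho>" for y
      proof -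
        have "\<bar>(y - v) $ i\<bar> \<le> \<rho>" for i
          using that[of "axis i 1"] that[of "- axis i 1"] unfolding S_def by (simp add: inner_axis' abs_le_iff)
        then have "(\<Sum>i\<in>UNIV. \<bar>(y - v) $ i\<bar>) \<le> (\<Sum>i\<in>(UNIV :: 'd set). \<rho>)" by (intro sum_mono)
        with norm_le_l1_cart[of "y - v"] have n: "norm (y - v) \<le> CARD('d) * \<rho>" by simp
        also have "\<dots> \<le> CARD('d) * (\<rho>0 / (2 * CARD('d)))" unfolding \<rho>_def by (intro mult_left_mono) auto
        also have "\<dots> < \<rho>0" using \<rho>0 by simp
        finally show "y \<in> A" using \<rho>0(2) by (auto simp: dist_norm norm_minus_commute)
        have "u \<bullet> (y - v) \<le> norm u * norm (y - v)" by (rule norm_cauchy_schwarz)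
        also have "\<dots> \<le> (norm u + 1) * (CARD('d) * \<rho>)" using n by (intro mult_mono) auto
        also have "\<dots> \<le> (norm u + 1) * (CARD('d) * (\<epsilon> / ((norm u + 1) * CARD('d))))"
          unfolding \<rho>_def by (intro mult_left_mono) auto
        also have "\<dots> = \<epsilon>"
        proof -
          have "norm u + 1 \<noteq> 0" using norm_ge_zero[of u] by linarith
          then show ?thesis by simp
        qed
        finally show "u \<bullet> y \<le> u \<bullet> v + \<epsilon>" by (simp add: inner_diff_right)
      qed
      \<comment> \<open>Makes \<open>t w * \<Lambda> w\<close> at most half of \<rho>, so that each
        half-space loses at least \<open>t w * \<rho> / 2\<close> in the exponent.\<close>
      define t where "t = (\<lambda>w. \<rho> / (2 * (1 + \<bar>\<Lambda> w\<bar>)))"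
      have t: "0 < t w" "t w * \<bar>\<Lambda> w\<bar> \<le> \<rho> / 2" for w
        using \<rho> unfolding t_def by (auto simp: field_simps add_pos_nonneg)
      \<comment> \<open>A quarter of \<open>t w * \<rho>\<close> leaves room: the loss
        \<open>2 * \<kappa>\<close>, reduced by the \<open>\<kappa> / 2\<close> of the upper Laplace
        bound, still exceeds the \<open>\<kappa> / 2\<close> of the lower Laplace bound by
        \<kappa>.\<close>
      define \<kappa> where "\<kappa> = Min (insert \<epsilon> ((\<lambda>w. t w * \<rho> / 4) ` S))"
      have \<kappa>: "0 < \<kappa>" "\<kappa> \<le> \<epsilon>"
        unfolding \<kappa>_def using S \<epsilon> t \<rho> by auto
      have \<kappa>S: "\<kappa> \<le> t w * \<rho> / 4" if "w \<in> S" for w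
        unfolding \<kappa>_def using S that by (intro Min_le) auto
      have evS: "eventually (\<lambda>N. \<forall>w\<in>S. L N (u + t w *\<^sub>R w) \<le> exp (\<alpha> N * (\<Lambda> (u + t w *\<^sub>R w) + \<kappa> / 2))) sequentially"
        using S \<kappa>(1) by (intro eventually_ball_finite ballI) (auto intro: eventually_mono[OF Lev[of "\<kappa> / 2"]])
      have evu: "eventually (\<lambda>N. exp (\<alpha> N * (\<Lambda> u - \<kappa> / 2)) \<le> L N u) sequentially"
        using Lev[of "\<kappa> / 2" u] \<kappa>(1) by (auto elim: eventually_mono)
      show ?thesis
      proof (rule Liminf_bounded)
        show "eventually (\<lambda>N. ereal (- (u \<bullet> v - \<Lambda> u) - 3 * \<epsilon>) \<le> r A N) sequentially"
          using evS evu ev1 \<alpha>_large[OF \<kappa>(1), of "ln (2 * (card S + 1))"] \<alpha>_large[OF \<epsilon>, of "ln 2"]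
        proof eventually_elim
          case (elim N)
          then have N: "N \<ge> 1" by simp
          interpret prob_space "P N" using prob[OF N] .
          have [measurable]: "Y N \<in> borel_measurable (P N)" using Y[OF N] .
          note ap = \<alpha>_pos[OF N]
          let ?e = "\<lambda>\<omega>. exp (\<alpha> N * (u \<bullet> Y N \<omega>))"
          let ?H = "\<lambda>w. {\<omega>\<in>space (P N). w \<bullet> v + \<rho> \<le> w \<bullet> Y N \<omega>}"
          let ?A = "{\<omega>\<in>space (P N). Y N \<omega> \<in> A}"
          have [measurable]: "?A \<in> sets (P N)" using A by measurable
          have iA: "integrable (P N) (indicat_real ?A)"
            by (rule integrable_real_indicator) (simp_all add: emeasure_finite less_top[symmetric])
          have iH: "integrable (P N) (\<lambda>\<omega>. indicat_real (?H w) \<omega> *\<^sub>R ?e \<omega>)" for w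
            using halfspace(1)[OF N order_refl] unfolding set_integrable_def .
          have H: "(LINT \<omega>:?H w|P N. ?e \<omega>) \<le> exp (\<alpha> N * (\<Lambda> u - 3 / 2 * \<kappa>))" if w: "w \<in> S" for w
          proof -
            have "(LINT \<omega>:?H w|P N. ?e \<omega>) \<le> exp (- (\<alpha> N * t w * (w \<bullet> v + \<rho>))) * L N (u + t w *\<^sub>R w)"
              using t(1)[of w] by (intro halfspace(2)[OF N]) simp
            also have "\<dots> \<le> exp (- (\<alpha> N * t w * (w \<bullet> v + \<rho>))) * exp (\<alpha> N * (\<Lambda> (u + t w *\<^sub>R w) + \<kappa> / 2))"
              using elim w by (intro mult_left_mono) auto
            also have "\<dots> = exp (\<alpha> N * (\<Lambda> u + t w * (t w * \<Lambda> w) - t w * \<rho> + \<kappa> / 2))"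
              unfolding tilt by (simp add: exp_add[symmetric] algebra_simps power2_eq_square)
            also have "\<dots> \<le> exp (\<alpha> N * (\<Lambda> u - 3 / 2 * \<kappa>))"
            proof -
              have "t w * \<Lambda> w \<le> t w * \<bar>\<Lambda> w\<bar>" using t(1)[of w] by (intro mult_left_mono) auto
              then have "t w * \<Lambda> w \<le> \<rho> / 2" using t(2)[of w] by (rule order_trans)
              then have "t w * (t w * \<Lambda> w) \<le> t w * (\<rho> / 2)"
                using less_imp_le[OF t(1)[of w]] by (rule mult_left_mono)
              then have "\<Lambda> u + t w * (t w * \<Lambda> w) - t w * \<rho> + \<kappa> / 2 \<le> \<Lambda> u - 3 / 2 * \<kappa>"
                using \<kappa>S[OF w] by (simp add: algebra_simps)
              then show ?thesis using ap by simp
            qed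
            finally show ?thesis .
          qed
          \<comment> \<open>The full Laplace integral is split: near \<open>v\<close> the point is
            in \<open>A\<close> and the integrand is at most
            \<open>exp (\<alpha> N * (u \<bullet> v + \<epsilon>))\<close>; elsewhere some
            half-space indicator is 1.\<close>
          have "L N u \<le> (\<integral>\<omega>. exp (\<alpha> N * (u \<bullet> v + \<epsilon>)) * indicator ?A \<omega> + (\<Sum>w\<in>S. indicator (?H w) \<omega> *\<^sub>R ?e \<omega>) \<partial>P N)"
            unfolding L_def
          proof (rule integral_mono[OF int[OF N]])
            show "integrable (P N) (\<lambda>\<omega>. exp (\<alpha> N * (u \<bullet> v + \<epsilon>)) * indicator ?A \<omega> + (\<Sum>w\<in>S. indicator (?H w) \<omega> *\<^sub>R ?e \<omega>))"
              by (intro Bochner_Integration.integrable_add Bochner_Integration.integrable_sum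
                  integrable_mult_right iA iH)
            fix \<omega> assume \<omega>: "\<omega> \<in> space (P N)"
            show "?e \<omega> \<le> exp (\<alpha> N * (u \<bullet> v + \<epsilon>)) * indicator ?A \<omega> + (\<Sum>w\<in>S. indicator (?H w) \<omega> *\<^sub>R ?e \<omega>)"
            proof (cases "\<exists>w\<in>S. w \<bullet> v + \<rho> \<le> w \<bullet> Y N \<omega>")
              case True
              then obtain w where w: "w \<in> S" "w \<bullet> v + \<rho> \<le> w \<bullet> Y N \<omega>" by blast
              then have "?e \<omega> = indicator (?H w) \<omega> *\<^sub>R ?e \<omega>" using \<omega> by simp
              also have "\<dots> \<le> (\<Sum>w\<in>S. indicator (?H w) \<omega> *\<^sub>R ?e \<omega>)"
                using S w(1) by (intro member_le_sum) auto
              finally show ?thesis by (simp add: add_increasing)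
            next
              case False
              then have "Y N \<omega> \<in> A" "u \<bullet> Y N \<omega> \<le> u \<bullet> v + \<epsilon>"
                using near[of "Y N \<omega>"] by (auto simp: not_le)
              then show ?thesis using \<omega> ap by (intro add_increasing2 sum_nonneg) auto
            qed
          qed
          also have "\<dots> = exp (\<alpha> N * (u \<bullet> v + \<epsilon>)) * prob ?A + (\<Sum>w\<in>S. LINT \<omega>:?H w|P N. ?e \<omega>)"
            unfolding set_lebesgue_integral_def
            by (subst Bochner_Integration.integral_add, intro integrable_mult_right iA,
                intro Bochner_Integration.integrable_sum iH, subst Bochner_Integration.integral_sum, rule iH) simp
          also have "\<dots> \<le> exp (\<alpha> N * (u \<bullet> v + \<epsilon>)) * prob ?A + card S * exp (\<alpha> N * (\<Lambda> u - 3 / 2 * \<kappa>))"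
            using sum_mono[of S, OF H] by simp
          \<comment> \<open>The gap \<kappa> absorbs the number of half-spaces. They carry at most
            half of the tilted mass, so the other half must come from \<open>A\<close>.\<close>
          also have "card S * exp (\<alpha> N * (\<Lambda> u - 3 / 2 * \<kappa>)) \<le> 1 / 2 * exp (\<alpha> N * (\<Lambda> u - \<kappa> / 2))"
          proof -
            have "2 * real (card S) \<le> exp (ln (2 * (card S + 1)))" by (subst exp_ln) auto
            also have "\<dots> \<le> exp (\<alpha> N * \<kappa>)" unfolding exp_le_cancel_iff using elim by simp
            finally have "real (card S) * exp (\<alpha> N * (\<Lambda> u - 3 / 2 * \<kappa>)) \<le> 1 / 2 * exp (\<alpha> N * \<kappa>) * exp (\<alpha> N * (\<Lambda> u - 3 / 2 * \<kappa>))"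
              by (intro mult_right_mono) auto
            also have "\<dots> = 1 / 2 * exp (\<alpha> N * (\<Lambda> u - \<kappa> / 2))" by (simp add: exp_add[symmetric] algebra_simps)
            finally show ?thesis .
          qed
          finally have "1 / 2 * exp (\<alpha> N * (\<Lambda> u - \<kappa> / 2)) \<le> exp (\<alpha> N * (u \<bullet> v + \<epsilon>)) * prob ?A"
            using elim by linarith
          then have "1 / 2 * exp (\<alpha> N * (\<Lambda> u - \<kappa> / 2)) / exp (\<alpha> N * (u \<bullet> v + \<epsilon>)) \<le> prob ?A"
            by (subst pos_divide_le_eq) (simp_all only: exp_gt_zero mult.commute)
          then have p: "1 / 2 * exp (\<alpha> N * (\<Lambda> u - \<kappa> / 2 - (u \<bullet> v + \<epsilon>))) \<le> prob ?A"
            by (simp only: right_diff_distrib[of "\<alpha> N" _ "u \<bullet> v + \<epsilon>"] exp_diff times_divide_eq_right)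
          have p0: "0 < prob ?A"
            by (rule less_le_trans[OF _ p]) simp
          have "\<alpha> N * (\<Lambda> u - \<kappa> / 2 - (u \<bullet> v + \<epsilon>)) - ln 2 \<le> ln (prob ?A)"
          proof -
            have "ln (1 / 2 * exp (\<alpha> N * (\<Lambda> u - \<kappa> / 2 - (u \<bullet> v + \<epsilon>)))) \<le> ln (prob ?A)"
              using p p0 by (subst ln_le_cancel_iff) auto
            then show ?thesis by (simp add: ln_mult ln_div)
          qed
          \<comment> \<open>The three losses \<open>\<alpha> N * (\<kappa> / 2)\<close>,
            \<open>\<alpha> N * \<epsilon>\<close> and \<open>ln 2\<close> are each at most
            \<open>\<alpha> N * \<epsilon>\<close>.\<close>
          moreover have "\<alpha> N * (\<Lambda> u - u \<bullet> v - 3 * \<epsilon>) \<le> \<alpha> N * (\<Lambda> u - \<kappa> / 2 - (u \<bullet> v + \<epsilon>)) - ln 2"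
          proof -
            have "\<alpha> N * (\<kappa> / 2) \<le> \<alpha> N * \<epsilon>" using ap \<kappa> by (intro mult_left_mono) auto
            then show ?thesis using elim by (simp add: algebra_simps)
          qed
          ultimately have "\<alpha> N * (\<Lambda> u - u \<bullet> v - 3 * \<epsilon>) \<le> ln (prob ?A)" by linarith
          then show ?case using ap p0 by (simp add: r_def ext_ln_def pos_le_divide_eq mult.commute)
        qed
      qed
    qed
    have "ereal (- (u \<bullet> v - \<Lambda> u)) \<le> liminf (r A)"
    proof (rule ereal_le_epsilon2)
      fix e :: real assume "0 < e"
      then have "ereal (- (u \<bullet> v - \<Lambda> u) - e) \<le> liminf (r A)" using bound[of "e / 3"] by simp
      then show "ereal (- (u \<bullet> v - \<Lambda> u)) \<le> liminf (r A) + ereal e"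
        by (cases "liminf (r A)") auto
    qed
    moreover have "ereal (u \<bullet> v - \<Lambda> u) \<le> I v" unfolding I_def by (rule SUP_upper) simp
    ultimately show ?thesis by (metis ereal_minus_le_minus order_trans uminus_ereal.simps(1))
  qed
  have "- (INF x\<in>interior A. I x) \<le> liminf (r A)" if "A \<in> sets borel" for A
    using lower[OF that] by (simp add: ereal_uminus_le_reorder le_INF_iff)
  moreover have "liminf (r A) \<le> limsup (r A)" for A by (rule Liminf_le_Limsup) simp
  ultimately show ?thesis
    using upper quadratic_conjugate_good[of C] prob Y \<alpha>
    unfolding LDP_def Let_def I_def \<Lambda>_def r_def by simp
qed

section \<open>Bounded functions and logarithmic Laplace limits\<close>

lemma bfunI:
  assumes "f \<in> borel_measurable M" "\<And>x. x \<in> space M \<Longrightarrow> \<bar>f x\<bar> \<le> C"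
  shows "f \<in> bfun M"
  using assms unfolding bfun_def by blast

lemma bfunE:
  assumes "f \<in> bfun M"
  obtains C where "0 \<le> C" "\<And>x. x \<in> space M \<Longrightarrow> \<bar>f x\<bar> \<le> C"
proof -
  from assms obtain C where "\<And>x. x \<in> space M \<Longrightarrow> \<bar>f x\<bar> \<le> C" unfolding bfun_def by blast
  then show thesis using that[of "\<bar>C\<bar>"] by (meson abs_ge_self abs_ge_zero order_trans)
qed

lemma bfun_measurable: "f \<in> bfun M \<Longrightarrow> f \<in> borel_measurable M"
  unfolding bfun_def by simp

lemma bfun_const: "(\<lambda>_. c) \<in> bfun M"
  by (rule bfunI[of _ _ "\<bar>c\<bar>"]) auto

lemma bfun_add:
  assumes "f \<in> bfun M" "g \<in> bfun M"
  shows "(\<lambda>x. f x + g x) \<in> bfun M"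
proof -
  obtain C where C: "\<And>x. x \<in> space M \<Longrightarrow> \<bar>f x\<bar> \<le> C" using assms(1) by (rule bfunE) blast
  obtain C' where C': "\<And>x. x \<in> space M \<Longrightarrow> \<bar>g x\<bar> \<le> C'" using assms(2) by (rule bfunE) blast
  show ?thesis
  proof (rule bfunI)
    show "(\<lambda>x. f x + g x) \<in> borel_measurable M"
      using assms[THEN bfun_measurable] by measurable
    show "\<bar>f x + g x\<bar> \<le> C + C'" if "x \<in> space M" for x using C[OF that] C'[OF that] by linarith
  qed
qed

lemma bfun_mult:
  assumes "f \<in> bfun M" "g \<in> bfun M"
  shows "(\<lambda>x. f x * g x) \<in> bfun M"
proof -
  obtain C where C: "0 \<le> C" "\<And>x. x \<in> space M \<Longrightarrow> \<bar>f x\<bar> \<le> C" using assms(1) by (rule bfunE) blast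
  obtain C' where C': "\<And>x. x \<in> space M \<Longrightarrow> \<bar>g x\<bar> \<le> C'" using assms(2) by (rule bfunE) blast
  show ?thesis
  proof (rule bfunI)
    show "(\<lambda>x. f x * g x) \<in> borel_measurable M"
      using assms[THEN bfun_measurable] by measurable
    show "\<bar>f x * g x\<bar> \<le> C * C'" if "x \<in> space M" for x
      using C(1) C(2)[OF that] C'[OF that] by (simp add: abs_mult mult_mono)
  qed
qed

lemma bfun_cmult: "f \<in> bfun M \<Longrightarrow> (\<lambda>x. c * f x) \<in> bfun M"
  by (intro bfun_mult bfun_const)

lemma bfun_diff:
  assumes "f \<in> bfun M" "g \<in> bfun M"
  shows "(\<lambda>x. f x - g x) \<in> bfun M"
  using bfun_add[OF assms(1) bfun_cmult[OF assms(2), of "- 1"]] by simp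

lemma bfun_divide: "f \<in> bfun M \<Longrightarrow> (\<lambda>x. f x / c) \<in> bfun M"
  using bfun_cmult[of f M "1 / c"] by simp

lemma bfun_sum:
  assumes "\<And>i. i \<in> I \<Longrightarrow> f i \<in> bfun M"
  shows "(\<lambda>x. \<Sum>i\<in>I. f i x) \<in> bfun M"
  using assms
proof (induction I rule: infinite_finite_induct)
  case (insert i I)
  then show ?case using bfun_add[of "f i" M "\<lambda>x. \<Sum>i\<in>I. f i x"] by simp
qed (auto intro: bfun_const)

lemma bfun_power2: "f \<in> bfun M \<Longrightarrow> (\<lambda>x. (f x)\<^sup>2) \<in> bfun M"
  using bfun_mult[of f M f] by (simp add: power2_eq_square)

lemma bfun_abs: "f \<in> bfun M \<Longrightarrow> (\<lambda>x. \<bar>f x\<bar>) \<in> bfun M"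
  unfolding bfun_def by auto

text \<open>Members of \<open>bfun\<close> are total functions with arbitrary values off the space,
  so formulas valid only on the space can be used to establish membership.\<close>

lemma bfun_cong:
  assumes "f \<in> bfun M" "\<And>x. x \<in> space M \<Longrightarrow> f x = g x"
  shows "g \<in> bfun M"
  using assms measurable_cong[of M f g borel] unfolding bfun_def by auto

lemma bfun_exp:
  assumes "f \<in> bfun M"
  shows "(\<lambda>x. exp (f x)) \<in> bfun M"
proof -
  obtain C where C: "\<And>x. x \<in> space M \<Longrightarrow> \<bar>f x\<bar> \<le> C" using assms by (rule bfunE) blast
  show ?thesis
  proof (rule bfunI)
    show "(\<lambda>x. exp (f x)) \<in> borel_measurable M"
      using bfun_measurable[OF assms] by measurable
    show "\<bar>exp (f x)\<bar> \<le> exp C" if "x \<in> space M" for x using C[OF that] by (simp add: abs_le_iff)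
  qed
qed

lemma bfun_comp:
  assumes "f \<in> bfun M" "g \<in> N \<rightarrow>\<^sub>M M"
  shows "(\<lambda>x. f (g x)) \<in> bfun N"
  using assms measurable_space[OF assms(2)] unfolding bfun_def by fastforce

lemma bfun_integrable:
  assumes "f \<in> bfun M" "finite_measure \<mu>" "sets \<mu> = sets M"
  shows "integrable \<mu> f"
proof -
  interpret finite_measure \<mu> by fact
  obtain C where C: "\<And>x. x \<in> space M \<Longrightarrow> \<bar>f x\<bar> \<le> C" using assms(1) by (rule bfunE) blast
  have [measurable_cong]: "sets \<mu> = sets M" by fact
  have "f \<in> borel_measurable \<mu>" using bfun_measurable[OF assms(1)] by simp
  then show ?thesis using C sets_eq_imp_space_eq[OF assms(3)]
    by (intro integrable_const_bound[where B = C]) auto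
qed

lemma (in prob_space) integrable_bfun: "f \<in> bfun M \<Longrightarrow> integrable M f"
  by (rule bfun_integrable) (auto intro: finite_measure_axioms)

lemma (in prob_space) nn_integral_bfun:
  "f \<in> bfun M \<Longrightarrow> (\<And>x. x \<in> space M \<Longrightarrow> 0 \<le> f x) \<Longrightarrow> (\<integral>\<^sup>+x. ennreal (f x) \<partial>M) = ennreal (\<integral>x. f x \<partial>M)"
  by (intro nn_integral_eq_integral integrable_bfun) auto

lemma (in prob_space) expectation_exp_pos:
  assumes "f \<in> bfun M"
  shows "0 < expectation (\<lambda>x. exp (f x))"
proof -
  obtain C where C: "\<And>x. x \<in> space M \<Longrightarrow> \<bar>f x\<bar> \<le> C" using assms by (rule bfunE) blast
  have "0 < exp (- C)" by simp
  also have "exp (- C) = expectation (\<lambda>_. exp (- C))" by (simp add: prob_space)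
  also have "\<dots> \<le> expectation (\<lambda>x. exp (f x))"
    using C by (intro integral_mono integrable_bfun bfun_const bfun_exp assms) (auto simp: abs_le_iff minus_le_iff)
  finally show ?thesis .
qed

section \<open>Exponential inequalities and exponentially negligible errors\<close>

lemma (in prob_space) exp_moment_abs:
  assumes X: "X \<in> borel_measurable M"
    and le: "\<And>s. (\<integral>\<^sup>+\<omega>. ennreal (exp (s * X \<omega>)) \<partial>M) \<le> ennreal (exp (s\<^sup>2 / 2))"
  shows "(\<integral>\<^sup>+\<omega>. ennreal (exp (s * \<bar>X \<omega>\<bar>)) \<partial>M) \<le> ennreal (2 * exp (s\<^sup>2 / 2))"
proof -
  note [measurable] = X
  have "exp (s * \<bar>X \<omega>\<bar>) \<le> exp (s * X \<omega>) + exp ((- s) * X \<omega>)" for \<omega>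
    by (cases "0 \<le> X \<omega>") (auto simp: abs_if)
  then have "(\<integral>\<^sup>+\<omega>. ennreal (exp (s * \<bar>X \<omega>\<bar>)) \<partial>M) \<le> (\<integral>\<^sup>+\<omega>. ennreal (exp (s * X \<omega>)) + ennreal (exp ((- s) * X \<omega>)) \<partial>M)"
    by (intro nn_integral_mono) (simp add: ennreal_plus[symmetric] del: ennreal_plus)
  also have "\<dots> = (\<integral>\<^sup>+\<omega>. ennreal (exp (s * X \<omega>)) \<partial>M) + (\<integral>\<^sup>+\<omega>. ennreal (exp ((- s) * X \<omega>)) \<partial>M)"
    by (rule nn_integral_add) auto
  also have "\<dots> \<le> ennreal (exp (s\<^sup>2 / 2)) + ennreal (exp ((- s)\<^sup>2 / 2))" by (intro add_mono le)
  also have "\<dots> = ennreal (2 * exp (s\<^sup>2 / 2))" by (subst ennreal_plus[symmetric]) auto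
  finally show ?thesis .
qed

text \<open>Convexity of \<open>exp\<close>, in place of Hoelder's inequality with exponents 1 / (1
  - t) and 1 / t. The inequality is additive, so the two factors have to be normalised before it is
  applied.\<close>

lemma young_exp:
  fixes x y t :: real
  assumes "0 < t" "t < 1"
  shows "exp (x + y) \<le> (1 - t) * exp (x / (1 - t)) + t * exp (y / t)"
proof -
  have "exp ((1 - t) *\<^sub>R (x / (1 - t)) + t *\<^sub>R (y / t)) \<le> (1 - t) * exp (x / (1 - t)) + t * exp (y / t)"
    using assms by (intro convex_onD[OF exp_convex]) auto
  then show ?thesis using assms by simp
qed

text \<open>The larger summand decides. This separates dependent terms without reference to a joint
  law, at the price of doubling \<open>s\<close>.\<close>

lemma exp_abs_add_le:
  fixes a b s :: real
  assumes "0 \<le> s"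
  shows "exp (s * \<bar>a + b\<bar>) \<le> exp (2 * s * \<bar>a\<bar>) + exp (2 * s * \<bar>b\<bar>)"
proof -
  have "s * \<bar>a + b\<bar> \<le> max (2 * s * \<bar>a\<bar>) (2 * s * \<bar>b\<bar>)"
  proof (cases "\<bar>a\<bar> \<le> \<bar>b\<bar>")
    case True
    then have "\<bar>a + b\<bar> \<le> 2 * \<bar>b\<bar>" by linarith
    then have "s * \<bar>a + b\<bar> \<le> s * (2 * \<bar>b\<bar>)" using assms by (rule mult_left_mono)
    then show ?thesis by simp
  next
    case False
    then have "\<bar>a + b\<bar> \<le> 2 * \<bar>a\<bar>" by linarith
    then have "s * \<bar>a + b\<bar> \<le> s * (2 * \<bar>a\<bar>)" using assms by (rule mult_left_mono)
    then show ?thesis by simp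
  qed
  then have "exp (s * \<bar>a + b\<bar>) \<le> exp (max (2 * s * \<bar>a\<bar>) (2 * s * \<bar>b\<bar>))" by simp
  also have "\<dots> \<le> exp (2 * s * \<bar>a\<bar>) + exp (2 * s * \<bar>b\<bar>)" by (simp add: max_def)
  finally show ?thesis .
qed

text \<open>Asking for every \<open>s\<close> makes the notion stable under sums and lets
  \<open>B\<close> be removed from an exponent at any Hoelder exponent.\<close>

definition exp_negligible :: "(nat \<Rightarrow> 'w measure) \<Rightarrow> (nat \<Rightarrow> real) \<Rightarrow> (nat \<Rightarrow> 'w \<Rightarrow> real) \<Rightarrow> bool" where
  "exp_negligible P \<alpha> B \<longleftrightarrow>
     (\<forall>s>0. \<forall>\<epsilon>>0. eventually (\<lambda>N. (\<integral>\<^sup>+\<omega>. ennreal (exp (s * \<bar>B N \<omega>\<bar>)) \<partial>P N) \<le> ennreal (exp (\<epsilon> * \<alpha> N))) sequentially)"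

lemma eventually_const_le_exp:
  fixes c \<epsilon> :: real
  assumes "filterlim \<alpha> at_top sequentially" "0 < \<epsilon>"
  shows "eventually (\<lambda>N. c \<le> exp (\<epsilon> * \<alpha> N)) sequentially"
proof -
  have "eventually (\<lambda>N. ln (\<bar>c\<bar> + 1) / \<epsilon> \<le> \<alpha> N) sequentially"
    using assms(1) by (simp add: filterlim_at_top)
  then show ?thesis
  proof eventually_elim
    case (elim N)
    then have "ln (\<bar>c\<bar> + 1) \<le> \<epsilon> * \<alpha> N" using assms(2) by (simp add: pos_divide_le_eq mult.commute)
    then have "exp (ln (\<bar>c\<bar> + 1)) \<le> exp (\<epsilon> * \<alpha> N)" unfolding exp_le_cancel_iff .
    then show ?case by (subst (asm) exp_ln) auto
  qed
qed

lemma exp_negligible_mono: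
  assumes B: "exp_negligible P \<alpha> B"
    and le: "eventually (\<lambda>N. \<forall>\<omega>\<in>space (P N). \<bar>A N \<omega>\<bar> \<le> \<bar>B N \<omega>\<bar>) sequentially"
  shows "exp_negligible P \<alpha> A"
  unfolding exp_negligible_def
proof (intro allI impI)
  fix s \<epsilon> :: real assume s: "s > 0" and \<epsilon>: "\<epsilon> > 0"
  have "eventually (\<lambda>N. (\<integral>\<^sup>+\<omega>. ennreal (exp (s * \<bar>B N \<omega>\<bar>)) \<partial>P N) \<le> ennreal (exp (\<epsilon> * \<alpha> N))) sequentially"
    using B s \<epsilon> unfolding exp_negligible_def by blast
  with le show "eventually (\<lambda>N. (\<integral>\<^sup>+\<omega>. ennreal (exp (s * \<bar>A N \<omega>\<bar>)) \<partial>P N) \<le> ennreal (exp (\<epsilon> * \<alpha> N))) sequentially"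
  proof eventually_elim
    case (elim N)
    have "(\<integral>\<^sup>+\<omega>. ennreal (exp (s * \<bar>A N \<omega>\<bar>)) \<partial>P N) \<le> (\<integral>\<^sup>+\<omega>. ennreal (exp (s * \<bar>B N \<omega>\<bar>)) \<partial>P N)"
      using elim s by (intro nn_integral_mono ennreal_leI) auto
    with elim show ?case by simp
  qed
qed

lemma exp_negligible_add:
  assumes \<alpha>: "filterlim \<alpha> at_top sequentially"
    and A: "exp_negligible P \<alpha> A" and B: "exp_negligible P \<alpha> B"
    and m: "\<And>N. N \<ge> 1 \<Longrightarrow> A N \<in> borel_measurable (P N)" "\<And>N. N \<ge> 1 \<Longrightarrow> B N \<in> borel_measurable (P N)"
  shows "exp_negligible P \<alpha> (\<lambda>N \<omega>. A N \<omega> + B N \<omega>)"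
  unfolding exp_negligible_def
proof (intro allI impI)
  fix s \<epsilon> :: real assume s: "s > 0" and \<epsilon>: "\<epsilon> > 0"
  have s2: "2 * s > 0" and e2: "\<epsilon> / 2 > 0" using s \<epsilon> by auto
  have "eventually (\<lambda>N. (\<integral>\<^sup>+\<omega>. ennreal (exp (2 * s * \<bar>A N \<omega>\<bar>)) \<partial>P N) \<le> ennreal (exp (\<epsilon> / 2 * \<alpha> N))) sequentially"
    "eventually (\<lambda>N. (\<integral>\<^sup>+\<omega>. ennreal (exp (2 * s * \<bar>B N \<omega>\<bar>)) \<partial>P N) \<le> ennreal (exp (\<epsilon> / 2 * \<alpha> N))) sequentially"
    using A B s2 e2 unfolding exp_negligible_def by blast+
  then show "eventually (\<lambda>N. (\<integral>\<^sup>+\<omega>. ennreal (exp (s * \<bar>A N \<omega> + B N \<omega>\<bar>)) \<partial>P N) \<le> ennreal (exp (\<epsilon> * \<alpha> N))) sequentially"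
    using eventually_const_le_exp[OF \<alpha> e2, of 2] eventually_ge_at_top[of 1]
  proof eventually_elim
    case (elim N)
    note [measurable] = m[OF elim(4)]
    have "(\<integral>\<^sup>+\<omega>. ennreal (exp (s * \<bar>A N \<omega> + B N \<omega>\<bar>)) \<partial>P N)
      \<le> (\<integral>\<^sup>+\<omega>. ennreal (exp (2 * s * \<bar>A N \<omega>\<bar>)) + ennreal (exp (2 * s * \<bar>B N \<omega>\<bar>)) \<partial>P N)"
      using s by (intro nn_integral_mono) (simp add: ennreal_plus[symmetric] exp_abs_add_le del: ennreal_plus)
    also have "\<dots> = (\<integral>\<^sup>+\<omega>. ennreal (exp (2 * s * \<bar>A N \<omega>\<bar>)) \<partial>P N) + (\<integral>\<^sup>+\<omega>. ennreal (exp (2 * s * \<bar>B N \<omega>\<bar>)) \<partial>P N)"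
      by (rule nn_integral_add) auto
    also have "\<dots> \<le> ennreal (exp (\<epsilon> / 2 * \<alpha> N)) + ennreal (exp (\<epsilon> / 2 * \<alpha> N))"
      using elim by (intro add_mono)
    also have "\<dots> = ennreal (2 * exp (\<epsilon> / 2 * \<alpha> N))"
      by (subst ennreal_plus[symmetric]) auto
    also have "\<dots> \<le> ennreal (exp (\<epsilon> / 2 * \<alpha> N) * exp (\<epsilon> / 2 * \<alpha> N))"
      using elim by (intro ennreal_leI mult_right_mono) auto
    also have "\<dots> = ennreal (exp (\<epsilon> * \<alpha> N))" by (simp add: exp_add[symmetric])
    finally show ?case .
  qed
qed

lemma exp_negligible_bounded:
  assumes prob: "\<And>N. N \<ge> 1 \<Longrightarrow> prob_space (P N)"
    and \<alpha>_pos: "\<And>N. N \<ge> 1 \<Longrightarrow> 0 < \<alpha> N"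
    and lim: "(\<lambda>N. b N / \<alpha> N) \<longlonglongrightarrow> 0"
  shows "exp_negligible P \<alpha> (\<lambda>N \<omega>. b N)"
  unfolding exp_negligible_def
proof (intro allI impI)
  fix s \<epsilon> :: real assume s: "s > 0" and \<epsilon>: "\<epsilon> > 0"
  have "eventually (\<lambda>N. dist (b N / \<alpha> N) 0 < \<epsilon> / s) sequentially"
    using s \<epsilon> by (intro tendstoD[OF lim]) auto
  then show "eventually (\<lambda>N. (\<integral>\<^sup>+\<omega>. ennreal (exp (s * \<bar>b N\<bar>)) \<partial>P N) \<le> ennreal (exp (\<epsilon> * \<alpha> N))) sequentially"
    using eventually_ge_at_top[of 1]
  proof eventually_elim
    case (elim N)
    then interpret prob_space "P N" using prob by simp
    have "s * \<bar>b N\<bar> \<le> \<epsilon> * \<alpha> N" using elim s \<alpha>_pos[of N] by (simp add: field_simps)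
    then show ?case by (simp add: emeasure_space_1)
  qed
qed

text \<open>The constant \<open>C\<close> may depend on \<open>s\<close> but not on
  \<open>N\<close>: half of \<epsilon> absorbs it, the other half absorbs \<open>b\<close>.\<close>

lemma exp_negligible_moment:
  assumes \<alpha>: "filterlim \<alpha> at_top sequentially"
    and mom: "\<And>s. s > 0 \<Longrightarrow> \<exists>C. eventually (\<lambda>N. (\<integral>\<^sup>+\<omega>. ennreal (exp (s * \<bar>B N \<omega>\<bar>)) \<partial>P N) \<le> ennreal (C * exp (b s N))) sequentially"
    and b: "\<And>s. s > 0 \<Longrightarrow> (\<lambda>N. b s N / \<alpha> N) \<longlonglongrightarrow> 0"
  shows "exp_negligible P \<alpha> B"
  unfolding exp_negligible_def
proof (intro allI impI)
  fix s \<epsilon> :: real assume s: "s > 0" and \<epsilon>: "\<epsilon> > 0"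
  then have e2: "\<epsilon> / 2 > 0" by simp
  from mom[OF s] obtain C where
    C: "eventually (\<lambda>N. (\<integral>\<^sup>+\<omega>. ennreal (exp (s * \<bar>B N \<omega>\<bar>)) \<partial>P N) \<le> ennreal (C * exp (b s N))) sequentially" by blast
  have "eventually (\<lambda>N. dist (b s N / \<alpha> N) 0 < \<epsilon> / 2) sequentially"
    using e2 by (rule tendstoD[OF b[OF s]])
  moreover have "eventually (\<lambda>N. 0 < \<alpha> N) sequentially"
    using \<alpha> by (simp add: filterlim_at_top_dense)
  ultimately show "eventually (\<lambda>N. (\<integral>\<^sup>+\<omega>. ennreal (exp (s * \<bar>B N \<omega>\<bar>)) \<partial>P N) \<le> ennreal (exp (\<epsilon> * \<alpha> N))) sequentially"
    using C eventually_const_le_exp[OF \<alpha> e2, of C]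
  proof eventually_elim
    case (elim N)
    have "b s N / \<alpha> N \<le> \<epsilon> / 2" using elim(1) unfolding dist_real_def by linarith
    then have "exp (b s N) \<le> exp (\<epsilon> / 2 * \<alpha> N)" using elim(2) by (simp add: pos_divide_le_eq)
    then have "C * exp (b s N) \<le> exp (\<epsilon> / 2 * \<alpha> N) * exp (\<epsilon> / 2 * \<alpha> N)"
      using elim(4) by (intro mult_mono) auto
    also have "\<dots> = exp (\<epsilon> * \<alpha> N)" by (simp add: exp_add[symmetric])
    finally show ?case using elim(3) by (meson ennreal_leI order_trans)
  qed
qed

text \<open>The Hoelder step replaces \<open>A\<close> by \<open>p * A\<close> with \<open>p\<close>
  slightly above or below 1; the limit \<open>p\<^sup>2 * \<sigma>\<close> is continuous at p = 1,
  which closes the gap. The lower bound applies the same inequality to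
  \<open>A = (A + B) - B\<close>.\<close>

lemma log_laplace_perturb:
  assumes prob: "\<And>N. N \<ge> 1 \<Longrightarrow> prob_space (P N)"
    and \<alpha>_pos: "\<And>N. N \<ge> 1 \<Longrightarrow> 0 < \<alpha> N" and \<alpha>: "filterlim \<alpha> at_top sequentially"
    and A: "\<And>N. N \<ge> 1 \<Longrightarrow> A N \<in> bfun (P N)" and B: "\<And>N. N \<ge> 1 \<Longrightarrow> B N \<in> bfun (P N)"
    and neg: "exp_negligible P \<alpha> B"
    and lim: "\<And>p. p > 0 \<Longrightarrow> (\<lambda>N. ln (\<integral>\<omega>. exp (p * A N \<omega>) \<partial>P N) / \<alpha> N) \<longlonglongrightarrow> p\<^sup>2 * \<sigma>"
  shows "(\<lambda>N. ln (\<integral>\<omega>. exp (A N \<omega> + B N \<omega>) \<partial>P N) / \<alpha> N) \<longlonglongrightarrow> \<sigma>"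
proof (rule LIMSEQ_I)
  fix e0 :: real assume e0: "0 < e0"
  define e where "e = e0 / 2"
  have e: "0 < e" "e < e0" using e0 by (auto simp: e_def)
  \<comment> \<open>The lower bound loses \<open>3 * p * \<eta>\<close>, at most
    \<open>6 * \<eta>\<close>, which is e / 3. The choice of \<open>d\<close> keeps the cost of
    changing the exponent below e / 3 as well.\<close>
  define \<eta> where "\<eta> = e / 18"
  define d where "d = min 1 (e / (3 * (\<bar>\<sigma>\<bar> + 1)))"
  define p where "p = 1 + d"
  \<comment> \<open>The conjugate weight: \<open>1 - t = 1 / p\<close>, so the two exponents are
    \<open>p\<close> and \<open>1 / t\<close>.\<close>
  define t where "t = d / p"
  have \<eta>: "0 < \<eta>" using e by (simp add: \<eta>_def)
  have d: "0 < d" "d \<le> 1" unfolding d_def using e by (auto simp: add_nonneg_pos)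
  have d\<sigma>: "d * \<bar>\<sigma>\<bar> \<le> e / 3"
  proof -
    have "d * \<bar>\<sigma>\<bar> \<le> e / (3 * (\<bar>\<sigma>\<bar> + 1)) * \<bar>\<sigma>\<bar>" unfolding d_def by (intro mult_right_mono) auto
    also have "\<dots> \<le> e / 3" using e by (simp add: field_simps add_nonneg_pos)
    finally show ?thesis .
  qed
  have p: "1 < p" "p \<le> 2" using d by (auto simp: p_def)
  have t: "0 < t" "t < 1" "1 - t = 1 / p" using d by (auto simp: t_def p_def field_simps)
  have p0: "0 < p" "0 < 1 / p" using p by auto
  note ev = eventually_ge_at_top[of "1::nat"]
  have ev_pos: "eventually (\<lambda>N. 0 < (\<integral>\<omega>. exp (q * A N \<omega>) \<partial>P N) \<and> 0 < \<alpha> N) sequentially" for q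
    using ev by eventually_elim
      (simp add: \<alpha>_pos prob_space.expectation_exp_pos[OF prob] bfun_cmult A)
  have evp: "eventually (\<lambda>N. (\<integral>\<omega>. exp (p * A N \<omega>) \<partial>P N) \<le> exp (\<alpha> N * (p\<^sup>2 * \<sigma> + \<eta>))) sequentially"
    using eventually_exp_bounds[OF lim[OF p0(1)] \<eta> ev_pos] by eventually_elim simp
  have evq: "eventually (\<lambda>N. exp (\<alpha> N * ((1 / p)\<^sup>2 * \<sigma> - \<eta>)) \<le> (\<integral>\<omega>. exp ((1 / p) * A N \<omega>) \<partial>P N)) sequentially"
    using eventually_exp_bounds[OF lim[OF p0(2)] \<eta> ev_pos] by eventually_elim simp
  have evB: "eventually (\<lambda>N. (\<integral>\<omega>. exp (\<bar>B N \<omega>\<bar> / t) \<partial>P N) \<le> exp (\<eta> * \<alpha> N)) sequentially"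
  proof -
    have "1 / t > 0" using t by simp
    then have "eventually (\<lambda>N. (\<integral>\<^sup>+\<omega>. ennreal (exp (1 / t * \<bar>B N \<omega>\<bar>)) \<partial>P N) \<le> ennreal (exp (\<eta> * \<alpha> N))) sequentially"
      using neg \<eta> unfolding exp_negligible_def by blast
    then show ?thesis using ev
    proof eventually_elim
      case (elim N)
      then interpret prob_space "P N" using prob by simp
      have "(\<lambda>\<omega>. exp (1 / t * \<bar>B N \<omega>\<bar>)) \<in> bfun (P N)"
        using B elim by (intro bfun_exp bfun_cmult bfun_abs)
      from nn_integral_bfun[OF this] elim(1) show ?case by simp
    qed
  qed
  have "eventually (\<lambda>N. norm (ln (\<integral>\<omega>. exp (A N \<omega> + B N \<omega>) \<partial>P N) / \<alpha> N - \<sigma>) < e0) sequentially"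
    using evp evq evB eventually_const_le_exp[OF \<alpha> \<eta>, of 2] ev
  proof eventually_elim
    case (elim N)
    interpret prob_space "P N" using prob elim(5) by simp
    note AN = A[OF elim(5)] and BN = B[OF elim(5)] and ap = \<alpha>_pos[OF elim(5)]
    let ?X = "expectation (\<lambda>\<omega>. exp (A N \<omega> + B N \<omega>))"
    note bf = integrable_bfun bfun_exp bfun_add bfun_diff bfun_cmult bfun_divide bfun_const bfun_abs AN BN
    have iB: "integrable (P N) (\<lambda>\<omega>. exp (\<bar>B N \<omega>\<bar> / t))" by (intro bf)
    have Xpos: "0 < ?X" by (intro expectation_exp_pos bf)
    have "?X \<le> exp (\<alpha> N * (\<sigma> + e))"
    proof -
      \<comment> \<open>After subtraction of \<open>p * k\<close> the exponential moment of
        \<open>p * A N\<close> is at most 1, so the additive inequality loses nothing on the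
        exponential scale.\<close>
      define k where "k = \<alpha> N * ((p\<^sup>2 * \<sigma> + \<eta>) / p)"
      have iA: "integrable (P N) (\<lambda>\<omega>. exp (p * A N \<omega> - p * k))" by (intro bf)
      have "?X \<le> expectation (\<lambda>\<omega>. exp k * ((1 / p) * exp (p * A N \<omega> - p * k) + t * exp (\<bar>B N \<omega>\<bar> / t)))"
      proof (rule integral_mono)
        show "integrable (P N) (\<lambda>\<omega>. exp (A N \<omega> + B N \<omega>))" by (intro bf)
        show "integrable (P N) (\<lambda>\<omega>. exp k * ((1 / p) * exp (p * A N \<omega> - p * k) + t * exp (\<bar>B N \<omega>\<bar> / t)))"
          by (intro bf)
        fix \<omega>
        have "exp (A N \<omega> + B N \<omega>) = exp k * exp ((A N \<omega> - k) + B N \<omega>)" by (simp add: exp_add[symmetric])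
        also have "exp ((A N \<omega> - k) + B N \<omega>) \<le> (1 - t) * exp ((A N \<omega> - k) / (1 - t)) + t * exp (B N \<omega> / t)"
          by (rule young_exp[OF t(1,2)])
        also have "\<dots> \<le> (1 / p) * exp (p * A N \<omega> - p * k) + t * exp (\<bar>B N \<omega>\<bar> / t)"
          unfolding t(3) using t(1) p0 by (intro add_mono mult_left_mono) (auto simp: algebra_simps divide_right_mono)
        finally show "exp (A N \<omega> + B N \<omega>) \<le> exp k * ((1 / p) * exp (p * A N \<omega> - p * k) + t * exp (\<bar>B N \<omega>\<bar> / t))"
          by simp
      qed
      also have "\<dots> = exp k * ((1 / p) * expectation (\<lambda>\<omega>. exp (p * A N \<omega> - p * k)) + t * expectation (\<lambda>\<omega>. exp (\<bar>B N \<omega>\<bar> / t)))"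
        using iA iB by simp
      also have "\<dots> \<le> exp k * ((1 / p) * 1 + t * exp (\<eta> * \<alpha> N))"
      proof (intro mult_left_mono add_mono)
        show "expectation (\<lambda>\<omega>. exp (p * A N \<omega> - p * k)) \<le> 1"
          using elim(1) p by (simp add: exp_diff k_def pos_divide_le_eq)
      qed (use p0 t elim(3) in auto)
      also have "\<dots> \<le> exp k * ((1 / p) * exp (\<eta> * \<alpha> N) + t * exp (\<eta> * \<alpha> N))"
        using p0 \<eta> ap by (intro mult_left_mono add_mono order_refl) auto
      also have "(1 / p) * exp (\<eta> * \<alpha> N) + t * exp (\<eta> * \<alpha> N) = exp (\<eta> * \<alpha> N)"
        unfolding t(3)[symmetric] by (simp add: algebra_simps)
      also have "exp k * exp (\<eta> * \<alpha> N) = exp (\<alpha> N * (p * \<sigma> + \<eta> / p + \<eta>))"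
        using p0 by (simp add: exp_add[symmetric] k_def power2_eq_square field_simps)
      also have "\<dots> \<le> exp (\<alpha> N * (\<sigma> + e))"
      proof -
        have "\<eta> / p \<le> \<eta>" using p \<eta> by (simp add: pos_divide_le_eq)
        moreover have "d * \<sigma> \<le> d * \<bar>\<sigma>\<bar>" using d by (intro mult_left_mono) auto
        moreover have "p * \<sigma> = \<sigma> + d * \<sigma>" by (simp add: p_def algebra_simps)
        ultimately have "p * \<sigma> + \<eta> / p + \<eta> \<le> \<sigma> + e"
          using d\<sigma> e unfolding \<eta>_def by linarith
        then show ?thesis using ap by simp
      qed
      finally show ?thesis .
    qed
    moreover have "exp (\<alpha> N * (\<sigma> - e)) \<le> ?X"
    proof -
      \<comment> \<open>The left side is then at least \<open>exp (2 * \<eta> * \<alpha> N)\<close>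
        while the \<open>B\<close> term is at most \<open>exp (\<eta> * \<alpha> N)\<close>. Their
        difference is at least 1, which forces the mean of
        \<open>exp (A N \<omega> + B N \<omega>)\<close> above \<open>exp (p * k)\<close>.\<close>
      define k where "k = \<alpha> N * ((1 / p)\<^sup>2 * \<sigma> - 3 * \<eta>)"
      have iX: "integrable (P N) (\<lambda>\<omega>. exp (A N \<omega> + B N \<omega> - p * k))" by (intro bf)
      have "exp (2 * \<eta> * \<alpha> N) = exp (\<alpha> N * ((1 / p)\<^sup>2 * \<sigma> - \<eta>)) / exp k"
        by (simp add: exp_diff[symmetric] k_def algebra_simps)
      also have "\<dots> \<le> expectation (\<lambda>\<omega>. exp ((1 / p) * A N \<omega>)) / exp k"
        by (intro divide_right_mono elim(2)) auto
      also have "\<dots> = expectation (\<lambda>\<omega>. exp ((1 / p) * A N \<omega> - k))" by (simp add: exp_diff)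
      also have "\<dots> \<le> expectation (\<lambda>\<omega>. (1 / p) * exp (A N \<omega> + B N \<omega> - p * k) + t * exp (\<bar>B N \<omega>\<bar> / t))"
      proof (rule integral_mono)
        show "integrable (P N) (\<lambda>\<omega>. exp ((1 / p) * A N \<omega> - k))" by (intro bf)
        show "integrable (P N) (\<lambda>\<omega>. (1 / p) * exp (A N \<omega> + B N \<omega> - p * k) + t * exp (\<bar>B N \<omega>\<bar> / t))" by (intro bf)
        fix \<omega>
        have "exp ((1 / p) * A N \<omega> - k) = exp (((1 / p) * (A N \<omega> + B N \<omega>) - k) + (- (1 / p) * B N \<omega>))"
          by (simp add: algebra_simps add_divide_distrib)
        also have "\<dots> \<le> (1 - t) * exp (((1 / p) * (A N \<omega> + B N \<omega>) - k) / (1 - t)) + t * exp ((- (1 / p) * B N \<omega>) / t)"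
          by (rule young_exp[OF t(1,2)])
        also have "\<dots> \<le> (1 / p) * exp (A N \<omega> + B N \<omega> - p * k) + t * exp (\<bar>B N \<omega>\<bar> / t)"
        proof -
          have "((1 / p) * (A N \<omega> + B N \<omega>) - k) / (1 - t) = A N \<omega> + B N \<omega> - p * k"
            unfolding t(3) using p by (simp add: field_simps)
          then have 1: "(1 - t) * exp (((1 / p) * (A N \<omega> + B N \<omega>) - k) / (1 - t)) = (1 / p) * exp (A N \<omega> + B N \<omega> - p * k)"
            unfolding t(3) by simp
          have "- (1 / p) * B N \<omega> = (1 / p) * - B N \<omega>" by simp
          also have "\<dots> \<le> (1 / p) * \<bar>B N \<omega>\<bar>" using p0 by (intro mult_left_mono) auto
          also have "\<dots> \<le> 1 * \<bar>B N \<omega>\<bar>" using p by (intro mult_right_mono) auto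
          finally have "exp ((- (1 / p) * B N \<omega>) / t) \<le> exp (\<bar>B N \<omega>\<bar> / t)"
            unfolding exp_le_cancel_iff using t(1) by (intro divide_right_mono) auto
          then have "t * exp ((- (1 / p) * B N \<omega>) / t) \<le> t * exp (\<bar>B N \<omega>\<bar> / t)" using t by (intro mult_left_mono) auto
          then show ?thesis unfolding 1 by simp
        qed
        finally show "exp ((1 / p) * A N \<omega> - k) \<le> (1 / p) * exp (A N \<omega> + B N \<omega> - p * k) + t * exp (\<bar>B N \<omega>\<bar> / t)" .
      qed
      also have "\<dots> = (1 / p) * expectation (\<lambda>\<omega>. exp (A N \<omega> + B N \<omega> - p * k)) + t * expectation (\<lambda>\<omega>. exp (\<bar>B N \<omega>\<bar> / t))"
        using iX iB by simp
      also have "\<dots> \<le> 1 * (?X / exp (p * k)) + 1 * exp (\<eta> * \<alpha> N)"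
        using p t elim(3) Xpos by (intro add_mono mult_mono) (auto simp: exp_diff)
      finally have "exp (2 * \<eta> * \<alpha> N) - exp (\<eta> * \<alpha> N) \<le> ?X / exp (p * k)" by simp
      moreover have "1 \<le> exp (2 * \<eta> * \<alpha> N) - exp (\<eta> * \<alpha> N)"
      proof -
        have "2 * exp (\<eta> * \<alpha> N) \<le> exp (\<eta> * \<alpha> N) * exp (\<eta> * \<alpha> N)" using elim(4) by (intro mult_right_mono) auto
        also have "\<dots> = exp (2 * \<eta> * \<alpha> N)" by (simp add: exp_add[symmetric])
        finally show ?thesis using elim(4) by linarith
      qed
      ultimately have "1 \<le> ?X / exp (p * k)" by linarith
      then have "exp (p * k) \<le> ?X" by (simp add: pos_le_divide_eq)
      moreover have "exp (\<alpha> N * (\<sigma> - e)) \<le> exp (p * k)"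
      proof -
        have pk: "p * k = \<alpha> N * (\<sigma> / p - 3 * p * \<eta>)"
          using p0 by (simp add: k_def field_simps power2_eq_square)
        have "\<sigma> - \<sigma> / p = t * \<sigma>" using p0 by (simp add: t_def p_def field_simps)
        also have "\<dots> \<le> t * \<bar>\<sigma>\<bar>" using t by (intro mult_left_mono) auto
        also have "\<dots> \<le> d * \<bar>\<sigma>\<bar>" using p d unfolding t_def by (intro mult_right_mono) (auto simp: pos_divide_le_eq)
        finally have "\<sigma> - \<sigma> / p \<le> e / 3" using d\<sigma> by linarith
        moreover have "3 * p * \<eta> \<le> 6 * \<eta>" using p \<eta> by simp
        ultimately have "\<sigma> - e \<le> \<sigma> / p - 3 * p * \<eta>" using e unfolding \<eta>_def by linarith
        then show ?thesis unfolding pk using ap by simp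
      qed
      ultimately show ?thesis by linarith
    qed
    ultimately have "ln ?X \<le> \<alpha> N * (\<sigma> + e)" "\<alpha> N * (\<sigma> - e) \<le> ln ?X"
      using Xpos by (metis exp_le_cancel_iff exp_ln)+
    then have "ln ?X / \<alpha> N \<le> \<sigma> + e" "\<sigma> - e \<le> ln ?X / \<alpha> N"
      using ap by (auto simp: pos_divide_le_eq pos_le_divide_eq mult.commute)
    then show ?case using e(2) by (auto simp: abs_le_iff)
  qed
  then show "\<exists>no. \<forall>N\<ge>no. norm (ln (\<integral>\<omega>. exp (A N \<omega> + B N \<omega>) \<partial>P N) / \<alpha> N - \<sigma>) < e0"
    by (simp add: eventually_sequentially)
qed

section \<open>Covariance of the limiting fields\<close>

lemma probs_prob_space: "\<mu> \<in> probs M \<Longrightarrow> prob_space \<mu>"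
  by (simp add: space_prob_algebra)

lemma probs_sets: "\<mu> \<in> probs M \<Longrightarrow> sets \<mu> = sets M"
  by (simp add: space_prob_algebra)

lemma probs_space: "\<mu> \<in> probs M \<Longrightarrow> space \<mu> = space M"
  by (rule sets_eq_imp_space_eq) (rule probs_sets)

lemma probs_bfun: "\<mu> \<in> probs M \<Longrightarrow> bfun \<mu> = bfun M"
  unfolding bfun_def by (simp add: probs_space measurable_cong_sets[OF probs_sets refl])

lemma probs_integrable:
  assumes "\<mu> \<in> probs M" "f \<in> bfun M"
  shows "integrable \<mu> f"
  using assms by (intro bfun_integrable[of f M] prob_space.finite_measure probs_prob_space probs_sets)

lemma probs_abs_integral_le:
  assumes \<mu>: "\<mu> \<in> probs M" and f: "f \<in> bfun M" and le: "\<And>x. x \<in> space M \<Longrightarrow> \<bar>f x\<bar> \<le> C"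
  shows "\<bar>\<integral>x. f x \<partial>\<mu>\<bar> \<le> C"
proof -
  interpret prob_space \<mu> using \<mu> by (rule probs_prob_space)
  have "\<bar>expectation f\<bar> \<le> expectation (\<lambda>x. \<bar>f x\<bar>)" by (rule integral_abs_bound)
  also have "\<dots> \<le> expectation (\<lambda>_. C)"
    using le probs_integrable[OF \<mu> bfun_abs[OF f]] by (intro integral_mono) (auto simp: probs_space[OF \<mu>])
  finally show ?thesis by (simp add: prob_space)
qed

lemma probs_integral_sum:
  assumes \<mu>: "\<mu> \<in> probs M" and f: "\<And>i. i \<in> I \<Longrightarrow> f i \<in> bfun M"
    and g: "\<And>x. x \<in> space M \<Longrightarrow> g x = (\<Sum>i\<in>I. u i * f i x)"
  shows "(\<integral>x. g x \<partial>\<mu>) = (\<Sum>i\<in>I. u i * (\<integral>x. f i x \<partial>\<mu>))"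
proof -
  have "(\<integral>x. g x \<partial>\<mu>) = (\<integral>x. (\<Sum>i\<in>I. u i * f i x) \<partial>\<mu>)"
    using g by (intro Bochner_Integration.integral_cong) (auto simp: probs_space[OF \<mu>])
  also have "\<dots> = (\<Sum>i\<in>I. \<integral>x. u i * f i x \<partial>\<mu>)"
    using f by (intro Bochner_Integration.integral_sum probs_integrable[OF \<mu>] bfun_cmult)
  finally show ?thesis by simp
qed

lemma probs_covariance:
  assumes \<mu>: "\<mu> \<in> probs M" and f: "f \<in> bfun M" and g: "g \<in> bfun M"
  shows "(\<integral>y. (f y - (\<integral>z. f z \<partial>\<mu>)) * (g y - (\<integral>z. g z \<partial>\<mu>)) \<partial>\<mu>)
    = (\<integral>y. f y * g y \<partial>\<mu>) - (\<integral>y. f y \<partial>\<mu>) * (\<integral>y. g y \<partial>\<mu>)"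
proof -
  interpret prob_space \<mu> using \<mu> by (rule probs_prob_space)
  note i = probs_integrable[OF \<mu>]
  let ?a = "\<integral>z. f z \<partial>\<mu>" and ?b = "\<integral>z. g z \<partial>\<mu>"
  have "(\<integral>y. (f y - ?a) * (g y - ?b) \<partial>\<mu>) = (\<integral>y. (f y * g y - ?b * f y) - (?a * g y - ?a * ?b) \<partial>\<mu>)"
    by (intro Bochner_Integration.integral_cong) (auto simp: algebra_simps)
  also have "\<dots> = ((\<integral>y. f y * g y \<partial>\<mu>) - (\<integral>y. ?b * f y \<partial>\<mu>)) - ((\<integral>y. ?a * g y \<partial>\<mu>) - (\<integral>y. ?a * ?b \<partial>\<mu>))"
    by (subst Bochner_Integration.integral_diff Bochner_Integration.integral_diff,
        intro i bfun_diff bfun_mult bfun_cmult bfun_const f g,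
        intro i bfun_diff bfun_mult bfun_cmult bfun_const f g)+
      (simp only: Bochner_Integration.integral_diff i bfun_diff bfun_mult bfun_cmult bfun_const f g)
  finally show ?thesis by (simp add: prob_space)
qed

lemma probs_exp_integral_pos:
  assumes \<mu>: "\<mu> \<in> probs M" and h: "h \<in> bfun M"
  shows "0 < (\<integral>y. exp (h y) \<partial>\<mu>)"
proof -
  interpret prob_space \<mu> using \<mu> by (rule probs_prob_space)
  show ?thesis using expectation_exp_pos[of h] h by (simp add: probs_bfun[OF \<mu>])
qed

text \<open>A HOL function acting on all functions carries no linearity. It is inherited from the
  two finite measures, at each point of \<open>space E\<close> and for bounded arguments only, and
  \<open>g\<close> is compared with the combination on \<open>space F\<close> only.\<close>

lemma bounded_integral_op_sum:
  assumes M: "bounded_integral_op E F M" and x: "x \<in> space E"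
    and f: "\<And>i. i \<in> I \<Longrightarrow> f i \<in> bfun F" and g: "g \<in> bfun F"
    and eq: "\<And>y. y \<in> space F \<Longrightarrow> g y = (\<Sum>i\<in>I. u i * f i y)"
  shows "M g x = (\<Sum>i\<in>I. u i * M (f i) x)"
proof -
  obtain A B where A: "finite_measure A" "sets A = sets F" and B: "finite_measure B" "sets B = sets F"
    and M: "\<And>h. h \<in> bfun F \<Longrightarrow> M h x = diff_int A B h"
    using M x unfolding bounded_integral_op_def by blast
  have lin: "(\<integral>y. g y \<partial>\<mu>) = (\<Sum>i\<in>I. u i * (\<integral>y. f i y \<partial>\<mu>))" if "finite_measure \<mu>" "sets \<mu> = sets F" for \<mu>
  proof -
    have "(\<integral>y. g y \<partial>\<mu>) = (\<integral>y. (\<Sum>i\<in>I. u i * f i y) \<partial>\<mu>)"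
      using eq by (intro Bochner_Integration.integral_cong) (auto simp: sets_eq_imp_space_eq[OF that(2)])
    also have "\<dots> = (\<Sum>i\<in>I. \<integral>y. u i * f i y \<partial>\<mu>)"
      by (intro Bochner_Integration.integral_sum bfun_integrable[OF bfun_cmult[OF f] that])
    finally show ?thesis by simp
  qed
  have "M g x = (\<Sum>i\<in>I. u i * (\<integral>y. f i y \<partial>A)) - (\<Sum>i\<in>I. u i * (\<integral>y. f i y \<partial>B))"
    using M[OF g] lin[OF A] lin[OF B] by (simp add: diff_int_def)
  also have "\<dots> = (\<Sum>i\<in>I. u i * diff_int A B (f i))"
    by (simp add: diff_int_def right_diff_distrib sum_subtractf)
  also have "\<dots> = (\<Sum>i\<in>I. u i * M (f i) x)"
    using M[OF f] by (intro sum.cong) auto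
  finally show ?thesis .
qed

lemma centered_gaussian_moments:
  assumes "prob_space Q" and Y: "centered_gaussian Q Y"
  shows "integrable Q Y" "(\<integral>\<omega>. Y \<omega> \<partial>Q) = 0" "integrable Q (\<lambda>\<omega>. (Y \<omega>)\<^sup>2)"
proof -
  interpret prob_space Q by fact
  have [measurable]: "Y \<in> borel_measurable Q" using Y unfolding centered_gaussian_def by simp
  have "integrable Q Y \<and> (\<integral>\<omega>. Y \<omega> \<partial>Q) = 0 \<and> integrable Q (\<lambda>\<omega>. (Y \<omega>)\<^sup>2)"
  proof (cases "distr Q borel Y = return borel 0")
    \<comment> \<open>The degenerate law has no Lebesgue density; almost sure vanishing replaces the
      density formulas.\<close>
    case True
    have "AE y in distr Q borel Y. y = 0" unfolding True by (simp add: AE_return)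
    then have ae: "AE \<omega> in Q. Y \<omega> = 0" by (simp add: AE_distr_iff)
    have "integrable Q Y" using ae by (intro iffD2[OF integrable_cong_AE[of Y Q "\<lambda>_. 0"]]) auto
    moreover have "(\<integral>\<omega>. Y \<omega> \<partial>Q) = 0" using ae by (rule integral_eq_zero_AE)
    moreover have "integrable Q (\<lambda>\<omega>. (Y \<omega>)\<^sup>2)"
    proof -
      have "AE \<omega> in Q. (Y \<omega>)\<^sup>2 = 0" using ae by eventually_elim simp
      then show ?thesis
        by (intro iffD2[OF integrable_cong_AE[of "\<lambda>\<omega>. (Y \<omega>)\<^sup>2" Q "\<lambda>_. 0 :: real"]]) measurable
    qed
    ultimately show ?thesis by simp
  next
    case False
    then obtain \<sigma> where \<sigma>: "0 < \<sigma>" and D: "distributed Q lborel Y (\<lambda>x. ennreal (normal_density 0 \<sigma> x))"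
      using Y unfolding centered_gaussian_def by blast
    have "integrable lborel (\<lambda>x. normal_density 0 \<sigma> x * x) \<longleftrightarrow> integrable Q (\<lambda>\<omega>. Y \<omega>)"
      by (rule distributed_integrable[OF D]) auto
    then have "integrable Q Y" using integrable_normal_moment_nz_1[OF \<sigma>, of 0] by blast
    moreover have "(\<integral>\<omega>. Y \<omega> \<partial>Q) = 0" by (rule normal_distributed_expectation[OF \<sigma> D])
    moreover have "integrable Q (\<lambda>\<omega>. (Y \<omega>)\<^sup>2)"
    proof -
      have "integrable lborel (\<lambda>x. normal_density 0 \<sigma> x * x\<^sup>2) \<longleftrightarrow> integrable Q (\<lambda>\<omega>. (Y \<omega>)\<^sup>2)"
        by (rule distributed_integrable[OF D]) auto
      then show ?thesis using integrable_normal_moment[OF \<sigma>, of 0 2] by simp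
    qed
    ultimately show ?thesis by simp
  qed
  then show "integrable Q Y" "(\<integral>\<omega>. Y \<omega> \<partial>Q) = 0" "integrable Q (\<lambda>\<omega>. (Y \<omega>)\<^sup>2)" by auto
qed

text \<open>Holds the data that involve neither \<open>N\<close> nor the particles; every constant
  obtained in this context is uniform in \<open>N\<close>.\<close>

locale mean_field_flow =
  fixes E :: "nat \<Rightarrow> 'a measure" and K :: "'a kernels" and \<eta>0 :: "'a measure" and D :: "'a derivs"
  assumes model: "mean_field_model E K \<eta>0"
    and H1_K: "\<And>k. cond_K (E k) (E (Suc k)) (K (Suc k))"
    and H1_Phi: "\<And>k. upsilon (E k) (E (Suc k)) (Phi K (Suc k)) (D (Suc k))"
begin

abbreviation "\<eta> \<equiv> flow K \<eta>0"
abbreviation "S \<equiv> semigroup_D K \<eta>0 D"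

lemma Phi_probs: "\<mu> \<in> probs (E n) \<Longrightarrow> Phi K (Suc n) \<mu> \<in> probs (E (Suc n))"
  using H1_Phi[of n] unfolding upsilon_def by blast

lemma flow_probs: "\<eta> n \<in> probs (E n)"
  by (induction n) (use model Phi_probs in \<open>auto simp: mean_field_model_def\<close>)

lemma K_measurable: "\<mu> \<in> probs (E n) \<Longrightarrow> K (Suc n) \<mu> \<in> E n \<rightarrow>\<^sub>M prob_algebra (E (Suc n))"
  using model unfolding mean_field_model_def by blast

lemma K_probs: "\<mu> \<in> probs (E n) \<Longrightarrow> x \<in> space (E n) \<Longrightarrow> K (Suc n) \<mu> x \<in> probs (E (Suc n))"
  using K_measurable measurable_space by metis

lemma K_bfun:
  assumes \<mu>: "\<mu> \<in> probs (E n)" and f: "f \<in> bfun (E (Suc n))"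
  shows "(\<lambda>x. \<integral>y. f y \<partial>K (Suc n) \<mu> x) \<in> bfun (E n)"
proof -
  obtain C where C: "\<And>x. x \<in> space (E (Suc n)) \<Longrightarrow> \<bar>f x\<bar> \<le> C" using f by (rule bfunE) blast
  note [measurable] = bfun_measurable[OF f] measurable_prob_algebraD[OF K_measurable[OF \<mu>]]
  show ?thesis
  proof (rule bfunI)
    show "(\<lambda>x. \<integral>y. f y \<partial>K (Suc n) \<mu> x) \<in> borel_measurable (E n)"
      by (rule measurable_compose[OF measurable_prob_algebraD[OF K_measurable[OF \<mu>]]
            integral_measurable_subprob_algebra]) measurable
    show "\<bar>\<integral>y. f y \<partial>K (Suc n) \<mu> x\<bar> \<le> C" if "x \<in> space (E n)" for x
      using probs_abs_integral_le[OF K_probs[OF \<mu> that] f C] .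
  qed
qed

lemma D_integral_op: "\<mu> \<in> probs (E n) \<Longrightarrow> bounded_integral_op (E n) (E (Suc n)) (D (Suc n) \<mu>)"
  using H1_Phi[of n] unfolding upsilon_def by blast

lemma D_bfun: "\<mu> \<in> probs (E n) \<Longrightarrow> f \<in> bfun (E (Suc n)) \<Longrightarrow> D (Suc n) \<mu> f \<in> bfun (E n)"
  using D_integral_op unfolding bounded_integral_op_def by blast

lemma semigroup_D_refl [simp]: "S n n f = f"
  by (simp add: semigroup_D_def)

text \<open>Strips the operator that acts first on \<open>f\<close>, not the outermost one: the
  induction on time replaces \<open>f\<close> by \<open>D (Suc n) (\<eta> n) f\<close> and steps
  back to \<open>n\<close>.\<close>

lemma semigroup_D_Suc: "p \<le> n \<Longrightarrow> S p (Suc n) f = S p n (D (Suc n) (\<eta> n) f)"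
proof -
  have "foldr (\<circ>) (xs @ [g]) id h = foldr (\<circ>) xs id (g h)" for xs :: "('b \<Rightarrow> 'b) list" and g h
    by (induction xs) auto
  then show "p \<le> n \<Longrightarrow> S p (Suc n) f = S p n (D (Suc n) (\<eta> n) f)"
    by (simp add: semigroup_D_def)
qed

lemma semigroup_D_bfun: "p \<le> n \<Longrightarrow> f \<in> bfun (E n) \<Longrightarrow> S p n f \<in> bfun (E p)"
proof (induction n arbitrary: f)
  case (Suc n)
  then show ?case
    by (cases "p = Suc n") (auto simp: semigroup_D_Suc intro!: Suc.IH D_bfun flow_probs)
qed simp

lemma semigroup_D_sum:
  assumes "p \<le> n" "\<And>i. i \<in> I \<Longrightarrow> f i \<in> bfun (E n)" "g \<in> bfun (E n)"
    and "\<And>y. y \<in> space (E n) \<Longrightarrow> g y = (\<Sum>i\<in>I. u i * f i y)" and "x \<in> space (E p)"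
  shows "S p n g x = (\<Sum>i\<in>I. u i * S p n (f i) x)"
  using assms
proof (induction n arbitrary: f g)
  case (Suc n)
  show ?case
  proof (cases "p = Suc n")
    case False
    then have p: "p \<le> n" using Suc.prems(1) by simp
    have "D (Suc n) (\<eta> n) g y = (\<Sum>i\<in>I. u i * D (Suc n) (\<eta> n) (f i) y)" if "y \<in> space (E n)" for y
      using Suc.prems that by (intro bounded_integral_op_sum[OF D_integral_op[OF flow_probs]]) auto
    then show ?thesis
      using Suc.prems p unfolding semigroup_D_Suc[OF p] by (intro Suc.IH D_bfun flow_probs) auto
  qed (use Suc.prems in simp)
qed simp

lemma local_cov_0:
  "f \<in> bfun (E 0) \<Longrightarrow> g \<in> bfun (E 0) \<Longrightarrow>
    local_cov K \<eta>0 0 f g = (\<integral>y. f y * g y \<partial>\<eta>0) - (\<integral>y. f y \<partial>\<eta>0) * (\<integral>y. g y \<partial>\<eta>0)"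
  using probs_covariance[OF flow_probs[of 0, simplified]] by simp

text \<open>In uncentred form only kernel integrals of bounded functions occur, which keeps
  measurability in \<open>x\<close> and linearity at hand.\<close>

lemma local_cov_Suc:
  assumes "f \<in> bfun (E (Suc n))" "g \<in> bfun (E (Suc n))"
  shows "local_cov K \<eta>0 (Suc n) f g =
     (\<integral>x. (\<integral>y. f y * g y \<partial>K (Suc n) (\<eta> n) x)
       - (\<integral>y. f y \<partial>K (Suc n) (\<eta> n) x) * (\<integral>y. g y \<partial>K (Suc n) (\<eta> n) x) \<partial>\<eta> n)"
  unfolding local_cov.simps Let_def
  by (intro Bochner_Integration.integral_cong probs_covariance[OF K_probs[OF flow_probs]] assms)
    (auto simp: probs_space[OF flow_probs])

lemma local_cov_commute: "local_cov K \<eta>0 p f g = local_cov K \<eta>0 p g f"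
  by (cases p) (simp_all add: Let_def mult.commute)

lemma local_cov_sum:
  assumes f: "\<And>i. i \<in> I \<Longrightarrow> f i \<in> bfun (E p)" and h: "h \<in> bfun (E p)" and g: "g \<in> bfun (E p)"
    and eq: "\<And>y. y \<in> space (E p) \<Longrightarrow> h y = (\<Sum>i\<in>I. u i * f i y)"
  shows "local_cov K \<eta>0 p h g = (\<Sum>i\<in>I. u i * local_cov K \<eta>0 p (f i) g)"
proof -
  have cov: "(\<integral>y. h y * g y \<partial>\<mu>) - (\<integral>y. h y \<partial>\<mu>) * (\<integral>y. g y \<partial>\<mu>)
    = (\<Sum>i\<in>I. u i * ((\<integral>y. f i y * g y \<partial>\<mu>) - (\<integral>y. f i y \<partial>\<mu>) * (\<integral>y. g y \<partial>\<mu>)))"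
    if \<mu>: "\<mu> \<in> probs (E p)" for \<mu>
  proof -
    have "(\<integral>y. h y * g y \<partial>\<mu>) = (\<Sum>i\<in>I. u i * (\<integral>y. f i y * g y \<partial>\<mu>))"
      using f g eq by (intro probs_integral_sum[OF \<mu>] bfun_mult) (auto simp: sum_distrib_right mult.assoc)
    moreover have "(\<integral>y. h y \<partial>\<mu>) = (\<Sum>i\<in>I. u i * (\<integral>y. f i y \<partial>\<mu>))"
      using f eq by (intro probs_integral_sum[OF \<mu>]) auto
    ultimately show ?thesis
      by (simp add: right_diff_distrib sum_subtractf sum_distrib_right mult.assoc)
  qed
  show ?thesis
  proof (cases p)
    case 0
    show ?thesis
      using cov[OF flow_probs[of p]] f h g unfolding 0 by (simp add: local_cov_0 del: local_cov.simps)
  next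
    case (Suc n)
    let ?c = "\<lambda>h x. (\<integral>y. h y * g y \<partial>K (Suc n) (\<eta> n) x)
       - (\<integral>y. h y \<partial>K (Suc n) (\<eta> n) x) * (\<integral>y. g y \<partial>K (Suc n) (\<eta> n) x)"
    have "(\<integral>x. ?c h x \<partial>\<eta> n) = (\<Sum>i\<in>I. u i * (\<integral>x. ?c (f i) x \<partial>\<eta> n))"
    proof (rule probs_integral_sum[OF flow_probs])
      show "?c (f i) \<in> bfun (E n)" if "i \<in> I" for i
        using f[OF that] g unfolding Suc by (intro bfun_diff bfun_mult K_bfun flow_probs)
      show "?c h x = (\<Sum>i\<in>I. u i * ?c (f i) x)" if "x \<in> space (E n)" for x
        using cov[of "K (Suc n) (\<eta> n) x"] K_probs[OF flow_probs that] unfolding Suc by simp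
    qed
    then show ?thesis using f h g unfolding Suc by (simp add: local_cov_Suc del: local_cov.simps)
  qed
qed

text \<open>The second moment of \<open>W\<close> at time \<open>n\<close>, written without the
  Gaussian fields so that the analysis of the particles never refers to \<open>Q\<close>. Its
  recursion in \<open>n\<close> is the one that the Laplace limits obey.\<close>

definition limit_var :: "nat \<Rightarrow> ('a \<Rightarrow> real) \<Rightarrow> real" where
  "limit_var n f = (\<Sum>p\<le>n. local_cov K \<eta>0 p (S p n f) (S p n f))"

lemma limit_var_0: "limit_var 0 f = local_cov K \<eta>0 0 f f"
  by (simp add: limit_var_def)

lemma limit_var_Suc:
  "limit_var (Suc n) f = local_cov K \<eta>0 (Suc n) f f + limit_var n (D (Suc n) (\<eta> n) f)"
  by (simp add: limit_var_def semigroup_D_Suc)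

text \<open>Bilinearity turns the scalar limits for all linear combinations of the given functions
  into one quadratic form in the coefficients.\<close>

lemma limit_var_sum:
  assumes f: "\<And>i. i \<in> I \<Longrightarrow> f i \<in> bfun (E n)"
  shows "limit_var n (\<lambda>x. \<Sum>i\<in>I. u i * f i x)
    = (\<Sum>i\<in>I. \<Sum>j\<in>I. u i * u j * (\<Sum>p\<le>n. local_cov K \<eta>0 p (S p n (f i)) (S p n (f j))))"
proof -
  let ?g = "\<lambda>x. \<Sum>i\<in>I. u i * f i x"
  have g: "?g \<in> bfun (E n)" using f by (intro bfun_sum bfun_cmult)
  have "local_cov K \<eta>0 p (S p n ?g) (S p n ?g)
      = (\<Sum>i\<in>I. \<Sum>j\<in>I. u i * u j * local_cov K \<eta>0 p (S p n (f i)) (S p n (f j)))" if p: "p \<le> n" for p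
  proof -
    note Sf = semigroup_D_bfun[OF p f] and Sg = semigroup_D_bfun[OF p g]
    have eq: "S p n ?g y = (\<Sum>i\<in>I. u i * S p n (f i) y)" if "y \<in> space (E p)" for y
      using f g that by (intro semigroup_D_sum[OF p]) auto
    have "local_cov K \<eta>0 p (S p n ?g) (S p n ?g) = (\<Sum>i\<in>I. u i * local_cov K \<eta>0 p (S p n (f i)) (S p n ?g))"
      by (intro local_cov_sum Sf Sg eq)
    also have "\<dots> = (\<Sum>i\<in>I. u i * local_cov K \<eta>0 p (S p n ?g) (S p n (f i)))"
      by (simp add: local_cov_commute)
    also have "\<dots> = (\<Sum>i\<in>I. u i * (\<Sum>j\<in>I. u j * local_cov K \<eta>0 p (S p n (f j)) (S p n (f i))))"
      by (intro sum.cong refl arg_cong2[where f = "(*)"] local_cov_sum Sf Sg eq)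
    also have "\<dots> = (\<Sum>i\<in>I. \<Sum>j\<in>I. u i * u j * local_cov K \<eta>0 p (S p n (f i)) (S p n (f j)))"
      by (simp add: sum_distrib_left mult.assoc local_cov_commute)
    finally show ?thesis .
  qed
  then have "limit_var n ?g
    = (\<Sum>p\<le>n. \<Sum>i\<in>I. \<Sum>j\<in>I. u i * u j * local_cov K \<eta>0 p (S p n (f i)) (S p n (f j)))"
    unfolding limit_var_def by (intro sum.cong) auto
  also have "\<dots> = (\<Sum>i\<in>I. \<Sum>j\<in>I. \<Sum>p\<le>n. u i * u j * local_cov K \<eta>0 p (S p n (f i)) (S p n (f j)))"
    by (subst sum.swap, intro sum.cong refl, rule sum.swap)
  finally show ?thesis by (simp add: sum_distrib_left)
qed

text \<open>At equal times the covariance is prescribed; at different times it vanishes because the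
  whole fields are independent and each coordinate is centred.\<close>

lemma limit_field_covariance:
  assumes V: "limit_fields E K \<eta>0 Q V" and f: "f \<in> bfun (E p)" and g: "g \<in> bfun (E q)"
  shows "integrable Q (\<lambda>\<omega>. V p f \<omega> * V q g \<omega>)"
    and "(\<integral>\<omega>. V p f \<omega> * V q g \<omega> \<partial>Q) = (if p = q then local_cov K \<eta>0 p f g else 0)"
proof -
  interpret prob_space Q using V unfolding limit_fields_def by simp
  have gauss: "centered_gaussian Q (V k h)" if h: "h \<in> bfun (E k)" for k h
  proof -
    have "centered_gaussian_field Q (bfun (E k)) (V k)" using V unfolding limit_fields_def by simp
    from this[unfolded centered_gaussian_field_def, rule_format, of "{h}" "\<lambda>_. 1"] h show ?thesis by simp
  qed
  note mf = centered_gaussian_moments[OF prob_space_axioms gauss[OF f]]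
  note mg = centered_gaussian_moments[OF prob_space_axioms gauss[OF g]]
  have [measurable]: "V p f \<in> borel_measurable Q" "V q g \<in> borel_measurable Q"
    using gauss[OF f] gauss[OF g] unfolding centered_gaussian_def by auto
  show "integrable Q (\<lambda>\<omega>. V p f \<omega> * V q g \<omega>)"
  proof (rule Bochner_Integration.integrable_bound)
    show "integrable Q (\<lambda>\<omega>. (V p f \<omega>)\<^sup>2 + (V q g \<omega>)\<^sup>2)" using mf(3) mg(3) by simp
    have "\<bar>a * b\<bar> \<le> a\<^sup>2 + b\<^sup>2" for a b :: real
    proof -
      have "2 * (\<bar>a\<bar> * \<bar>b\<bar>) \<le> a\<^sup>2 + b\<^sup>2"
        using sum_squares_bound[of "\<bar>a\<bar>" "\<bar>b\<bar>"] by simp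
      moreover have "0 \<le> \<bar>a\<bar> * \<bar>b\<bar>" by simp
      ultimately show ?thesis unfolding abs_mult by linarith
    qed
    then show "AE \<omega> in Q. norm (V p f \<omega> * V q g \<omega>) \<le> norm ((V p f \<omega>)\<^sup>2 + (V q g \<omega>)\<^sup>2)" by simp
  qed measurable
  show "(\<integral>\<omega>. V p f \<omega> * V q g \<omega> \<partial>Q) = (if p = q then local_cov K \<eta>0 p f g else 0)"
  proof (cases "p = q")
    case True
    then show ?thesis using V f g unfolding limit_fields_def by simp
  next
    case False
    \<comment> \<open>One function is selected at every time, 0 away from \<open>p\<close> and
      \<open>q\<close>, because the projection of the independent fields to coordinates asks for a
      member of \<open>bfun (E k)\<close> at each \<open>k\<close>.\<close>
    define h where "h = (\<lambda>k. if k = p then f else if k = q then g else (\<lambda>_. 0))"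
    have h: "h k \<in> bfun (E k)" for k using f g by (auto simp: h_def bfun_const)
    have "indep_vars (\<lambda>n. \<Pi>\<^sub>M f\<in>bfun (E n). (borel :: real measure)) (\<lambda>n \<omega>. \<lambda>f\<in>bfun (E n). V n f \<omega>) UNIV"
      using V unfolding limit_fields_def by blast
    from indep_vars_compose2[OF this, of "\<lambda>n x. x (h n)" "\<lambda>_. borel", OF measurable_component_singleton[OF h]]
    have "indep_vars (\<lambda>_. borel) (\<lambda>n. V n (h n)) UNIV" using h by simp
    then have ind: "indep_vars (\<lambda>_. borel) (\<lambda>n. V n (h n)) {p, q}"
      by (rule indep_vars_subset) simp
    have "(\<integral>\<omega>. (\<Prod>i\<in>{p, q}. V i (h i) \<omega>) \<partial>Q) = (\<Prod>i\<in>{p, q}. \<integral>\<omega>. V i (h i) \<omega> \<partial>Q)"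
      using mf(1) mg(1) by (intro indep_vars_lebesgue_integral ind) (auto simp: h_def)
    then show ?thesis using False mf(2) by (simp add: h_def)
  qed
qed

lemma W_covariance:
  assumes V: "limit_fields E K \<eta>0 Q V" and f: "f \<in> bfun (E n)" and g: "g \<in> bfun (E n)"
  shows "integrable Q (\<lambda>\<omega>. W K \<eta>0 D V n f \<omega> * W K \<eta>0 D V n g \<omega>)"
    and "(\<integral>\<omega>. W K \<eta>0 D V n f \<omega> * W K \<eta>0 D V n g \<omega> \<partial>Q)
      = (\<Sum>p\<le>n. local_cov K \<eta>0 p (S p n f) (S p n g))"
proof -
  have eq: "W K \<eta>0 D V n f \<omega> * W K \<eta>0 D V n g \<omega>
     = (\<Sum>p\<le>n. \<Sum>q\<le>n. V p (S p n f) \<omega> * V q (S q n g) \<omega>)" for \<omega>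
    unfolding W_def by (rule sum_product)
  have i: "integrable Q (\<lambda>\<omega>. V p (S p n f) \<omega> * V q (S q n g) \<omega>)" if "p \<le> n" "q \<le> n" for p q
    using that f g by (intro limit_field_covariance(1)[OF V] semigroup_D_bfun)
  show "integrable Q (\<lambda>\<omega>. W K \<eta>0 D V n f \<omega> * W K \<eta>0 D V n g \<omega>)"
    unfolding eq using i by (intro Bochner_Integration.integrable_sum) auto
  have "(\<integral>\<omega>. W K \<eta>0 D V n f \<omega> * W K \<eta>0 D V n g \<omega> \<partial>Q)
     = (\<Sum>p\<le>n. \<Sum>q\<le>n. \<integral>\<omega>. V p (S p n f) \<omega> * V q (S q n g) \<omega> \<partial>Q)"
  proof -
    have "(\<integral>\<omega>. (\<Sum>p\<le>n. \<Sum>q\<le>n. V p (S p n f) \<omega> * V q (S q n g) \<omega>) \<partial>Q)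
      = (\<Sum>p\<le>n. \<integral>\<omega>. (\<Sum>q\<le>n. V p (S p n f) \<omega> * V q (S q n g) \<omega>) \<partial>Q)"
      using i by (intro Bochner_Integration.integral_sum Bochner_Integration.integrable_sum) auto
    also have "\<dots> = (\<Sum>p\<le>n. \<Sum>q\<le>n. \<integral>\<omega>. V p (S p n f) \<omega> * V q (S q n g) \<omega> \<partial>Q)"
      using i by (intro sum.cong refl Bochner_Integration.integral_sum) auto
    finally show ?thesis unfolding eq .
  qed
  also have "\<dots> = (\<Sum>p\<le>n. \<Sum>q\<le>n. if p = q then local_cov K \<eta>0 p (S p n f) (S p n g) else 0)"
    using f g by (intro sum.cong refl) (auto simp: limit_field_covariance(2)[OF V] semigroup_D_bfun)
  finally show "(\<integral>\<omega>. W K \<eta>0 D V n f \<omega> * W K \<eta>0 D V n g \<omega> \<partial>Q)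
      = (\<Sum>p\<le>n. local_cov K \<eta>0 p (S p n f) (S p n g))" by simp
qed

end

section \<open>Transition law of the particle system\<close>

locale mean_field_particles = mean_field_flow E K \<eta>0 D
  for E :: "nat \<Rightarrow> 'a measure" and K \<eta>0 D +
  fixes N :: nat and P :: "'w measure" and \<xi> :: "nat \<Rightarrow> 'w \<Rightarrow> nat \<Rightarrow> 'a"
  assumes N: "1 \<le> N" and system: "particle_system E K \<eta>0 N P \<xi>"
begin

sublocale P: prob_space P
  using system unfolding particle_system_def by blast

abbreviation config :: "nat \<Rightarrow> (nat \<Rightarrow> 'a) measure" where
  "config n \<equiv> \<Pi>\<^sub>M i\<in>{..<N}. E n"

abbreviation emp :: "nat \<Rightarrow> (nat \<Rightarrow> 'a) \<Rightarrow> 'a measure" where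
  "emp n x \<equiv> empirical (E n) N x"

abbreviation kern :: "nat \<Rightarrow> (nat \<Rightarrow> 'a) \<Rightarrow> nat \<Rightarrow> 'a measure" where
  "kern n x i \<equiv> K (Suc n) (emp n x) (x i)"

lemma \<xi>_measurable [measurable]: "\<xi> n \<in> P \<rightarrow>\<^sub>M config n"
  using system unfolding particle_system_def by blast

lemma config_space: "x \<in> space (config n) \<Longrightarrow> i < N \<Longrightarrow> x i \<in> space (E n)"
  by (auto simp: space_PiM)

lemma emp_measurable: "x \<in> space (config n) \<Longrightarrow> x \<in> uniform_count_measure {..<N} \<rightarrow>\<^sub>M E n"
  by (auto simp: config_space measurable_def space_uniform_count_measure sets_uniform_count_measure)

lemma emp_probs: "x \<in> space (config n) \<Longrightarrow> emp n x \<in> probs (E n)"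
  unfolding empirical_def space_prob_algebra using N
  by (auto intro!: prob_space.prob_space_distr prob_space_uniform_count_measure emp_measurable
      simp: lessThan_empty_iff)

lemma emp_integral:
  fixes h :: "'a \<Rightarrow> real"
  assumes x: "x \<in> space (config n)" and h: "h \<in> borel_measurable (E n)"
  shows "(\<integral>y. h y \<partial>emp n x) = (\<Sum>i<N. h (x i)) / N"
  unfolding empirical_def
  using emp_measurable[OF x] h by (subst integral_distr) (auto simp: uniform_count_measure_def lebesgue_integral_point_measure_finite sum_divide_distrib)

lemma kern_probs: "x \<in> space (config n) \<Longrightarrow> i < N \<Longrightarrow> kern n x i \<in> probs (E (Suc n))"
  by (intro K_probs emp_probs config_space)

text \<open>The model makes only the mass of each fixed set a measurable function of the
  configuration. For probability measures this amounts to measurability into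
  \<open>prob_algebra\<close>, from which kernel integrals become measurable.\<close>

lemma kern_measurable:
  assumes i: "i < N"
  shows "(\<lambda>x. kern n x i) \<in> config n \<rightarrow>\<^sub>M prob_algebra (E (Suc n))"
proof (rule measurable_prob_algebraI)
  show "prob_space (kern n x i)" if "x \<in> space (config n)" for x
    using kern_probs[OF that i] by (rule probs_prob_space)
  show "(\<lambda>x. kern n x i) \<in> config n \<rightarrow>\<^sub>M subprob_algebra (E (Suc n))"
  proof (rule measurable_subprob_algebra)
    fix x assume x: "x \<in> space (config n)"
    show "subprob_space (kern n x i)"
      by (intro prob_space_imp_subprob_space probs_prob_space[OF kern_probs[OF x i]])
    show "sets (kern n x i) = sets (E (Suc n))" using kern_probs[OF x i] by (rule probs_sets)
  next
    fix A assume "A \<in> sets (E (Suc n))"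
    then have "(\<lambda>x. measure (kern n x i) A) \<in> borel_measurable (config n)"
      using model N i unfolding mean_field_model_def by blast
    then have "(\<lambda>x. ennreal (measure (kern n x i) A)) \<in> borel_measurable (config n)" by measurable
    then show "(\<lambda>x. emeasure (kern n x i) A) \<in> borel_measurable (config n)"
    proof (rule measurable_cong[THEN iffD1, rotated])
      fix x assume x: "x \<in> space (config n)"
      interpret prob_space "kern n x i" using kern_probs[OF x i] by (rule probs_prob_space)
      show "ennreal (measure (kern n x i) A) = emeasure (kern n x i) A"
        by (simp add: emeasure_eq_measure)
    qed
  qed
qed

lemma kern_bfun:
  assumes i: "i < N" and f: "f \<in> bfun (E (Suc n))"
  shows "(\<lambda>x. \<integral>y. f y \<partial>kern n x i) \<in> bfun (config n)"
proof -
  obtain C where C: "\<And>x. x \<in> space (E (Suc n)) \<Longrightarrow> \<bar>f x\<bar> \<le> C" using f by (rule bfunE) blast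
  note [measurable] = bfun_measurable[OF f]
  show ?thesis
  proof (rule bfunI)
    show "(\<lambda>x. \<integral>y. f y \<partial>kern n x i) \<in> borel_measurable (config n)"
      by (rule measurable_compose[OF measurable_prob_algebraD[OF kern_measurable[OF i]]
            integral_measurable_subprob_algebra]) measurable
    show "\<bar>\<integral>y. f y \<partial>kern n x i\<bar> \<le> C" if "x \<in> space (config n)" for x
      using probs_abs_integral_le[OF kern_probs[OF that i] f C] .
  qed
qed

text \<open>Integration against the empirical measure is a particle average, so \<open>Phi\<close>
  at the empirical measure is the conditional mean of the next empirical measure.\<close>

lemma Phi_emp_integral:
  assumes x: "x \<in> space (config n)" and f: "f \<in> bfun (E (Suc n))"
  shows "(\<integral>y. f y \<partial>Phi K (Suc n) (emp n x)) = (\<Sum>i<N. \<integral>y. f y \<partial>kern n x i) / N"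
proof -
  note e = emp_probs[OF x]
  obtain C where C: "\<And>x. x \<in> space (E (Suc n)) \<Longrightarrow> \<bar>f x\<bar> \<le> C" using f by (rule bfunE) blast
  interpret e: prob_space "emp n x" using e by (rule probs_prob_space)
  have "(\<integral>y. f y \<partial>Phi K (Suc n) (emp n x)) = (\<integral>z. (\<integral>y. f y \<partial>K (Suc n) (emp n x) z) \<partial>emp n x)"
    unfolding Phi_def
  proof (rule integral_bind[where K = "E (Suc n)" and B = C and B' = 1])
    show "K (Suc n) (emp n x) \<in> emp n x \<rightarrow>\<^sub>M subprob_algebra (E (Suc n))"
      using measurable_prob_algebraD[OF K_measurable[OF e]]
      by (simp add: measurable_cong_sets[OF probs_sets[OF e] refl])
    show "AE z in emp n x. emeasure (K (Suc n) (emp n x) z) (space (K (Suc n) (emp n x) z)) \<le> ennreal 1"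
      using probs_prob_space[OF K_probs[OF e]]
      by (intro AE_I2) (simp add: probs_space[OF e] prob_space.emeasure_space_1)
  qed (use f C e.finite_measure_axioms in \<open>auto simp: bfun_measurable\<close>)
  also have "\<dots> = (\<Sum>i<N. \<integral>y. f y \<partial>kern n x i) / N"
    using bfun_measurable[OF K_bfun[OF e f]] by (rule emp_integral[OF x])
  finally show ?thesis .
qed

text \<open>The factors with index at least \<open>N\<close> play no role; they only make the family total.\<close>

definition kern_prod :: "nat \<Rightarrow> (nat \<Rightarrow> 'a) \<Rightarrow> (nat \<Rightarrow> 'a) measure" where
  "kern_prod n x = (\<Pi>\<^sub>M i\<in>{..<N}. if i < N then kern n x i else \<eta> (Suc n))"

context
  fixes n x assumes x: "x \<in> space (config n)"
begin

lemma kern_factor: "(if i < N then kern n x i else \<eta> (Suc n)) \<in> probs (E (Suc n))"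
  using kern_probs[OF x] flow_probs[of "Suc n"] by (simp del: flow.simps)

interpretation kp: product_prob_space "\<lambda>i. if i < N then kern n x i else \<eta> (Suc n)" "{..<N}"
  by (intro product_prob_spaceI probs_prob_space[OF kern_factor])

lemma prob_space_kern_prod: "prob_space (kern_prod n x)"
  unfolding kern_prod_def by (rule kp.P.prob_space_axioms)

lemma sets_kern_prod: "sets (kern_prod n x) = sets (config (Suc n))"
  unfolding kern_prod_def by (intro sets_PiM_cong refl probs_sets kern_factor)

lemma emeasure_kern_prod:
  assumes A: "A \<in> {..<N} \<rightarrow> sets (E (Suc n))"
  shows "emeasure (kern_prod n x) (Pi\<^sub>E {..<N} A) = ennreal (\<Prod>i<N. measure (kern n x i) (A i))"
proof -
  have "emeasure (kern_prod n x) (Pi\<^sub>E {..<N} A) = (\<Prod>i<N. emeasure (if i < N then kern n x i else \<eta> (Suc n)) (A i))"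
    unfolding kern_prod_def using A by (intro kp.emeasure_PiM) (auto simp: probs_sets[OF kern_probs[OF x]])
  also have "\<dots> = (\<Prod>i<N. ennreal (measure (kern n x i) (A i)))"
  proof (intro prod.cong refl)
    fix i assume "i \<in> {..<N}"
    then interpret prob_space "kern n x i" using probs_prob_space[OF kern_probs[OF x]] by simp
    show "emeasure (if i < N then kern n x i else \<eta> (Suc n)) (A i) = ennreal (measure (kern n x i) (A i))"
      using \<open>i \<in> {..<N}\<close> by (simp add: emeasure_eq_measure)
  qed
  finally show ?thesis by (simp add: prod_ennreal)
qed

lemma nn_integral_kern_prod:
  assumes \<psi>: "\<psi> \<in> borel_measurable (E (Suc n))"
  shows "(\<integral>\<^sup>+y. (\<Prod>i<N. \<psi> (y i)) \<partial>kern_prod n x) = (\<Prod>i<N. \<integral>\<^sup>+y. \<psi> y \<partial>kern n x i)"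
proof -
  have "(\<integral>\<^sup>+y. (\<Prod>i<N. \<psi> (y i)) \<partial>kern_prod n x)
    = (\<Prod>i<N. \<integral>\<^sup>+y. \<psi> y \<partial>(if i < N then kern n x i else \<eta> (Suc n)))"
    unfolding kern_prod_def using \<psi>
    by (intro kp.product_nn_integral_prod) (auto simp: measurable_cong_sets[OF probs_sets[OF kern_probs[OF x]] refl])
  then show ?thesis by simp
qed

end

lemma config_generator:
  "sets (config n) = sigma_sets (space (config n)) {Pi\<^sub>E {..<N} A | A. A \<in> {..<N} \<rightarrow> sets (E n)}"
  using sets_PiM[of "{..<N}" "\<lambda>_. E n"] by (simp add: space_PiM prod_algebra_eq_finite Pi_def)

lemma config_generator_stable: "Int_stable {Pi\<^sub>E {..<N} A | A. A \<in> {..<N} \<rightarrow> sets (E n)}"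
  using Int_stable_PiE[of "{..<N}" "{..<N}" "\<lambda>_. E n"] by (simp add: Pi_def Ball_def)

lemma config_generator_subset:
  "{Pi\<^sub>E {..<N} A | A. A \<in> {..<N} \<rightarrow> sets (E n)} \<subseteq> Pow (space (config n))"
  by (auto simp: space_PiM PiE_def Pi_def dest: sets.sets_into_space)

text \<open>Rectangles generate the product field and are stable under intersection, and on them the
  mass is a finite product of measurable functions.\<close>

lemma kern_prod_measurable: "kern_prod n \<in> config n \<rightarrow>\<^sub>M prob_algebra (config (Suc n))"
proof (rule measurable_prob_algebra_generated[OF config_generator config_generator_stable config_generator_subset])
  fix B assume "B \<in> {Pi\<^sub>E {..<N} A | A. A \<in> {..<N} \<rightarrow> sets (E (Suc n))}"
  then obtain A where A: "A \<in> {..<N} \<rightarrow> sets (E (Suc n))" and B: "B = Pi\<^sub>E {..<N} A" by blast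
  have "(\<lambda>x. measure (kern n x i) (A i)) \<in> borel_measurable (config n)" if "i < N" for i
    using that A model N unfolding mean_field_model_def by (auto simp: Pi_def)
  then have "(\<lambda>x. ennreal (\<Prod>i<N. measure (kern n x i) (A i))) \<in> borel_measurable (config n)"
    by (intro measurable_compose[OF _ measurable_ennreal] borel_measurable_prod) auto
  then show "(\<lambda>x. emeasure (kern_prod n x) B) \<in> borel_measurable (config n)"
    unfolding B by (rule measurable_cong[THEN iffD1, rotated]) (rule emeasure_kern_prod[OF _ A, symmetric])
qed (simp_all add: prob_space_kern_prod sets_kern_prod)

lemma history_subalgebra: "subalgebra P (history E N P \<xi> n)"
proof -
  have m: "(\<lambda>\<omega>. \<lambda>p\<in>{..n}. \<xi> p \<omega>) \<in> P \<rightarrow>\<^sub>M (\<Pi>\<^sub>M p\<in>{..n}. \<Pi>\<^sub>M i\<in>{..<N}. E p)" by measurable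
  have "sets (history E N P \<xi> n) \<subseteq> sets P"
    unfolding history_def
    by (subst sets_vimage_algebra2) (use measurable_space[OF m] measurable_sets[OF m] in blast)+
  then show ?thesis unfolding subalgebra_def by (simp add: history_def)
qed

lemma \<xi>_history: "\<xi> n \<in> history E N P \<xi> n \<rightarrow>\<^sub>M config n"
proof -
  let ?H = "\<lambda>\<omega>. \<lambda>p\<in>{..n}. \<xi> p \<omega>"
  have "?H \<in> P \<rightarrow>\<^sub>M (\<Pi>\<^sub>M p\<in>{..n}. config p)" by measurable
  then have "?H \<in> space P \<rightarrow> space (\<Pi>\<^sub>M p\<in>{..n}. config p)"
    by (intro funcsetI) (rule measurable_space)
  then have "?H \<in> history E N P \<xi> n \<rightarrow>\<^sub>M (\<Pi>\<^sub>M p\<in>{..n}. config p)"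
    unfolding history_def by (rule measurable_vimage_algebra1)
  then have "(\<lambda>\<omega>. ?H \<omega> n) \<in> history E N P \<xi> n \<rightarrow>\<^sub>M config n"
    by (rule measurable_compose[OF _ measurable_component_singleton]) simp
  then show ?thesis by simp
qed

text \<open>The particle system prescribes conditional probabilities of rectangles only. Weighted by
  \<open>G\<close> at the current configuration, the law of the next configuration and the mixture
  of the product kernels are finite measures that agree on rectangles, hence coincide. The product
  of the \<psi> is then integrated against both.\<close>

lemma transition:
  fixes G :: "(nat \<Rightarrow> 'a) \<Rightarrow> real" and \<psi> :: "'a \<Rightarrow> ennreal"
  assumes G: "G \<in> bfun (config n)" and G0: "\<And>x. x \<in> space (config n) \<Longrightarrow> 0 \<le> G x"
    and \<psi>: "\<psi> \<in> borel_measurable (E (Suc n))"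
  shows "(\<integral>\<^sup>+\<omega>. ennreal (G (\<xi> n \<omega>)) * (\<Prod>i<N. \<psi> (\<xi> (Suc n) \<omega> i)) \<partial>P)
    = (\<integral>\<^sup>+\<omega>. ennreal (G (\<xi> n \<omega>)) * (\<Prod>i<N. \<integral>\<^sup>+y. \<psi> y \<partial>kern n (\<xi> n \<omega>) i) \<partial>P)"
proof -
  let ?F = "history E N P \<xi> n"
  interpret F: finite_measure_subalgebra P ?F
    by standard (rule history_subalgebra)
  note [measurable] = bfun_measurable[OF G] \<psi>
  have sp: "\<xi> n \<omega> \<in> space (config n)" if "\<omega> \<in> space P" for \<omega>
    using measurable_space[OF \<xi>_measurable that] .
  have G\<xi>: "(\<lambda>\<omega>. G (\<xi> n \<omega>)) \<in> bfun P" using G \<xi>_measurable by (rule bfun_comp)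
  have GF: "(\<lambda>\<omega>. G (\<xi> n \<omega>)) \<in> borel_measurable ?F"
    by (rule measurable_compose[OF \<xi>_history]) measurable
  \<comment> \<open>Carrying the weight \<open>G\<close> as a density reduces the claim to the
    equality of two finite measures on configurations.\<close>
  define m where "m = density P (\<lambda>\<omega>. ennreal (G (\<xi> n \<omega>)))"
  have sm[measurable_cong]: "sets m = sets P" unfolding m_def by simp
  have spm: "space m = space P" unfolding m_def by simp
  have nem: "space m \<noteq> {}" unfolding spm by (rule P.not_empty)
  have k[measurable]: "(\<lambda>\<omega>. kern_prod n (\<xi> n \<omega>)) \<in> P \<rightarrow>\<^sub>M subprob_algebra (config (Suc n))"
    by (rule measurable_compose[OF \<xi>_measurable measurable_prob_algebraD[OF kern_prod_measurable]])
  have km: "(\<lambda>\<omega>. kern_prod n (\<xi> n \<omega>)) \<in> m \<rightarrow>\<^sub>M subprob_algebra (config (Suc n))"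
    by measurable
  define m1 where "m1 = distr m (config (Suc n)) (\<xi> (Suc n))"
  define m2 where "m2 = m \<bind> (\<lambda>\<omega>. kern_prod n (\<xi> n \<omega>))"
  have "m1 = m2"
  proof (rule measure_eqI_generator_eq[OF config_generator_stable config_generator_subset, where A = "\<lambda>_. space (config (Suc n))"])
    fix X assume "X \<in> {Pi\<^sub>E {..<N} A | A. A \<in> {..<N} \<rightarrow> sets (E (Suc n))}"
    then obtain A where A: "A \<in> {..<N} \<rightarrow> sets (E (Suc n))" and X: "X = Pi\<^sub>E {..<N} A" by blast
    have Xs[measurable]: "X \<in> sets (config (Suc n))" unfolding X using A by (intro sets_PiM_I_finite) auto
    define B where "B = {\<omega>\<in>space P. \<forall>i<N. \<xi> (Suc n) \<omega> i \<in> A i}"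
    have B: "B = \<xi> (Suc n) -` X \<inter> space P"
      using measurable_space[OF \<xi>_measurable[of "Suc n"]] unfolding X B_def by (fastforce simp: space_PiM PiE_def)
    have Bs[measurable]: "B \<in> sets P" unfolding B by measurable
    let ?p = "\<lambda>\<omega>. \<Prod>i<N. measure (kern n (\<xi> n \<omega>) i) (A i)"
    have ind: "(indicator B :: 'w \<Rightarrow> real) \<in> bfun P"
      using borel_measurable_indicator[OF Bs] by (rule bfunI[of _ _ 1]) simp
    have i1: "integrable P (\<lambda>\<omega>. G (\<xi> n \<omega>) * indicator B \<omega>)"
      by (intro P.integrable_bfun bfun_mult G\<xi> ind)
    have ae: "AE \<omega> in P. real_cond_exp P ?F (indicator B) \<omega> = ?p \<omega>"
      using system A unfolding particle_system_def B_def by blast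
    have Gp: "(\<lambda>\<omega>. G (\<xi> n \<omega>) * ?p \<omega>) \<in> borel_measurable P"
    proof -
      have "(\<lambda>\<omega>. measure (kern n (\<xi> n \<omega>) i) (A i)) \<in> borel_measurable P" if "i < N" for i
        using that A model N unfolding mean_field_model_def
        by (intro measurable_compose[OF \<xi>_measurable, where g = "\<lambda>x. measure (kern n x i) (A i)"]) (auto simp: Pi_def)
      then show ?thesis by (intro borel_measurable_times borel_measurable_prod) auto
    qed
    \<comment> \<open>The defining property of the conditional expectation, tested with
      \<open>G (\<xi> n \<omega>)\<close>, which is measurable for the history up to
      \<open>n\<close>.\<close>
    have ce: "(\<integral>\<omega>. G (\<xi> n \<omega>) * ?p \<omega> \<partial>P) = (\<integral>\<omega>. G (\<xi> n \<omega>) * indicator B \<omega> \<partial>P)"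
      and ip: "integrable P (\<lambda>\<omega>. G (\<xi> n \<omega>) * ?p \<omega>)"
    proof -
      have eq: "AE \<omega> in P. G (\<xi> n \<omega>) * real_cond_exp P ?F (indicator B) \<omega> = G (\<xi> n \<omega>) * ?p \<omega>"
        using ae by eventually_elim simp
      have "(\<integral>\<omega>. G (\<xi> n \<omega>) * ?p \<omega> \<partial>P) = (\<integral>\<omega>. G (\<xi> n \<omega>) * real_cond_exp P ?F (indicator B) \<omega> \<partial>P)"
        using eq Gp by (intro integral_cong_AE) auto
      also have "\<dots> = (\<integral>\<omega>. G (\<xi> n \<omega>) * indicator B \<omega> \<partial>P)"
        by (rule F.real_cond_exp_intg(2)[OF i1 GF]) measurable
      finally show "(\<integral>\<omega>. G (\<xi> n \<omega>) * ?p \<omega> \<partial>P) = (\<integral>\<omega>. G (\<xi> n \<omega>) * indicator B \<omega> \<partial>P)" .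
      have "integrable P (\<lambda>\<omega>. G (\<xi> n \<omega>) * real_cond_exp P ?F (indicator B) \<omega>)"
        by (rule F.real_cond_exp_intg(1)[OF i1 GF]) measurable
      then show "integrable P (\<lambda>\<omega>. G (\<xi> n \<omega>) * ?p \<omega>)"
        using eq Gp by (subst (asm) integrable_cong_AE) auto
    qed
    have "emeasure m1 X = emeasure m B"
      unfolding m1_def B using Xs by (subst emeasure_distr) (auto simp: spm)
    also have "\<dots> = (\<integral>\<^sup>+\<omega>. ennreal (G (\<xi> n \<omega>)) * indicator B \<omega> \<partial>P)"
      unfolding m_def by (rule emeasure_density) auto
    also have "\<dots> = (\<integral>\<^sup>+\<omega>. ennreal (G (\<xi> n \<omega>) * indicator B \<omega>) \<partial>P)"
      by (intro nn_integral_cong) (auto simp: indicator_def)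
    also have "\<dots> = ennreal (\<integral>\<omega>. G (\<xi> n \<omega>) * indicator B \<omega> \<partial>P)"
      using i1 G0 sp by (intro nn_integral_eq_integral) auto
    also have "\<dots> = (\<integral>\<^sup>+\<omega>. ennreal (G (\<xi> n \<omega>) * ?p \<omega>) \<partial>P)"
      unfolding ce[symmetric] using ip G0 sp
      by (intro nn_integral_eq_integral[symmetric]) (auto intro!: AE_I2 mult_nonneg_nonneg prod_nonneg)
    also have "\<dots> = (\<integral>\<^sup>+\<omega>. ennreal (G (\<xi> n \<omega>)) * emeasure (kern_prod n (\<xi> n \<omega>)) X \<partial>P)"
      using A G0 sp unfolding X by (intro nn_integral_cong) (simp add: emeasure_kern_prod ennreal_mult prod_nonneg)
    also have "\<dots> = (\<integral>\<^sup>+\<omega>. emeasure (kern_prod n (\<xi> n \<omega>)) X \<partial>m)"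
      unfolding m_def by (rule nn_integral_density[symmetric]) measurable
    also have "\<dots> = emeasure m2 X"
      unfolding m2_def by (rule emeasure_bind[symmetric, OF nem km Xs])
    finally show "emeasure m1 X = emeasure m2 X" .
  next
    show "sets m1 = sigma_sets (space (config (Suc n))) {Pi\<^sub>E {..<N} A | A. A \<in> {..<N} \<rightarrow> sets (E (Suc n))}"
      unfolding m1_def using config_generator by simp
    show "sets m2 = sigma_sets (space (config (Suc n))) {Pi\<^sub>E {..<N} A | A. A \<in> {..<N} \<rightarrow> sets (E (Suc n))}"
      unfolding m2_def using config_generator sets_bind[OF sets_kernel[OF km] nem] by simp
    show "range (\<lambda>_. space (config (Suc n))) \<subseteq> {Pi\<^sub>E {..<N} A | A. A \<in> {..<N} \<rightarrow> sets (E (Suc n))}"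
      by (auto simp: space_PiM intro!: exI[of _ "\<lambda>_. space (E (Suc n))"])
    show "(\<Union>i. space (config (Suc n))) = space (config (Suc n))" by simp
    \<comment> \<open>Finiteness of the total mass, required for uniqueness, comes from the
      boundedness of \<open>G\<close>.\<close>
    have "emeasure m1 (space (config (Suc n))) = emeasure m (space m)"
      unfolding m1_def by (subst emeasure_distr) (auto simp: spm measurable_space[OF \<xi>_measurable] intro!: arg_cong[where f = "emeasure m"])
    also have "\<dots> = (\<integral>\<^sup>+\<omega>. ennreal (G (\<xi> n \<omega>)) \<partial>P)"
      unfolding m_def by (subst emeasure_density) (auto intro!: nn_integral_cong)
    also have "\<dots> < \<infinity>"
      using G0 sp by (subst P.nn_integral_bfun[OF G\<xi>]) auto
    finally show "emeasure m1 (space (config (Suc n))) \<noteq> \<infinity>" by simp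
  qed
  have pm[measurable]: "(\<lambda>y. \<Prod>i<N. \<psi> (y i)) \<in> borel_measurable (config (Suc n))"
    by measurable
  have "(\<integral>\<^sup>+\<omega>. ennreal (G (\<xi> n \<omega>)) * (\<Prod>i<N. \<psi> (\<xi> (Suc n) \<omega> i)) \<partial>P) = (\<integral>\<^sup>+\<omega>. (\<Prod>i<N. \<psi> (\<xi> (Suc n) \<omega> i)) \<partial>m)"
    unfolding m_def by (rule nn_integral_density[symmetric]) measurable
  also have "\<dots> = (\<integral>\<^sup>+y. (\<Prod>i<N. \<psi> (y i)) \<partial>m1)"
    unfolding m1_def by (rule nn_integral_distr[symmetric]) measurable
  also have "\<dots> = (\<integral>\<^sup>+\<omega>. \<integral>\<^sup>+y. (\<Prod>i<N. \<psi> (y i)) \<partial>kern_prod n (\<xi> n \<omega>) \<partial>m)"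
    unfolding \<open>m1 = m2\<close> m2_def by (rule nn_integral_bind[OF pm km])
  also have "\<dots> = (\<integral>\<^sup>+\<omega>. ennreal (G (\<xi> n \<omega>)) * (\<integral>\<^sup>+y. (\<Prod>i<N. \<psi> (y i)) \<partial>kern_prod n (\<xi> n \<omega>)) \<partial>P)"
    unfolding m_def
    by (rule nn_integral_density) (auto intro!: measurable_compose[OF k nn_integral_measurable_subprob_algebra])
  also have "\<dots> = (\<integral>\<^sup>+\<omega>. ennreal (G (\<xi> n \<omega>)) * (\<Prod>i<N. \<integral>\<^sup>+y. \<psi> y \<partial>kern n (\<xi> n \<omega>) i) \<partial>P)"
    using sp by (intro nn_integral_cong) (simp add: nn_integral_kern_prod[OF _ \<psi>])
  finally show ?thesis .
qed

lemma initial: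
  assumes [measurable]: "\<psi> \<in> borel_measurable (E 0)"
  shows "(\<integral>\<^sup>+\<omega>. (\<Prod>i<N. \<psi> (\<xi> 0 \<omega> i)) \<partial>P) = (\<integral>\<^sup>+y. \<psi> y \<partial>\<eta> 0) ^ N"
proof -
  have "P.indep_vars (\<lambda>_. E 0) (\<lambda>i \<omega>. \<xi> 0 \<omega> i) {..<N}"
    using system unfolding particle_system_def by blast
  from P.indep_vars_compose2[OF this, of "\<lambda>_. \<psi>" "\<lambda>_. borel"]
  have "P.indep_vars (\<lambda>_. borel) (\<lambda>i \<omega>. \<psi> (\<xi> 0 \<omega> i)) {..<N}" by simp
  then have "(\<integral>\<^sup>+\<omega>. (\<Prod>i<N. \<psi> (\<xi> 0 \<omega> i)) \<partial>P) = (\<Prod>i<N. \<integral>\<^sup>+\<omega>. \<psi> (\<xi> 0 \<omega> i) \<partial>P)"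
    by (intro P.indep_vars_nn_integral) auto
  also have "\<dots> = (\<Prod>i<N. \<integral>\<^sup>+y. \<psi> y \<partial>\<eta> 0)"
  proof (intro prod.cong refl)
    fix i assume i: "i \<in> {..<N}"
    have "\<eta> 0 = distr P (E 0) (\<lambda>\<omega>. \<xi> 0 \<omega> i)"
      using system i unfolding particle_system_def by simp
    moreover have "(\<lambda>\<omega>. \<xi> 0 \<omega> i) \<in> P \<rightarrow>\<^sub>M E 0"
      using i by (intro measurable_compose[OF \<xi>_measurable measurable_component_singleton])
    ultimately show "(\<integral>\<^sup>+\<omega>. \<psi> (\<xi> 0 \<omega> i) \<partial>P) = (\<integral>\<^sup>+y. \<psi> y \<partial>\<eta> 0)"
      by (simp add: nn_integral_distr)
  qed
  finally show ?thesis by simp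
qed

end

section \<open>Local fluctuations\<close>

lemma osc_le_iff:
  assumes "0 \<le> c"
  shows "osc E f \<le> ennreal c \<longleftrightarrow> (\<forall>x\<in>space E. \<forall>y\<in>space E. \<bar>f x - f y\<bar> \<le> c)"
  unfolding osc_def using assms by (simp add: SUP_le_iff ennreal_le_iff)

lemma osc_le: "0 \<le> c \<Longrightarrow> (\<And>x y. x \<in> space E \<Longrightarrow> y \<in> space E \<Longrightarrow> \<bar>f x - f y\<bar> \<le> c) \<Longrightarrow> osc E f \<le> ennreal c"
  by (simp add: osc_le_iff)

lemma bfun_osc_finite:
  assumes "f \<in> bfun E"
  shows "osc E f < \<infinity>"
proof -
  obtain C where C: "0 \<le> C" "\<And>x. x \<in> space E \<Longrightarrow> \<bar>f x\<bar> \<le> C" using assms by (rule bfunE) blast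
  have "osc E f \<le> ennreal (2 * C)"
  proof (rule osc_le)
    fix x y assume "x \<in> space E" "y \<in> space E"
    from C(2)[OF this(1)] C(2)[OF this(2)] show "\<bar>f x - f y\<bar> \<le> 2 * C" by linarith
  qed (use C in simp)
  then show ?thesis by (simp add: le_less_trans)
qed

lemma bfun_osc:
  assumes "f \<in> bfun E"
  obtains a where "0 \<le> a" "osc E f = ennreal a" "\<And>x y. x \<in> space E \<Longrightarrow> y \<in> space E \<Longrightarrow> \<bar>f x - f y\<bar> \<le> a"
proof -
  from bfun_osc_finite[OF assms] obtain a where a: "0 \<le> a" "osc E f = ennreal a"
    by (cases "osc E f") auto
  with osc_le_iff[of a E f] that show thesis by auto
qed

text \<open>All values differ by at most 1 from the value at one fixed point; the empty space is
  treated apart.\<close>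

lemma Osc1_bfun: "Osc1 E \<subseteq> bfun E"
proof
  fix f assume f: "f \<in> Osc1 E"
  then have le: "\<bar>f x - f y\<bar> \<le> 1" if "x \<in> space E" "y \<in> space E" for x y
    using that osc_le_iff[of 1 E f] by (simp add: Osc1_def)
  show "f \<in> bfun E"
  proof (cases "space E = {}")
    case True
    then show ?thesis using f by (simp add: bfun_def Osc1_def)
  next
    case False
    then obtain x0 where x0: "x0 \<in> space E" by blast
    show ?thesis
    proof (rule bfunI)
      show "\<bar>f x\<bar> \<le> \<bar>f x0\<bar> + 1" if "x \<in> space E" for x using le[OF that x0] by linarith
    qed (use f in \<open>simp add: Osc1_def\<close>)
  qed
qed

lemma Osc1_diff_le: "f \<in> Osc1 E \<Longrightarrow> x \<in> space E \<Longrightarrow> y \<in> space E \<Longrightarrow> \<bar>f x - f y\<bar> \<le> 1"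
  using osc_le_iff[of 1 E f] by (simp add: Osc1_def)

lemma Osc1_scale:
  assumes f: "f \<in> bfun E" and a: "0 < a" and le: "\<And>x y. x \<in> space E \<Longrightarrow> y \<in> space E \<Longrightarrow> \<bar>f x - f y\<bar> \<le> a"
  shows "(\<lambda>x. f x / a) \<in> Osc1 E"
proof -
  have "osc E (\<lambda>x. f x / a) \<le> ennreal 1"
  proof (rule osc_le)
    fix x y assume xy: "x \<in> space E" "y \<in> space E"
    have "\<bar>f x / a - f y / a\<bar> = \<bar>f x - f y\<bar> / a" using a by (simp add: diff_divide_distrib[symmetric])
    also have "\<dots> \<le> 1" using le[OF xy] a by simp
    finally show "\<bar>f x / a - f y / a\<bar> \<le> 1" .
  qed simp
  then show ?thesis using bfun_measurable[OF bfun_divide[OF f]] by (simp add: Osc1_def)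
qed

lemma probs_deviation:
  assumes \<eta>: "\<eta> \<in> probs E" and f: "f \<in> bfun E" and x: "x \<in> space E"
    and le: "\<And>x y. x \<in> space E \<Longrightarrow> y \<in> space E \<Longrightarrow> \<bar>f x - f y\<bar> \<le> a"
  shows "\<bar>f x - (\<integral>y. f y \<partial>\<eta>)\<bar> \<le> a"
proof -
  interpret prob_space \<eta> using \<eta> by (rule probs_prob_space)
  have "f x - (\<integral>y. f y \<partial>\<eta>) = (\<integral>y. f x - f y \<partial>\<eta>)"
    using probs_integrable[OF \<eta> f] by (simp add: prob_space)
  also have "\<bar>\<dots>\<bar> \<le> a"
    using le x by (intro probs_abs_integral_le[OF \<eta>] bfun_diff bfun_const f) auto
  finally show ?thesis .
qed

text \<open>A function of oscillation at most 1 stays within distance 1 of its mean, so Hoeffding's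
  bound applies with c = 1.\<close>

lemma Osc1_hoeffding:
  assumes \<mu>: "\<mu> \<in> probs M" and f: "f \<in> Osc1 M"
  shows "(\<integral>\<^sup>+y. ennreal (exp (s * (f y - (\<integral>z. f z \<partial>\<mu>)))) \<partial>\<mu>) \<le> ennreal (exp (s\<^sup>2 / 2))"
proof -
  interpret prob_space \<mu> using \<mu> by (rule probs_prob_space)
  have fb: "f \<in> bfun M" using f Osc1_bfun by blast
  have "f \<in> borel_measurable \<mu>" using bfun_measurable[of f \<mu>] fb probs_bfun[OF \<mu>] by simp
  moreover have "\<bar>f x - expectation f\<bar> \<le> 1" if "x \<in> space \<mu>" for x
    using that by (intro probs_deviation[OF \<mu> fb] Osc1_diff_le[OF f]) (auto simp: probs_space[OF \<mu>])
  ultimately show ?thesis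
    using hoeffding_mgf[of f 1 s] by simp
qed

lemma diff_int_le:
  assumes \<mu>: "\<mu> \<in> probs E" and \<eta>: "\<eta> \<in> probs E" and f: "f \<in> bfun E"
    and le: "\<And>x y. x \<in> space E \<Longrightarrow> y \<in> space E \<Longrightarrow> \<bar>f x - f y\<bar> \<le> a"
  shows "\<bar>diff_int \<mu> \<eta> f\<bar> \<le> a"
proof -
  interpret prob_space \<mu> using \<mu> by (rule probs_prob_space)
  have "diff_int \<mu> \<eta> f = (\<integral>x. f x - (\<integral>y. f y \<partial>\<eta>) \<partial>\<mu>)"
    using probs_integrable[OF \<mu> f] by (simp add: diff_int_def prob_space)
  also have "\<bar>\<dots>\<bar> \<le> a"
    using probs_deviation[OF \<eta> f _ le] by (intro probs_abs_integral_le[OF \<mu>] bfun_diff bfun_const f)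
  finally show ?thesis .
qed

lemma diff_int_divide: "diff_int \<mu> \<eta> (\<lambda>x. f x / a) = diff_int \<mu> \<eta> f / a"
  by (simp add: diff_int_def diff_divide_distrib)

context mean_field_flow
begin

text \<open>Enlarging the bound to at least 1 allows division by it when images under
  \<open>D\<close> are scaled into \<open>Osc1\<close>.\<close>

lemma D_beta: "\<exists>b\<ge>1. \<forall>\<mu>\<in>probs (E n). \<forall>f\<in>Osc1 (E (Suc n)). osc (E n) (D (Suc n) \<mu> f) \<le> ennreal b"
proof -
  have "(SUP \<eta>\<in>probs (E n). beta (E n) (E (Suc n)) (D (Suc n) \<eta>)) < \<infinity>"
    using H1_Phi[of n] unfolding upsilon_def by blast
  then obtain b where b: "(SUP \<eta>\<in>probs (E n). beta (E n) (E (Suc n)) (D (Suc n) \<eta>)) = ennreal b" "0 \<le> b"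
    by (cases "SUP \<eta>\<in>probs (E n). beta (E n) (E (Suc n)) (D (Suc n) \<eta>)") auto
  have "osc (E n) (D (Suc n) \<mu> f) \<le> ennreal (max 1 b)" if "\<mu> \<in> probs (E n)" "f \<in> Osc1 (E (Suc n))" for \<mu> f
  proof -
    have "osc (E n) (D (Suc n) \<mu> f) \<le> beta (E n) (E (Suc n)) (D (Suc n) \<mu>)"
      unfolding beta_def using that(2) by (rule SUP_upper)
    also have "\<dots> \<le> ennreal b" unfolding b(1)[symmetric] using that(1) by (rule SUP_upper)
    also have "\<dots> \<le> ennreal (max 1 b)" by (intro ennreal_leI) simp
    finally show ?thesis .
  qed
  then show ?thesis by (intro exI[of _ "max 1 b"]) auto
qed

text \<open>The expansion is made at the deterministic base point \<open>\<eta> n\<close>, never at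
  the random empirical measure, so the first order operator is not random.\<close>

lemma Phi_diff:
  "diff_int (Phi K (Suc n) \<mu>) (\<eta> (Suc n)) f
    = diff_int \<mu> (\<eta> n) (D (Suc n) (\<eta> n) f) + remainder (Phi K (Suc n)) (D (Suc n)) \<mu> (\<eta> n) f"
  by (simp add: remainder_def)

end

context mean_field_particles
begin

text \<open>A function of the configuration instead of \<omega>: composed with
  \<open>\<xi> n\<close> it is \<open>WN\<close>, and in this form it can enter the weights of
  \<open>transition\<close>.\<close>

definition Wc :: "nat \<Rightarrow> ('a \<Rightarrow> real) \<Rightarrow> (nat \<Rightarrow> 'a) \<Rightarrow> real" where
  "Wc n f x = sqrt N * diff_int (emp n x) (\<eta> n) f"

text \<open>By \<open>Phi_emp_integral\<close> this is the conditional mean of the fluctuation of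
  \<open>f\<close> at time n + 1, given the configuration \<open>x\<close> at time
  \<open>n\<close>.\<close>

definition drift :: "nat \<Rightarrow> ('a \<Rightarrow> real) \<Rightarrow> (nat \<Rightarrow> 'a) \<Rightarrow> real" where
  "drift n f x = sqrt N * diff_int (Phi K (Suc n) (emp n x)) (\<eta> (Suc n)) f"

lemma WN_Wc: "WN E K \<eta>0 N \<xi> n f \<omega> = Wc n f (\<xi> n \<omega>)"
  by (simp add: WN_def Wc_def)

lemma N_pos: "0 < real N" "0 < sqrt (real N)"
  using N by auto

lemma Wc_eq: "x \<in> space (config n) \<Longrightarrow> f \<in> bfun (E n) \<Longrightarrow>
    Wc n f x = sqrt N * ((\<Sum>i<N. f (x i)) / N - (\<integral>y. f y \<partial>\<eta> n))"
  by (simp add: Wc_def diff_int_def emp_integral bfun_measurable del: flow.simps)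

lemma config_component_bfun: "i < N \<Longrightarrow> f \<in> bfun (E n) \<Longrightarrow> (\<lambda>x. f (x i)) \<in> bfun (config n)"
  by (rule bfun_comp[OF _ measurable_component_singleton]) auto

lemma Wc_bfun:
  assumes f: "f \<in> bfun (E n)"
  shows "Wc n f \<in> bfun (config n)"
proof (rule bfun_cong)
  show "(\<lambda>x. sqrt N * ((\<Sum>i<N. f (x i)) / N - (\<integral>y. f y \<partial>\<eta> n))) \<in> bfun (config n)"
    using f by (intro bfun_cmult bfun_diff bfun_divide bfun_sum bfun_const config_component_bfun) auto
qed (simp add: Wc_eq f)

lemma drift_bfun:
  assumes f: "f \<in> bfun (E (Suc n))"
  shows "drift n f \<in> bfun (config n)"
proof (rule bfun_cong)
  show "(\<lambda>x. sqrt N * ((\<Sum>i<N. \<integral>y. f y \<partial>kern n x i) / N - (\<integral>y. f y \<partial>\<eta> (Suc n)))) \<in> bfun (config n)"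
    using f by (intro bfun_cmult bfun_diff bfun_divide bfun_sum bfun_const kern_bfun) auto
qed (simp add: drift_def diff_int_def Phi_emp_integral f del: flow.simps)

lemma drift_eq:
  "drift n f x = Wc n (D (Suc n) (\<eta> n) f) x + sqrt N * remainder (Phi K (Suc n)) (D (Suc n)) (emp n x) (\<eta> n) f"
  unfolding drift_def Phi_diff Wc_def by (simp add: distrib_left)

lemma \<xi>_space: "\<omega> \<in> space P \<Longrightarrow> \<xi> n \<omega> \<in> space (config n)"
  using measurable_space[OF \<xi>_measurable] .

lemma Wc_Osc1_le:
  assumes "x \<in> space (config n)" "f \<in> Osc1 (E n)"
  shows "\<bar>Wc n f x\<bar> \<le> sqrt N"
proof -
  have "\<bar>diff_int (emp n x) (\<eta> n) f\<bar> \<le> 1"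
    using assms Osc1_bfun by (intro diff_int_le[of _ "E n"] emp_probs flow_probs Osc1_diff_le) auto
  then show ?thesis using N_pos by (simp add: Wc_def abs_mult mult_left_le)
qed

text \<open>Conditional independence in exact form, with a factor depending on the current
  configuration carried along: \<open>a = 0\<close> leads to the local sub-Gaussian bound, and
  \<open>a\<close> equal to \<open>t\<close> times the drift leads to the one-step Laplace
  identity.\<close>

lemma Wc_mgf_Suc:
  assumes a: "a \<in> bfun (config n)" and f: "f \<in> bfun (E (Suc n))"
  shows "(\<integral>\<^sup>+\<omega>. ennreal (exp (a (\<xi> n \<omega>) + s * (Wc (Suc n) f (\<xi> (Suc n) \<omega>) - drift n f (\<xi> n \<omega>)))) \<partial>P)
    = (\<integral>\<^sup>+\<omega>. ennreal (exp (a (\<xi> n \<omega>))) *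
        (\<Prod>i<N. \<integral>\<^sup>+y. ennreal (exp (s / sqrt N * (f y - (\<integral>z. f z \<partial>kern n (\<xi> n \<omega>) i)))) \<partial>kern n (\<xi> n \<omega>) i) \<partial>P)"
proof -
  let ?\<theta> = "s / sqrt N"
  let ?k = "\<lambda>x i. \<integral>z. f z \<partial>kern n x i"
  \<comment> \<open>Besides \<open>a\<close> it holds the centring terms, which depend on the
    current configuration only; what remains is one factor \<psi> for each new particle.\<close>
  define G where "G = (\<lambda>x. exp (a x - (\<Sum>i<N. ?\<theta> * ?k x i)))"
  define \<psi> where "\<psi> = (\<lambda>y. ennreal (exp (?\<theta> * f y)))"
  have G: "G \<in> bfun (config n)" unfolding G_def
    using f by (intro bfun_exp bfun_diff bfun_sum bfun_cmult kern_bfun a) auto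
  have \<psi>: "\<psi> \<in> borel_measurable (E (Suc n))"
    unfolding \<psi>_def using bfun_measurable[OF f] by measurable
  have lhs: "exp (a (\<xi> n \<omega>) + s * (Wc (Suc n) f (\<xi> (Suc n) \<omega>) - drift n f (\<xi> n \<omega>)))
    = G (\<xi> n \<omega>) * (\<Prod>i<N. exp (?\<theta> * f (\<xi> (Suc n) \<omega> i)))" if \<omega>: "\<omega> \<in> space P" for \<omega>
  proof -
    have "Wc (Suc n) f (\<xi> (Suc n) \<omega>) - drift n f (\<xi> n \<omega>)
      = sqrt N * ((\<Sum>i<N. f (\<xi> (Suc n) \<omega> i)) / N - (\<Sum>i<N. ?k (\<xi> n \<omega>) i) / N)"
      unfolding drift_def diff_int_def
      by (simp add: Wc_eq \<xi>_space[OF \<omega>] f Phi_emp_integral right_diff_distrib del: flow.simps)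
    also have "s * \<dots> = ?\<theta> * (\<Sum>i<N. f (\<xi> (Suc n) \<omega> i)) - ?\<theta> * (\<Sum>i<N. ?k (\<xi> n \<omega>) i)"
    proof -
      have "sqrt N / N = 1 / sqrt N" using N_pos by (simp add: real_div_sqrt field_simps)
      moreover have "s * (sqrt N * (u / N - v / N)) = s * (sqrt N / N) * (u - v)" for u v :: real
        using N_pos by (simp add: field_simps)
      ultimately have "s * (sqrt N * (u / N - v / N)) = ?\<theta> * u - ?\<theta> * v" for u v :: real
        by (simp add: right_diff_distrib)
      then show ?thesis .
    qed
    finally show ?thesis unfolding G_def
      by (simp add: exp_add exp_diff exp_sum[symmetric] sum_distrib_left)
  qed
  have "(\<integral>\<^sup>+\<omega>. ennreal (exp (a (\<xi> n \<omega>) + s * (Wc (Suc n) f (\<xi> (Suc n) \<omega>) - drift n f (\<xi> n \<omega>)))) \<partial>P)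
    = (\<integral>\<^sup>+\<omega>. ennreal (G (\<xi> n \<omega>)) * (\<Prod>i<N. \<psi> (\<xi> (Suc n) \<omega> i)) \<partial>P)"
    by (intro nn_integral_cong) (simp add: lhs \<psi>_def G_def ennreal_mult prod_ennreal prod_nonneg)
  also have "\<dots> = (\<integral>\<^sup>+\<omega>. ennreal (G (\<xi> n \<omega>)) * (\<Prod>i<N. \<integral>\<^sup>+y. \<psi> y \<partial>kern n (\<xi> n \<omega>) i) \<partial>P)"
    by (rule transition[OF G _ \<psi>]) (simp add: G_def)
  also have "\<dots> = (\<integral>\<^sup>+\<omega>. ennreal (exp (a (\<xi> n \<omega>))) *
        (\<Prod>i<N. \<integral>\<^sup>+y. ennreal (exp (?\<theta> * (f y - ?k (\<xi> n \<omega>) i))) \<partial>kern n (\<xi> n \<omega>) i) \<partial>P)"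
  proof (intro nn_integral_cong)
    fix \<omega> assume \<omega>: "\<omega> \<in> space P"
    have "(\<integral>\<^sup>+y. ennreal (exp (?\<theta> * (f y - ?k (\<xi> n \<omega>) i))) \<partial>kern n (\<xi> n \<omega>) i)
      = ennreal (exp (- (?\<theta> * ?k (\<xi> n \<omega>) i))) * (\<integral>\<^sup>+y. \<psi> y \<partial>kern n (\<xi> n \<omega>) i)" if "i < N" for i
    proof -
      have "\<psi> \<in> borel_measurable (kern n (\<xi> n \<omega>) i)"
        using \<psi> by (simp add: measurable_cong_sets[OF probs_sets[OF kern_probs[OF \<xi>_space[OF \<omega>] that]] refl])
      from nn_integral_cmult[OF this, symmetric] show ?thesis
        by (simp add: \<psi>_def ennreal_mult[symmetric] exp_add[symmetric] right_diff_distrib)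
    qed
    then have "(\<Prod>i<N. \<integral>\<^sup>+y. ennreal (exp (?\<theta> * (f y - ?k (\<xi> n \<omega>) i))) \<partial>kern n (\<xi> n \<omega>) i)
      = ennreal (\<Prod>i<N. exp (- (?\<theta> * ?k (\<xi> n \<omega>) i))) * (\<Prod>i<N. \<integral>\<^sup>+y. \<psi> y \<partial>kern n (\<xi> n \<omega>) i)"
      by (simp add: prod.distrib prod_ennreal)
    moreover have "exp (a (\<xi> n \<omega>)) * (\<Prod>i<N. exp (- (?\<theta> * ?k (\<xi> n \<omega>) i))) = G (\<xi> n \<omega>)"
      unfolding G_def exp_sum[OF finite_lessThan, symmetric] by (simp add: exp_add[symmetric] sum_negf)
    ultimately show "ennreal (G (\<xi> n \<omega>)) * (\<Prod>i<N. \<integral>\<^sup>+y. \<psi> y \<partial>kern n (\<xi> n \<omega>) i) =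
        ennreal (exp (a (\<xi> n \<omega>))) *
        (\<Prod>i<N. \<integral>\<^sup>+y. ennreal (exp (?\<theta> * (f y - ?k (\<xi> n \<omega>) i))) \<partial>kern n (\<xi> n \<omega>) i)"
      by (simp add: mult.assoc[symmetric] ennreal_mult[symmetric] prod_nonneg)
  qed
  finally show ?thesis .
qed

lemma Wc_mgf_0:
  assumes f: "f \<in> bfun (E 0)"
  shows "(\<integral>\<^sup>+\<omega>. ennreal (exp (s * Wc 0 f (\<xi> 0 \<omega>))) \<partial>P)
    = (\<integral>\<^sup>+y. ennreal (exp (s / sqrt N * (f y - (\<integral>z. f z \<partial>\<eta> 0)))) \<partial>\<eta> 0) ^ N"
proof -
  let ?\<theta> = "s / sqrt N"
  define \<psi> where "\<psi> = (\<lambda>y. ennreal (exp (?\<theta> * (f y - (\<integral>z. f z \<partial>\<eta> 0)))))"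
  have \<psi>: "\<psi> \<in> borel_measurable (E 0)"
    unfolding \<psi>_def using bfun_measurable[OF f] by measurable
  have "exp (s * Wc 0 f (\<xi> 0 \<omega>)) = (\<Prod>i<N. exp (?\<theta> * (f (\<xi> 0 \<omega> i) - (\<integral>z. f z \<partial>\<eta> 0))))"
    if \<omega>: "\<omega> \<in> space P" for \<omega>
  proof -
    have "s * Wc 0 f (\<xi> 0 \<omega>) = (\<Sum>i<N. ?\<theta> * (f (\<xi> 0 \<omega> i) - (\<integral>z. f z \<partial>\<eta> 0)))"
    proof -
      have "sqrt N / N = 1 / sqrt N" using N_pos by (simp add: real_div_sqrt field_simps)
      moreover have "s * (sqrt N * (u / N - v)) = s * (sqrt N / N) * (u - N * v)" for u v :: real
        using N_pos by (simp add: field_simps)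
      ultimately have "s * (sqrt N * (u / N - v)) = ?\<theta> * (u - N * v)" for u v :: real
        by simp
      then show ?thesis
        unfolding Wc_eq[OF \<xi>_space[OF \<omega>] f] sum_distrib_left[symmetric] sum_subtractf by simp
    qed
    then show ?thesis by (simp add: exp_sum)
  qed
  then have "(\<integral>\<^sup>+\<omega>. ennreal (exp (s * Wc 0 f (\<xi> 0 \<omega>))) \<partial>P) = (\<integral>\<^sup>+\<omega>. (\<Prod>i<N. \<psi> (\<xi> 0 \<omega> i)) \<partial>P)"
    by (intro nn_integral_cong) (simp add: \<psi>_def prod_ennreal)
  also have "\<dots> = (\<integral>\<^sup>+y. \<psi> y \<partial>\<eta> 0) ^ N" by (rule initial[OF \<psi>])
  finally show ?thesis unfolding \<psi>_def .
qed

text \<open>Each of the \<open>N\<close> conditional factors is at most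
  \<open>exp ((s / sqrt N)\<^sup>2 / 2)\<close>, so the bound for the product is free of
  \<open>N\<close>.\<close>

lemma local_subgaussian_Suc:
  assumes f: "f \<in> Osc1 (E (Suc n))"
  shows "(\<integral>\<^sup>+\<omega>. ennreal (exp (s * (Wc (Suc n) f (\<xi> (Suc n) \<omega>) - drift n f (\<xi> n \<omega>)))) \<partial>P) \<le> ennreal (exp (s\<^sup>2 / 2))"
proof -
  have fb: "f \<in> bfun (E (Suc n))" using f Osc1_bfun by blast
  have "(\<integral>\<^sup>+\<omega>. ennreal (exp (s * (Wc (Suc n) f (\<xi> (Suc n) \<omega>) - drift n f (\<xi> n \<omega>)))) \<partial>P)
    = (\<integral>\<^sup>+\<omega>. (\<Prod>i<N. \<integral>\<^sup>+y. ennreal (exp (s / sqrt N * (f y - (\<integral>z. f z \<partial>kern n (\<xi> n \<omega>) i)))) \<partial>kern n (\<xi> n \<omega>) i) \<partial>P)"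
    using Wc_mgf_Suc[OF bfun_const[of 0] fb, of s] by simp
  also have "\<dots> \<le> (\<integral>\<^sup>+\<omega>. (\<Prod>i<N. ennreal (exp ((s / sqrt N)\<^sup>2 / 2))) \<partial>P)"
    using f by (intro nn_integral_mono prod_mono_ennreal Osc1_hoeffding[OF kern_probs] \<xi>_space) auto
  also have "\<dots> = ennreal (exp ((s / sqrt N)\<^sup>2 / 2) ^ N)"
    by (simp add: P.emeasure_space_1 ennreal_power)
  also have "exp ((s / sqrt N)\<^sup>2 / 2) ^ N = exp (s\<^sup>2 / 2)"
    using N_pos by (simp add: exp_of_nat_mult[symmetric] power_divide)
  finally show ?thesis .
qed

lemma local_subgaussian_0:
  assumes f: "f \<in> Osc1 (E 0)"
  shows "(\<integral>\<^sup>+\<omega>. ennreal (exp (s * Wc 0 f (\<xi> 0 \<omega>))) \<partial>P) \<le> ennreal (exp (s\<^sup>2 / 2))"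
proof -
  have fb: "f \<in> bfun (E 0)" using f Osc1_bfun by blast
  have "(\<integral>\<^sup>+\<omega>. ennreal (exp (s * Wc 0 f (\<xi> 0 \<omega>))) \<partial>P) \<le> ennreal (exp ((s / sqrt N)\<^sup>2 / 2)) ^ N"
    unfolding Wc_mgf_0[OF fb] by (intro power_mono Osc1_hoeffding[OF flow_probs f]) simp
  also have "\<dots> = ennreal (exp (s\<^sup>2 / 2))"
    using N_pos by (simp add: ennreal_power exp_of_nat_mult[symmetric] power_divide)
  finally show ?thesis .
qed

end

section \<open>Integrals over second order remainders\<close>

context mean_field_flow
begin

text \<open>Fixes the order of the quantifiers: \<open>m\<close> is chosen before \<open>f\<close>,
  while the measure \<open>R\<close> may depend on \<open>f\<close>. Only the base point
  \<open>\<eta> n\<close> is retained.\<close>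

lemma remainder_bound:
  "\<exists>m\<ge>0. \<forall>f\<in>bfun (E (Suc n)). \<forall>a\<ge>0. osc (E (Suc n)) f \<le> ennreal a \<longrightarrow>
     (\<exists>R. measure_on_tensors (E n) R \<and>
       (\<integral>\<^sup>+(g1, g2). osc (E n) g1 * osc (E n) g2 \<partial>R) \<le> ennreal (a * m) \<and>
       (\<forall>\<mu>\<in>probs (E n). ennreal \<bar>remainder (Phi K (Suc n)) (D (Suc n)) \<mu> (\<eta> n) f\<bar>
          \<le> (\<integral>\<^sup>+(g1, g2). ennreal \<bar>diff_int \<mu> (\<eta> n) g1 * diff_int \<mu> (\<eta> n) g2\<bar> \<partial>R)))"
proof -
  obtain R :: "'a measure \<Rightarrow> ('a \<Rightarrow> real) \<Rightarrow> (('a \<Rightarrow> real) \<times> ('a \<Rightarrow> real)) measure" and \<delta> :: ennreal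
    where \<delta>: "\<delta> < \<infinity>"
      and R: "\<forall>f\<in>bfun (E (Suc n)).
         (\<forall>\<eta>\<in>probs (E n). measure_on_tensors (E n) (R \<eta> f)) \<and>
         (\<forall>\<mu>\<in>probs (E n). \<forall>\<eta>\<in>probs (E n).
            ennreal \<bar>remainder (Phi K (Suc n)) (D (Suc n)) \<mu> \<eta> f\<bar>
              \<le> (\<integral>\<^sup>+(g1, g2). ennreal \<bar>diff_int \<mu> \<eta> g1 * diff_int \<mu> \<eta> g2\<bar> \<partial>R \<eta> f)) \<and>
         (SUP \<eta>\<in>probs (E n). \<integral>\<^sup>+(g1, g2). osc (E n) g1 * osc (E n) g2 \<partial>R \<eta> f) \<le> osc (E (Suc n)) f * \<delta>"
    using H1_Phi[of n] unfolding upsilon_def by blast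
  obtain m where m: "0 \<le> m" "\<delta> = ennreal m" using \<delta> by (cases \<delta>) auto
  show ?thesis
  proof (intro exI[of _ m] conjI m(1) ballI allI impI)
    fix f a assume f: "f \<in> bfun (E (Suc n))" and a: "0 \<le> a" "osc (E (Suc n)) f \<le> ennreal a"
    note Rf = R[rule_format, OF f]
    have "(\<integral>\<^sup>+(g1, g2). osc (E n) g1 * osc (E n) g2 \<partial>R (\<eta> n) f)
      \<le> (SUP \<eta>\<in>probs (E n). \<integral>\<^sup>+(g1, g2). osc (E n) g1 * osc (E n) g2 \<partial>R \<eta> f)"
      by (rule SUP_upper[OF flow_probs])
    also have "\<dots> \<le> osc (E (Suc n)) f * \<delta>" using Rf by blast
    also have "\<dots> \<le> ennreal a * \<delta>" by (rule mult_right_mono[OF a(2)]) simp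
    also have "\<dots> = ennreal (a * m)" using a m by (simp add: ennreal_mult)
    finally show "\<exists>R. measure_on_tensors (E n) R \<and>
       (\<integral>\<^sup>+(g1, g2). osc (E n) g1 * osc (E n) g2 \<partial>R) \<le> ennreal (a * m) \<and>
       (\<forall>\<mu>\<in>probs (E n). ennreal \<bar>remainder (Phi K (Suc n)) (D (Suc n)) \<mu> (\<eta> n) f\<bar>
          \<le> (\<integral>\<^sup>+(g1, g2). ennreal \<bar>diff_int \<mu> (\<eta> n) g1 * diff_int \<mu> (\<eta> n) g2\<bar> \<partial>R))"
      using Rf flow_probs[of n] by (intro exI[of _ "R (\<eta> n) f"]) blast
  qed
qed

text \<open>The counterpart of \<open>remainder_bound\<close> for condition (K), with a mass bound
  uniform over \<open>Osc1\<close>.\<close>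

lemma kernel_bound:
  "\<exists>m\<ge>0. \<forall>f\<in>Osc1 (E (Suc n)).
     \<exists>T. measure_on_bfun (E n) T \<and> (\<integral>\<^sup>+h. osc (E n) h \<partial>T) \<le> ennreal m \<and>
       (\<forall>\<mu>\<in>probs (E n). sup_norm (E n) (\<lambda>x. diff_int (K (Suc n) \<mu> x) (K (Suc n) (\<eta> n) x) f)
          \<le> (\<integral>\<^sup>+h. ennreal \<bar>diff_int \<mu> (\<eta> n) h\<bar> \<partial>T))"
proof -
  obtain T :: "'a measure \<Rightarrow> ('a \<Rightarrow> real) \<Rightarrow> ('a \<Rightarrow> real) measure" and \<delta> :: ennreal
    where \<delta>: "\<delta> < \<infinity>"
      and T: "\<forall>f\<in>Osc1 (E (Suc n)).
         (\<forall>\<eta>\<in>probs (E n). measure_on_bfun (E n) (T \<eta> f)) \<and>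
         (\<forall>\<mu>\<in>probs (E n). \<forall>\<eta>\<in>probs (E n).
            sup_norm (E n) (\<lambda>x. diff_int (K (Suc n) \<mu> x) (K (Suc n) \<eta> x) f)
              \<le> (\<integral>\<^sup>+h. ennreal \<bar>diff_int \<mu> \<eta> h\<bar> \<partial>T \<eta> f)) \<and>
         (SUP \<eta>\<in>probs (E n). \<integral>\<^sup>+h. osc (E n) h \<partial>T \<eta> f) \<le> osc (E (Suc n)) f * \<delta>"
    using H1_K[of n] unfolding cond_K_def by blast
  obtain m where m: "0 \<le> m" "\<delta> = ennreal m" using \<delta> by (cases \<delta>) auto
  show ?thesis
  proof (intro exI[of _ m] conjI m(1) ballI)
    fix f assume f: "f \<in> Osc1 (E (Suc n))"
    note Tf = T[rule_format, OF f]
    have "(\<integral>\<^sup>+h. osc (E n) h \<partial>T (\<eta> n) f) \<le> (SUP \<eta>\<in>probs (E n). \<integral>\<^sup>+h. osc (E n) h \<partial>T \<eta> f)"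
      by (rule SUP_upper[OF flow_probs])
    also have "\<dots> \<le> osc (E (Suc n)) f * \<delta>" using Tf by blast
    also have "\<dots> \<le> 1 * \<delta>" using f by (intro mult_right_mono) (auto simp: Osc1_def)
    also have "\<dots> = ennreal m" using m by simp
    finally show "\<exists>T. measure_on_bfun (E n) T \<and> (\<integral>\<^sup>+h. osc (E n) h \<partial>T) \<le> ennreal m \<and>
       (\<forall>\<mu>\<in>probs (E n). sup_norm (E n) (\<lambda>x. diff_int (K (Suc n) \<mu> x) (K (Suc n) (\<eta> n) x) f)
          \<le> (\<integral>\<^sup>+h. ennreal \<bar>diff_int \<mu> (\<eta> n) h\<bar> \<partial>T))"
      using Tf flow_probs[of n] by (intro exI[of _ "T (\<eta> n) f"]) blast
  qed
qed

end

context mean_field_particles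
begin

lemma flow_sigma_finite: "sigma_finite_measure (\<eta> n)"
proof -
  interpret prob_space "\<eta> n" using flow_probs by (rule probs_prob_space)
  show ?thesis ..
qed

lemma Wc_scale: "Wc n (\<lambda>x. g x / a) x = Wc n g x / a"
  by (simp add: Wc_def diff_int_divide)

lemma Wc_osc_le:
  assumes x: "x \<in> space (config n)" and g: "g \<in> bfun (E n)"
  shows "\<bar>Wc n g x\<bar> \<le> sqrt N * enn2real (osc (E n) g)"
proof -
  obtain a where a: "0 \<le> a" "osc (E n) g = ennreal a"
    "\<And>x y. x \<in> space (E n) \<Longrightarrow> y \<in> space (E n) \<Longrightarrow> \<bar>g x - g y\<bar> \<le> a"
    using g by (rule bfun_osc) blast
  have "\<bar>diff_int (emp n x) (\<eta> n) g\<bar> \<le> a"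
    using a(3) by (intro diff_int_le[of _ "E n"] emp_probs flow_probs x g)
  then have "sqrt N * \<bar>diff_int (emp n x) (\<eta> n) g\<bar> \<le> sqrt N * a" by (intro mult_left_mono) auto
  then show ?thesis using a by (simp add: Wc_def abs_mult)
qed

text \<open>Joint measurability is assumed for the product \<open>g1 x * g2 y\<close>, not for its
  factors. The product of the two fluctuations is therefore expanded into four terms in which the
  functions occur only through this product, evaluated at pairs of particles or integrated by
  \<open>\<eta> n\<close>.\<close>

lemma tensor_measurable:
  assumes R: "measure_on_tensors (E n) R"
  shows "(\<lambda>(\<omega>, g). Wc n (fst g) (\<xi> n \<omega>) * Wc n (snd g) (\<xi> n \<omega>)) \<in> borel_measurable (P \<Otimes>\<^sub>M R)"
proof -
  interpret sf: sigma_finite_measure "\<eta> n" by (rule flow_sigma_finite)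
  have [measurable_cong]: "sets (\<eta> n) = sets (E n)" by (rule probs_sets[OF flow_probs])
  define F where "F = (\<lambda>z :: ('a \<times> 'a) \<times> (('a \<Rightarrow> real) \<times> ('a \<Rightarrow> real)). fst (snd z) (fst (fst z)) * snd (snd z) (snd (fst z)))"
  have F[measurable]: "F \<in> borel_measurable ((E n \<Otimes>\<^sub>M E n) \<Otimes>\<^sub>M R)"
    using R unfolding measure_on_tensors_def F_def by (simp add: case_prod_unfold)
  have x[measurable]: "(\<lambda>\<omega>. \<xi> n \<omega> i) \<in> P \<rightarrow>\<^sub>M E n" if "i < N" for i
    using that by (intro measurable_compose[OF \<xi>_measurable measurable_component_singleton]) auto
  let ?M = "P \<Otimes>\<^sub>M R"
  have m1: "(\<lambda>z. F ((\<xi> n (fst z) i, \<xi> n (fst z) j), snd z)) \<in> borel_measurable ?M" if [measurable]: "i < N" "j < N" for i j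
  proof -
    note [measurable] = x[OF that(1)] x[OF that(2)]
    show ?thesis by measurable
  qed
  have m2: "(\<lambda>z. \<integral>v. F ((\<xi> n (fst z) i, v), snd z) \<partial>\<eta> n) \<in> borel_measurable ?M" if "i < N" for i
  proof -
    note [measurable] = x[OF that]
    show ?thesis by (rule sf.borel_measurable_lebesgue_integral) measurable
  qed
  have m3: "(\<lambda>z. \<integral>u. F ((u, \<xi> n (fst z) i), snd z) \<partial>\<eta> n) \<in> borel_measurable ?M" if "i < N" for i
  proof -
    note [measurable] = x[OF that]
    show ?thesis by (rule sf.borel_measurable_lebesgue_integral) measurable
  qed
  have m4: "(\<lambda>z. \<integral>u. \<integral>v. F ((u, v), snd z) \<partial>\<eta> n \<partial>\<eta> n) \<in> borel_measurable ?M"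
    by (intro sf.borel_measurable_lebesgue_integral) measurable
  have "(\<lambda>z. N * ((\<Sum>i<N. \<Sum>j<N. F ((\<xi> n (fst z) i, \<xi> n (fst z) j), snd z)) / N\<^sup>2
      - (\<Sum>i<N. \<integral>v. F ((\<xi> n (fst z) i, v), snd z) \<partial>\<eta> n) / N
      - (\<Sum>i<N. \<integral>u. F ((u, \<xi> n (fst z) i), snd z) \<partial>\<eta> n) / N
      + (\<integral>u. \<integral>v. F ((u, v), snd z) \<partial>\<eta> n \<partial>\<eta> n))) \<in> borel_measurable ?M"
    using m1 m2 m3 m4
    by (intro borel_measurable_times borel_measurable_const borel_measurable_add borel_measurable_diff
        borel_measurable_divide borel_measurable_sum) auto
  then show ?thesis
  proof (rule measurable_cong[THEN iffD1, rotated])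
    fix z assume "z \<in> space ?M"
    then obtain \<omega> g1 g2 where z: "z = (\<omega>, (g1, g2))" and \<omega>: "\<omega> \<in> space P" and g: "(g1, g2) \<in> space R"
      by (auto simp: space_pair_measure)
    have g12: "g1 \<in> bfun (E n)" "g2 \<in> bfun (E n)"
      using R g Osc1_bfun[of "E n"] unfolding measure_on_tensors_def by auto
    \<comment> \<open>Factors the four terms again: \<open>a\<close> and \<open>b\<close> stand for
      the particle sums of the two functions, \<open>p\<close> and \<open>q\<close> for their
      means.\<close>
    have al: "N * (a * b / (real N)\<^sup>2 - a * q / N - p * b / N + p * q)
      = (sqrt N * (a / N - p)) * (sqrt N * (b / N - q))" for a b p q :: real
    proof -
      have "(sqrt N * (a / N - p)) * (sqrt N * (b / N - q)) = (sqrt N * sqrt N) * ((a / N - p) * (b / N - q))"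
        by (simp only: ac_simps)
      also have "\<dots> = N * (a * b / (real N)\<^sup>2 - a * q / N - p * b / N + p * q)"
        by (simp add: algebra_simps power2_eq_square)
      finally show ?thesis by simp
    qed
    show "N * ((\<Sum>i<N. \<Sum>j<N. F ((\<xi> n (fst z) i, \<xi> n (fst z) j), snd z)) / N\<^sup>2
      - (\<Sum>i<N. \<integral>v. F ((\<xi> n (fst z) i, v), snd z) \<partial>\<eta> n) / N
      - (\<Sum>i<N. \<integral>u. F ((u, \<xi> n (fst z) i), snd z) \<partial>\<eta> n) / N
      + (\<integral>u. \<integral>v. F ((u, v), snd z) \<partial>\<eta> n \<partial>\<eta> n))
      = (case z of (\<omega>, g) \<Rightarrow> Wc n (fst g) (\<xi> n \<omega>) * Wc n (snd g) (\<xi> n \<omega>))"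
      unfolding z F_def
      by (simp add: Wc_eq[OF \<xi>_space[OF \<omega>]] g12 sum_product[symmetric] sum_distrib_left[symmetric]
          sum_distrib_right[symmetric] del: flow.simps) (rule al)
  qed
qed

text \<open>Each deviation equals \<open>Wc\<close> divided by \<open>sqrt N\<close>, so
  \<open>N\<close> times the remainder is bounded by a mixture of products of two fluctuations.
  Weighting by the oscillations gives finite mass and reduces the moment condition to pairs in
  \<open>Osc1\<close>. That condition is left open because it is supplied once crudely and once
  sharply.\<close>

lemma remainder_moment:
  assumes R: "measure_on_tensors (E n) R"
    and Rm: "(\<integral>\<^sup>+(g1, g2). osc (E n) g1 * osc (E n) g2 \<partial>R) \<le> ennreal m" and m: "0 \<le> m"
    and rem: "\<And>\<mu>. \<mu> \<in> probs (E n) \<Longrightarrow> ennreal \<bar>remainder (Phi K (Suc n)) (D (Suc n)) \<mu> (\<eta> n) f\<bar>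
          \<le> (\<integral>\<^sup>+(g1, g2). ennreal \<bar>diff_int \<mu> (\<eta> n) g1 * diff_int \<mu> (\<eta> n) g2\<bar> \<partial>R)"
    and s: "0 \<le> s" and C: "1 \<le> C"
    and mom: "\<And>g1 g2. g1 \<in> Osc1 (E n) \<Longrightarrow> g2 \<in> Osc1 (E n) \<Longrightarrow>
       (\<integral>\<^sup>+\<omega>. ennreal (exp (s * m * (\<bar>Wc n g1 (\<xi> n \<omega>)\<bar> * \<bar>Wc n g2 (\<xi> n \<omega>)\<bar>))) \<partial>P) \<le> ennreal C"
  shows "(\<integral>\<^sup>+\<omega>. ennreal (exp (s * \<bar>N * remainder (Phi K (Suc n)) (D (Suc n)) (emp n (\<xi> n \<omega>)) (\<eta> n) f\<bar>)) \<partial>P) \<le> ennreal C"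
proof (rule P.exp_moment_mixture[where R = R and m = m and B = N and
      w = "\<lambda>g. osc (E n) (fst g) * osc (E n) (snd g)" and
      Y = "\<lambda>\<omega> g. \<bar>Wc n (fst g) (\<xi> n \<omega>) * Wc n (snd g) (\<xi> n \<omega>)\<bar>"])
  have gR: "fst g \<in> Osc1 (E n)" "snd g \<in> Osc1 (E n)" if "g \<in> space R" for g
    using R that unfolding measure_on_tensors_def by auto
  have gb: "fst g \<in> bfun (E n)" "snd g \<in> bfun (E n)" if "g \<in> space R" for g
    using gR[OF that] Osc1_bfun by auto
  show "(\<lambda>g. osc (E n) (fst g) * osc (E n) (snd g)) \<in> borel_measurable R"
    using R unfolding measure_on_tensors_def by (simp add: case_prod_unfold)
  show "(\<integral>\<^sup>+g. osc (E n) (fst g) * osc (E n) (snd g) \<partial>R) \<le> ennreal m"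
    using Rm by (simp add: case_prod_unfold)
  show "(\<lambda>(\<omega>, g). \<bar>Wc n (fst g) (\<xi> n \<omega>) * Wc n (snd g) (\<xi> n \<omega>)\<bar>) \<in> borel_measurable (P \<Otimes>\<^sub>M R)"
    using borel_measurable_abs[OF tensor_measurable[OF R]] by (simp add: case_prod_unfold)
  show "\<bar>Wc n (fst g) (\<xi> n \<omega>) * Wc n (snd g) (\<xi> n \<omega>)\<bar>
      \<le> N * enn2real (osc (E n) (fst g) * osc (E n) (snd g))" if "\<omega> \<in> space P" "g \<in> space R" for \<omega> g
  proof -
    have "\<bar>Wc n (fst g) (\<xi> n \<omega>)\<bar> * \<bar>Wc n (snd g) (\<xi> n \<omega>)\<bar>
      \<le> (sqrt N * enn2real (osc (E n) (fst g))) * (sqrt N * enn2real (osc (E n) (snd g)))"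
      using that by (intro mult_mono Wc_osc_le \<xi>_space gb) auto
    also have "\<dots> = (sqrt N * sqrt N) * enn2real (osc (E n) (fst g) * osc (E n) (snd g))"
      by (simp only: enn2real_mult ac_simps)
    finally show ?thesis by (simp add: abs_mult)
  qed
  show "osc (E n) (fst g) * osc (E n) (snd g) < \<infinity>" if "g \<in> space R" for g
    using bfun_osc_finite[OF gb(1)[OF that]] bfun_osc_finite[OF gb(2)[OF that]] by (simp add: ennreal_mult_less_top)
  show "(\<integral>\<^sup>+\<omega>. ennreal (exp (s * m * (\<bar>Wc n (fst g) (\<xi> n \<omega>) * Wc n (snd g) (\<xi> n \<omega>)\<bar>
      / enn2real (osc (E n) (fst g) * osc (E n) (snd g))))) \<partial>P) \<le> ennreal C"
    if g: "g \<in> space R" and w: "osc (E n) (fst g) * osc (E n) (snd g) \<noteq> 0" for g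
  proof -
    \<comment> \<open>The pair lies in \<open>Osc1\<close>, but the weight is the product of its
      true oscillations; division by them keeps the pair in \<open>Osc1\<close>.\<close>
    obtain a where a: "0 \<le> a" "osc (E n) (fst g) = ennreal a"
      "\<And>x y. x \<in> space (E n) \<Longrightarrow> y \<in> space (E n) \<Longrightarrow> \<bar>fst g x - fst g y\<bar> \<le> a"
      using gb(1)[OF g] by (rule bfun_osc) blast
    obtain b where b: "0 \<le> b" "osc (E n) (snd g) = ennreal b"
      "\<And>x y. x \<in> space (E n) \<Longrightarrow> y \<in> space (E n) \<Longrightarrow> \<bar>snd g x - snd g y\<bar> \<le> b"
      using gb(2)[OF g] by (rule bfun_osc) blast
    have ab: "0 < a" "0 < b" using w a b by (auto simp: less_le)
    have "\<bar>Wc n (fst g) x * Wc n (snd g) x\<bar> / enn2real (osc (E n) (fst g) * osc (E n) (snd g))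
      = \<bar>Wc n (\<lambda>x. fst g x / a) x\<bar> * \<bar>Wc n (\<lambda>x. snd g x / b) x\<bar>" for x
      using a b ab by (simp add: Wc_scale abs_mult enn2real_mult)
    then show ?thesis
      using mom[OF Osc1_scale[OF gb(1)[OF g] ab(1) a(3)] Osc1_scale[OF gb(2)[OF g] ab(2) b(3)]] by simp
  qed
  show "ennreal \<bar>N * remainder (Phi K (Suc n)) (D (Suc n)) (emp n (\<xi> n \<omega>)) (\<eta> n) f\<bar>
      \<le> (\<integral>\<^sup>+g. ennreal \<bar>Wc n (fst g) (\<xi> n \<omega>) * Wc n (snd g) (\<xi> n \<omega>)\<bar> \<partial>R)" if \<omega>: "\<omega> \<in> space P" for \<omega>
  proof -
    let ?d = "\<lambda>g. diff_int (emp n (\<xi> n \<omega>)) (\<eta> n) g"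
    have "(\<lambda>g. Wc n (fst g) (\<xi> n \<omega>) * Wc n (snd g) (\<xi> n \<omega>)) \<in> borel_measurable R"
      using measurable_Pair2[OF tensor_measurable[OF R] \<omega>] by simp
    then have "(\<lambda>g. ennreal (\<bar>Wc n (fst g) (\<xi> n \<omega>) * Wc n (snd g) (\<xi> n \<omega>)\<bar> / N)) \<in> borel_measurable R" by measurable
    moreover have W: "Wc n (fst g) (\<xi> n \<omega>) * Wc n (snd g) (\<xi> n \<omega>) = N * (?d (fst g) * ?d (snd g))" for g
    proof -
      have "Wc n (fst g) (\<xi> n \<omega>) * Wc n (snd g) (\<xi> n \<omega>) = (sqrt N * sqrt N) * (?d (fst g) * ?d (snd g))"
        by (simp only: Wc_def ac_simps)
      then show ?thesis by simp
    qed
    ultimately have dm: "(\<lambda>g. ennreal \<bar>?d (fst g) * ?d (snd g)\<bar>) \<in> borel_measurable R"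
      using N_pos by (simp add: abs_mult)
    have "ennreal \<bar>N * remainder (Phi K (Suc n)) (D (Suc n)) (emp n (\<xi> n \<omega>)) (\<eta> n) f\<bar>
      = ennreal N * ennreal \<bar>remainder (Phi K (Suc n)) (D (Suc n)) (emp n (\<xi> n \<omega>)) (\<eta> n) f\<bar>"
      by (simp add: abs_mult ennreal_mult)
    also have "\<dots> \<le> ennreal N * (\<integral>\<^sup>+(g1, g2). ennreal \<bar>?d g1 * ?d g2\<bar> \<partial>R)"
      by (intro mult_left_mono rem emp_probs \<xi>_space \<omega>) simp
    also have "\<dots> = (\<integral>\<^sup>+g. ennreal N * ennreal \<bar>?d (fst g) * ?d (snd g)\<bar> \<partial>R)"
      using nn_integral_cmult[OF dm, symmetric] by (simp add: case_prod_unfold)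
    also have "\<dots> = (\<integral>\<^sup>+g. ennreal \<bar>Wc n (fst g) (\<xi> n \<omega>) * Wc n (snd g) (\<xi> n \<omega>)\<bar> \<partial>R)"
      unfolding W by (simp add: ennreal_mult[symmetric] abs_mult)
    finally show ?thesis .
  qed
qed (use s C m in auto)

text \<open>The linear counterpart of \<open>remainder_moment\<close>: one deviation instead of two,
  hence the factor \<open>sqrt N\<close> instead of \<open>N\<close>.\<close>

lemma kernel_moment:
  assumes T: "measure_on_bfun (E n) T"
    and Tm: "(\<integral>\<^sup>+h. osc (E n) h \<partial>T) \<le> ennreal m" and m: "0 \<le> m"
    and bd: "\<And>\<mu>. \<mu> \<in> probs (E n) \<Longrightarrow> sup_norm (E n) (\<lambda>x. diff_int (K (Suc n) \<mu> x) (K (Suc n) (\<eta> n) x) f)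
          \<le> (\<integral>\<^sup>+h. ennreal \<bar>diff_int \<mu> (\<eta> n) h\<bar> \<partial>T)"
    and s: "0 \<le> s" and C: "1 \<le> C"
    and mom: "\<And>h. h \<in> Osc1 (E n) \<Longrightarrow> (\<integral>\<^sup>+\<omega>. ennreal (exp (s * m * \<bar>Wc n h (\<xi> n \<omega>)\<bar>)) \<partial>P) \<le> ennreal C"
    and r: "\<And>\<omega>. \<omega> \<in> space P \<Longrightarrow> ennreal \<bar>r \<omega>\<bar> \<le> ennreal (sqrt N) *
       sup_norm (E n) (\<lambda>x. diff_int (K (Suc n) (emp n (\<xi> n \<omega>)) x) (K (Suc n) (\<eta> n) x) f)"
  shows "(\<integral>\<^sup>+\<omega>. ennreal (exp (s * \<bar>r \<omega>\<bar>)) \<partial>P) \<le> ennreal C"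
proof (rule P.exp_moment_mixture[where R = T and m = m and B = "sqrt N" and
      w = "osc (E n)" and Y = "\<lambda>\<omega> h. \<bar>Wc n h (\<xi> n \<omega>)\<bar>"])
  interpret sf: sigma_finite_measure "\<eta> n" by (rule flow_sigma_finite)
  have [measurable_cong]: "sets (\<eta> n) = sets (E n)" by (rule probs_sets[OF flow_probs])
  have hb: "h \<in> bfun (E n)" if "h \<in> space T" for h
    using T that unfolding measure_on_bfun_def by auto
  have F[measurable]: "(\<lambda>z. snd z (fst z)) \<in> borel_measurable (E n \<Otimes>\<^sub>M T)"
    using T unfolding measure_on_bfun_def by (simp add: case_prod_unfold)
  have Wm: "(\<lambda>z. Wc n (snd z) (\<xi> n (fst z))) \<in> borel_measurable (P \<Otimes>\<^sub>M T)"
  proof -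
    have m1: "(\<lambda>z. snd z (\<xi> n (fst z) i)) \<in> borel_measurable (P \<Otimes>\<^sub>M T)" if i: "i < N" for i
    proof -
      have [measurable]: "(\<lambda>\<omega>. \<xi> n \<omega> i) \<in> P \<rightarrow>\<^sub>M E n"
        using i by (intro measurable_compose[OF \<xi>_measurable measurable_component_singleton]) auto
      have "(\<lambda>z. (\<xi> n (fst z) i, snd z)) \<in> P \<Otimes>\<^sub>M T \<rightarrow>\<^sub>M E n \<Otimes>\<^sub>M T" by measurable
      from measurable_compose[OF this F] show ?thesis by simp
    qed
    have m2: "(\<lambda>z. \<integral>y. snd z y \<partial>\<eta> n) \<in> borel_measurable (P \<Otimes>\<^sub>M T)"
    proof (rule sf.borel_measurable_lebesgue_integral)
      have "(\<lambda>z. (snd z, snd (fst z))) \<in> (P \<Otimes>\<^sub>M T) \<Otimes>\<^sub>M \<eta> n \<rightarrow>\<^sub>M E n \<Otimes>\<^sub>M T" by measurable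
      from measurable_compose[OF this F]
      show "(\<lambda>(z, y). snd z y) \<in> borel_measurable ((P \<Otimes>\<^sub>M T) \<Otimes>\<^sub>M \<eta> n)" by (simp add: case_prod_unfold)
    qed
    have "(\<lambda>z. sqrt N * ((\<Sum>i<N. snd z (\<xi> n (fst z) i)) / N - (\<integral>y. snd z y \<partial>\<eta> n))) \<in> borel_measurable (P \<Otimes>\<^sub>M T)"
      using m1 m2 by (intro borel_measurable_times borel_measurable_const borel_measurable_diff
          borel_measurable_divide borel_measurable_sum) auto
    then show ?thesis
      by (rule measurable_cong[THEN iffD1, rotated])
        (auto simp: space_pair_measure Wc_eq[OF \<xi>_space] hb simp del: flow.simps)
  qed
  show "osc (E n) \<in> borel_measurable T" using T unfolding measure_on_bfun_def by blast
  show "(\<integral>\<^sup>+h. osc (E n) h \<partial>T) \<le> ennreal m" by (rule Tm)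
  show "(\<lambda>(\<omega>, h). \<bar>Wc n h (\<xi> n \<omega>)\<bar>) \<in> borel_measurable (P \<Otimes>\<^sub>M T)"
    using borel_measurable_abs[OF Wm] by (simp add: case_prod_unfold)
  show "\<bar>Wc n h (\<xi> n \<omega>)\<bar> \<le> sqrt N * enn2real (osc (E n) h)" if "\<omega> \<in> space P" "h \<in> space T" for \<omega> h
    using that by (intro Wc_osc_le \<xi>_space hb)
  show "osc (E n) h < \<infinity>" if "h \<in> space T" for h
    using bfun_osc_finite[OF hb[OF that]] .
  show "(\<integral>\<^sup>+\<omega>. ennreal (exp (s * m * (\<bar>Wc n h (\<xi> n \<omega>)\<bar> / enn2real (osc (E n) h)))) \<partial>P) \<le> ennreal C"
    if h: "h \<in> space T" and w: "osc (E n) h \<noteq> 0" for h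
  proof -
    obtain a where a: "0 \<le> a" "osc (E n) h = ennreal a"
      "\<And>x y. x \<in> space (E n) \<Longrightarrow> y \<in> space (E n) \<Longrightarrow> \<bar>h x - h y\<bar> \<le> a"
      using hb[OF h] by (rule bfun_osc) blast
    have a0: "0 < a" using w a by (auto simp: less_le)
    have "\<bar>Wc n h x\<bar> / enn2real (osc (E n) h) = \<bar>Wc n (\<lambda>x. h x / a) x\<bar>" for x
      using a a0 by (simp add: Wc_scale)
    then show ?thesis using mom[OF Osc1_scale[OF hb[OF h] a0 a(3)]] by simp
  qed
  show "ennreal \<bar>r \<omega>\<bar> \<le> (\<integral>\<^sup>+h. ennreal \<bar>Wc n h (\<xi> n \<omega>)\<bar> \<partial>T)" if \<omega>: "\<omega> \<in> space P" for \<omega>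
  proof -
    let ?d = "\<lambda>h. diff_int (emp n (\<xi> n \<omega>)) (\<eta> n) h"
    have "(\<lambda>h. Wc n h (\<xi> n \<omega>)) \<in> borel_measurable T"
      using measurable_Pair2[OF Wm \<omega>] by simp
    then have "(\<lambda>h. ennreal (\<bar>Wc n h (\<xi> n \<omega>)\<bar> / sqrt N)) \<in> borel_measurable T" by measurable
    then have dm: "(\<lambda>h. ennreal \<bar>?d h\<bar>) \<in> borel_measurable T"
      using N_pos by (simp add: Wc_def abs_mult)
    have "ennreal \<bar>r \<omega>\<bar> \<le> ennreal (sqrt N) * (\<integral>\<^sup>+h. ennreal \<bar>?d h\<bar> \<partial>T)"
      using r[OF \<omega>] bd[OF emp_probs[OF \<xi>_space[OF \<omega>]]] by (meson mult_left_mono order_trans zero_le)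
    also have "\<dots> = (\<integral>\<^sup>+h. ennreal (sqrt N) * ennreal \<bar>?d h\<bar> \<partial>T)"
      using nn_integral_cmult[OF dm, symmetric] .
    also have "\<dots> = (\<integral>\<^sup>+h. ennreal \<bar>Wc n h (\<xi> n \<omega>)\<bar> \<partial>T)"
      by (simp add: Wc_def ennreal_mult[symmetric] abs_mult)
    finally show ?thesis .
  qed
qed (use s C m in auto)

end

section \<open>Uniform sub-Gaussian bounds\<close>

context mean_field_particles
begin

lemma Wc_\<xi>_measurable: "g \<in> bfun (E n) \<Longrightarrow> (\<lambda>\<omega>. Wc n g (\<xi> n \<omega>)) \<in> borel_measurable P"
  by (intro measurable_compose[OF \<xi>_measurable bfun_measurable] Wc_bfun)

lemma subgaussian_0:
  assumes g: "g \<in> Osc1 (E 0)"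
  shows "(\<integral>\<^sup>+\<omega>. ennreal (exp (s * \<bar>Wc 0 g (\<xi> 0 \<omega>)\<bar>)) \<partial>P) \<le> ennreal (2 * exp (s\<^sup>2 / 2))"
  using g Osc1_bfun by (intro P.exp_moment_abs Wc_\<xi>_measurable local_subgaussian_0) auto

text \<open>The fluctuation at time \<open>n + 1\<close> is the local fluctuation plus the first order term, which is a
  fluctuation at time \<open>n\<close>, plus a second order term, in which one of the two factors is at most
  \<open>sqrt N\<close>.\<close>

lemma subgaussian_Suc:
  assumes c: "1 \<le> c" and IH: "\<And>g s. g \<in> Osc1 (E n) \<Longrightarrow> 0 \<le> s \<Longrightarrow>
        (\<integral>\<^sup>+\<omega>. ennreal (exp (s * \<bar>Wc n g (\<xi> n \<omega>)\<bar>)) \<partial>P) \<le> ennreal (c * exp (c * s\<^sup>2))"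
    and b: "1 \<le> b" and Db: "osc (E n) (D (Suc n) (\<eta> n) g) \<le> ennreal b"
    and R: "measure_on_tensors (E n) R" and m: "0 \<le> m"
    and Rm: "(\<integral>\<^sup>+(g1, g2). osc (E n) g1 * osc (E n) g2 \<partial>R) \<le> ennreal m"
    and rem: "\<And>\<mu>. \<mu> \<in> probs (E n) \<Longrightarrow> ennreal \<bar>remainder (Phi K (Suc n)) (D (Suc n)) \<mu> (\<eta> n) g\<bar>
          \<le> (\<integral>\<^sup>+(g1, g2). ennreal \<bar>diff_int \<mu> (\<eta> n) g1 * diff_int \<mu> (\<eta> n) g2\<bar> \<partial>R)"
    and g: "g \<in> Osc1 (E (Suc n))" and s: "0 \<le> s"
    and C: "C = 2 + 2 * c + 16 * c * (b\<^sup>2 + m\<^sup>2)"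
  shows "(\<integral>\<^sup>+\<omega>. ennreal (exp (s * \<bar>Wc (Suc n) g (\<xi> (Suc n) \<omega>)\<bar>)) \<partial>P) \<le> ennreal (C * exp (C * s\<^sup>2))"
proof -
  have gb: "g \<in> bfun (E (Suc n))" using g Osc1_bfun by blast
  let ?h = "D (Suc n) (\<eta> n) g"
  have hb: "?h \<in> bfun (E n)" by (rule D_bfun[OF flow_probs gb])
  define V where "V = (\<lambda>\<omega>. Wc (Suc n) g (\<xi> (Suc n) \<omega>) - drift n g (\<xi> n \<omega>))"
  define B where "B = (\<lambda>\<omega>. Wc n ?h (\<xi> n \<omega>))"
  define r where "r = (\<lambda>\<omega>. remainder (Phi K (Suc n)) (D (Suc n)) (emp n (\<xi> n \<omega>)) (\<eta> n) g)"
  have dm: "(\<lambda>\<omega>. drift n g (\<xi> n \<omega>)) \<in> borel_measurable P"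
    by (intro measurable_compose[OF \<xi>_measurable bfun_measurable] drift_bfun gb)
  have Vm[measurable]: "V \<in> borel_measurable P"
    unfolding V_def by (intro borel_measurable_diff dm Wc_\<xi>_measurable gb)
  have Bm[measurable]: "B \<in> borel_measurable P" unfolding B_def by (intro Wc_\<xi>_measurable hb)
  have deq: "drift n g (\<xi> n \<omega>) = B \<omega> + sqrt N * r \<omega>" for \<omega>
    unfolding drift_eq B_def r_def ..
  have rm[measurable]: "(\<lambda>\<omega>. sqrt N * r \<omega>) \<in> borel_measurable P"
  proof -
    have "(\<lambda>\<omega>. drift n g (\<xi> n \<omega>) - B \<omega>) \<in> borel_measurable P" using dm Bm by measurable
    then show ?thesis unfolding deq by simp
  qed
  have V: "(\<integral>\<^sup>+\<omega>. ennreal (exp (2 * s * \<bar>V \<omega>\<bar>)) \<partial>P) \<le> ennreal (2 * exp (2 * s\<^sup>2))"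
    using P.exp_moment_abs[OF Vm, of "2 * s"] local_subgaussian_Suc[OF g] unfolding V_def
    by (simp add: power_mult_distrib)
  have B: "(\<integral>\<^sup>+\<omega>. ennreal (exp (4 * s * \<bar>B \<omega>\<bar>)) \<partial>P) \<le> ennreal (c * exp (16 * c * b\<^sup>2 * s\<^sup>2))"
  proof -
    have b0: "0 < b" using b by simp
    have "(\<lambda>x. ?h x / b) \<in> Osc1 (E n)"
      using Db b0 osc_le_iff[of b "E n" ?h] by (intro Osc1_scale hb) auto
    from IH[OF this, of "4 * s * b"] show ?thesis
      using s b0 unfolding B_def by (simp add: Wc_scale power_mult_distrib mult_ac)
  qed
  have r: "(\<integral>\<^sup>+\<omega>. ennreal (exp (4 * s * \<bar>sqrt N * r \<omega>\<bar>)) \<partial>P) \<le> ennreal (c * exp (16 * c * m\<^sup>2 * s\<^sup>2))"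
  proof -
    have Nr: "4 * s * \<bar>sqrt N * r \<omega>\<bar> = 4 * s / sqrt N * \<bar>N * r \<omega>\<bar>" for \<omega>
    proof -
      have "N * \<bar>r \<omega>\<bar> = sqrt N * (sqrt N * \<bar>r \<omega>\<bar>)" by (simp add: mult.assoc[symmetric])
      then have "4 * s / sqrt N * \<bar>N * r \<omega>\<bar> = 4 * s / sqrt N * (sqrt N * (sqrt N * \<bar>r \<omega>\<bar>))"
        by (simp only: abs_mult abs_of_nat)
      then show ?thesis using N_pos by (simp add: abs_mult)
    qed
    have "1 \<le> exp (16 * c * m\<^sup>2 * s\<^sup>2)" using c by simp
    then have "1 * 1 \<le> c * exp (16 * c * m\<^sup>2 * s\<^sup>2)" using c by (intro mult_mono) auto
    then have C1: "1 \<le> c * exp (16 * c * m\<^sup>2 * s\<^sup>2)" by simp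
    show ?thesis unfolding Nr unfolding r_def
    proof (rule remainder_moment[OF R Rm m rem _ C1])
      fix g1 g2 assume g12: "g1 \<in> Osc1 (E n)" "g2 \<in> Osc1 (E n)"
      have "(\<integral>\<^sup>+\<omega>. ennreal (exp (4 * s / sqrt N * m * (\<bar>Wc n g1 (\<xi> n \<omega>)\<bar> * \<bar>Wc n g2 (\<xi> n \<omega>)\<bar>))) \<partial>P)
        \<le> (\<integral>\<^sup>+\<omega>. ennreal (exp (4 * s * m * \<bar>Wc n g1 (\<xi> n \<omega>)\<bar>)) \<partial>P)"
      proof (intro nn_integral_mono ennreal_leI iffD2[OF exp_le_cancel_iff])
        fix \<omega> assume \<omega>: "\<omega> \<in> space P"
        have "4 * s / sqrt N * m * (\<bar>Wc n g1 (\<xi> n \<omega>)\<bar> * \<bar>Wc n g2 (\<xi> n \<omega>)\<bar>)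
          \<le> 4 * s / sqrt N * m * (\<bar>Wc n g1 (\<xi> n \<omega>)\<bar> * sqrt N)"
          using s m by (intro mult_left_mono Wc_Osc1_le \<xi>_space \<omega> g12) auto
        then show "4 * s / sqrt N * m * (\<bar>Wc n g1 (\<xi> n \<omega>)\<bar> * \<bar>Wc n g2 (\<xi> n \<omega>)\<bar>)
          \<le> 4 * s * m * \<bar>Wc n g1 (\<xi> n \<omega>)\<bar>" using N_pos by simp
      qed
      also have "\<dots> \<le> ennreal (c * exp (c * (4 * s * m)\<^sup>2))" using s m by (intro IH g12) auto
      also have "\<dots> = ennreal (c * exp (16 * c * m\<^sup>2 * s\<^sup>2))" by (simp add: power_mult_distrib mult_ac)
      finally show "(\<integral>\<^sup>+\<omega>. ennreal (exp (4 * s / sqrt N * m * (\<bar>Wc n g1 (\<xi> n \<omega>)\<bar> * \<bar>Wc n g2 (\<xi> n \<omega>)\<bar>))) \<partial>P)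
        \<le> ennreal (c * exp (16 * c * m\<^sup>2 * s\<^sup>2))" .
    qed (use s in auto)
  qed
  have "exp (s * \<bar>Wc (Suc n) g (\<xi> (Suc n) \<omega>)\<bar>)
    \<le> exp (2 * s * \<bar>V \<omega>\<bar>) + (exp (4 * s * \<bar>B \<omega>\<bar>) + exp (4 * s * \<bar>sqrt N * r \<omega>\<bar>))" for \<omega>
  proof -
    have "Wc (Suc n) g (\<xi> (Suc n) \<omega>) = V \<omega> + (B \<omega> + sqrt N * r \<omega>)"
      unfolding V_def deq[symmetric] by simp
    then have "exp (s * \<bar>Wc (Suc n) g (\<xi> (Suc n) \<omega>)\<bar>) \<le> exp (2 * s * \<bar>V \<omega>\<bar>) + exp (2 * s * \<bar>B \<omega> + sqrt N * r \<omega>\<bar>)"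
      using exp_abs_add_le[OF s] by simp
    also have "exp (2 * s * \<bar>B \<omega> + sqrt N * r \<omega>\<bar>) \<le> exp (2 * (2 * s) * \<bar>B \<omega>\<bar>) + exp (2 * (2 * s) * \<bar>sqrt N * r \<omega>\<bar>)"
      using s by (intro exp_abs_add_le) simp
    finally show ?thesis by simp
  qed
  then have "(\<integral>\<^sup>+\<omega>. ennreal (exp (s * \<bar>Wc (Suc n) g (\<xi> (Suc n) \<omega>)\<bar>)) \<partial>P)
    \<le> (\<integral>\<^sup>+\<omega>. ennreal (exp (2 * s * \<bar>V \<omega>\<bar>)) + (ennreal (exp (4 * s * \<bar>B \<omega>\<bar>)) + ennreal (exp (4 * s * \<bar>sqrt N * r \<omega>\<bar>))) \<partial>P)"
    by (intro nn_integral_mono) (simp add: ennreal_plus[symmetric] del: ennreal_plus)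
  also have "\<dots> = (\<integral>\<^sup>+\<omega>. ennreal (exp (2 * s * \<bar>V \<omega>\<bar>)) \<partial>P) +
     ((\<integral>\<^sup>+\<omega>. ennreal (exp (4 * s * \<bar>B \<omega>\<bar>)) \<partial>P) + (\<integral>\<^sup>+\<omega>. ennreal (exp (4 * s * \<bar>sqrt N * r \<omega>\<bar>)) \<partial>P))"
  proof -
    have [measurable]: "(\<lambda>\<omega>. ennreal (exp (4 * s * \<bar>sqrt N * r \<omega>\<bar>))) \<in> borel_measurable P"
      by (intro measurable_compose[OF _ measurable_ennreal] borel_measurable_exp[THEN measurable_compose[rotated]]
          borel_measurable_times borel_measurable_const borel_measurable_abs rm)
    show ?thesis by (subst nn_integral_add, measurable, subst nn_integral_add, measurable)
  qed
  also have "\<dots> \<le> ennreal (2 * exp (2 * s\<^sup>2)) + (ennreal (c * exp (16 * c * b\<^sup>2 * s\<^sup>2)) + ennreal (c * exp (16 * c * m\<^sup>2 * s\<^sup>2)))"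
    by (intro add_mono V B r)
  also have "\<dots> = ennreal (2 * exp (2 * s\<^sup>2) + (c * exp (16 * c * b\<^sup>2 * s\<^sup>2) + c * exp (16 * c * m\<^sup>2 * s\<^sup>2)))"
    using c by (simp add: ennreal_plus[symmetric] del: ennreal_plus)
  also have "\<dots> \<le> ennreal (C * exp (C * s\<^sup>2))"
  proof (rule ennreal_leI)
    have "0 \<le> c * b\<^sup>2" "0 \<le> c * m\<^sup>2" using c by auto
    \<comment> \<open>The factor 16 is the square of the 4 in \<open>4 * s\<close>, which comes from
      separating three terms in two steps; \<open>2 + 2 * c\<close> adds up the three
      prefactors.\<close>
    then have C': "2 \<le> C" "16 * c * b\<^sup>2 \<le> C" "16 * c * m\<^sup>2 \<le> C" "2 + 2 * c \<le> C"
      using c unfolding C by (auto simp: algebra_simps)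
    have e: "exp (2 * s\<^sup>2) \<le> exp (C * s\<^sup>2)" "exp (16 * c * b\<^sup>2 * s\<^sup>2) \<le> exp (C * s\<^sup>2)"
      "exp (16 * c * m\<^sup>2 * s\<^sup>2) \<le> exp (C * s\<^sup>2)"
      unfolding exp_le_cancel_iff using C' by (auto intro!: mult_right_mono)
    have "2 * exp (2 * s\<^sup>2) + (c * exp (16 * c * b\<^sup>2 * s\<^sup>2) + c * exp (16 * c * m\<^sup>2 * s\<^sup>2))
      \<le> 2 * exp (C * s\<^sup>2) + (c * exp (C * s\<^sup>2) + c * exp (C * s\<^sup>2))"
      using e c by (intro add_mono mult_left_mono) auto
    also have "\<dots> = (2 + 2 * c) * exp (C * s\<^sup>2)" by (simp add: algebra_simps)
    also have "\<dots> \<le> C * exp (C * s\<^sup>2)" using C' by (intro mult_right_mono) auto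
    finally show "2 * exp (2 * s\<^sup>2) + (c * exp (16 * c * b\<^sup>2 * s\<^sup>2) + c * exp (16 * c * m\<^sup>2 * s\<^sup>2)) \<le> C * exp (C * s\<^sup>2)" .
  qed
  finally show ?thesis .
qed

section \<open>One-step expansion of the conditional Laplace transform\<close>

definition lnm :: "nat \<Rightarrow> ('a \<Rightarrow> real) \<Rightarrow> real \<Rightarrow> (nat \<Rightarrow> 'a) \<Rightarrow> nat \<Rightarrow> real" where
  "lnm n f \<theta> x i = ln (\<integral>y. exp (\<theta> * (f y - (\<integral>z. f z \<partial>kern n x i))) \<partial>kern n x i)"

text \<open>The particle average takes the place of the supremum that dominates it in
  \<open>kern_dev_le\<close>: the average is what \<open>step_bound\<close> produces, and it is a
  measurable function of the configuration.\<close>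

definition kern_dev :: "nat \<Rightarrow> ('a \<Rightarrow> real) \<Rightarrow> (nat \<Rightarrow> 'a) \<Rightarrow> real" where
  "kern_dev n f x = sqrt N * ((\<Sum>i<N. \<bar>diff_int (kern n x i) (K (Suc n) (\<eta> n) (x i)) f\<bar>) / N)"

text \<open>The uncentred integral lies between \<open>exp (- C)\<close> and \<open>exp C\<close>,
  so its logarithm is bounded; the centring only subtracts a bounded kernel integral.\<close>

lemma lnm_bfun:
  assumes i: "i < N" and f: "f \<in> bfun (E (Suc n))"
  shows "(\<lambda>x. lnm n f \<theta> x i) \<in> bfun (config n)"
proof -
  obtain C where C: "0 \<le> C" "\<And>x. x \<in> space (E (Suc n)) \<Longrightarrow> \<bar>\<theta> * f x\<bar> \<le> C"
    using bfun_cmult[OF f, of \<theta>] by (rule bfunE) blast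
  have ef: "(\<lambda>y. exp (\<theta> * f y)) \<in> bfun (E (Suc n))" by (intro bfun_exp bfun_cmult f)
  have "(\<lambda>x. ln (\<integral>y. exp (\<theta> * f y) \<partial>kern n x i)) \<in> bfun (config n)"
  proof (rule bfunI)
    show "(\<lambda>x. ln (\<integral>y. exp (\<theta> * f y) \<partial>kern n x i)) \<in> borel_measurable (config n)"
      using bfun_measurable[OF kern_bfun[OF i ef]] by measurable
    fix x assume x: "x \<in> space (config n)"
    note k = kern_probs[OF x i]
    interpret prob_space "kern n x i" using k by (rule probs_prob_space)
    have cb: "\<And>c. (\<lambda>_. c) \<in> bfun (E (Suc n))" by (rule bfun_const)
    have "(\<integral>y. exp (- C) \<partial>kern n x i) \<le> (\<integral>y. exp (\<theta> * f y) \<partial>kern n x i)"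
      using C(2) by (intro integral_mono probs_integrable[OF k] ef cb)
        (auto simp: probs_space[OF k] abs_le_iff minus_le_iff)
    moreover have "(\<integral>y. exp (\<theta> * f y) \<partial>kern n x i) \<le> (\<integral>y. exp C \<partial>kern n x i)"
      using C(2) by (intro integral_mono probs_integrable[OF k] ef cb)
        (auto simp: probs_space[OF k] abs_le_iff minus_le_iff)
    ultimately have m: "exp (- C) \<le> (\<integral>y. exp (\<theta> * f y) \<partial>kern n x i)"
      "(\<integral>y. exp (\<theta> * f y) \<partial>kern n x i) \<le> exp C" by (auto simp: prob_space)
    have m0: "0 < (\<integral>y. exp (\<theta> * f y) \<partial>kern n x i)" using m(1) exp_gt_zero less_le_trans by blast
    have "- C \<le> ln (\<integral>y. exp (\<theta> * f y) \<partial>kern n x i)" "ln (\<integral>y. exp (\<theta> * f y) \<partial>kern n x i) \<le> C"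
      using m m0 by (metis exp_le_cancel_iff exp_ln)+
    then show "\<bar>ln (\<integral>y. exp (\<theta> * f y) \<partial>kern n x i)\<bar> \<le> C" by (simp add: abs_le_iff)
  qed
  then have "(\<lambda>x. ln (\<integral>y. exp (\<theta> * f y) \<partial>kern n x i) - \<theta> * (\<integral>z. f z \<partial>kern n x i)) \<in> bfun (config n)"
    by (intro bfun_diff bfun_cmult kern_bfun i f)
  then show ?thesis
  proof (rule bfun_cong)
    fix x assume x: "x \<in> space (config n)"
    have "lnm n f \<theta> x i = ln ((\<integral>y. exp (\<theta> * f y) \<partial>kern n x i) / exp (\<theta> * (\<integral>z. f z \<partial>kern n x i)))"
      unfolding lnm_def by (simp add: right_diff_distrib exp_diff)
    also have "\<dots> = ln (\<integral>y. exp (\<theta> * f y) \<partial>kern n x i) - \<theta> * (\<integral>z. f z \<partial>kern n x i)"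
      using probs_exp_integral_pos[OF kern_probs[OF x i] bfun_cmult[OF f, of \<theta>]] by (simp add: ln_div)
    finally show "ln (\<integral>y. exp (\<theta> * f y) \<partial>kern n x i) - \<theta> * (\<integral>z. f z \<partial>kern n x i) = lnm n f \<theta> x i" ..
  qed
qed

text \<open>An exact identity: the randomness of the last step is integrated out, and only the
  configuration at time \<open>n\<close> remains in the exponent.\<close>

lemma step_laplace:
  assumes f: "f \<in> bfun (E (Suc n))"
  shows "(\<integral>\<omega>. exp (t * Wc (Suc n) f (\<xi> (Suc n) \<omega>)) \<partial>P)
    = (\<integral>\<omega>. exp (t * drift n f (\<xi> n \<omega>) + (\<Sum>i<N. lnm n f (t / sqrt N) (\<xi> n \<omega>) i)) \<partial>P)"
proof -
  let ?\<theta> = "t / sqrt N"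
  have b1: "(\<lambda>\<omega>. exp (t * Wc (Suc n) f (\<xi> (Suc n) \<omega>))) \<in> bfun P"
    by (intro bfun_exp bfun_cmult bfun_comp[OF Wc_bfun[OF f] \<xi>_measurable])
  have "(\<lambda>x. exp (t * drift n f x + (\<Sum>i<N. lnm n f ?\<theta> x i))) \<in> bfun (config n)"
    using f by (intro bfun_exp bfun_add bfun_cmult bfun_sum drift_bfun lnm_bfun) auto
  then have b2: "(\<lambda>\<omega>. exp (t * drift n f (\<xi> n \<omega>) + (\<Sum>i<N. lnm n f ?\<theta> (\<xi> n \<omega>) i))) \<in> bfun P"
    using bfun_comp[OF _ \<xi>_measurable] by blast
  have "ennreal (\<integral>\<omega>. exp (t * Wc (Suc n) f (\<xi> (Suc n) \<omega>)) \<partial>P)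
    = (\<integral>\<^sup>+\<omega>. ennreal (exp (t * Wc (Suc n) f (\<xi> (Suc n) \<omega>))) \<partial>P)"
    using b1 by (intro P.nn_integral_bfun[symmetric]) auto
  also have "\<dots> = (\<integral>\<^sup>+\<omega>. ennreal (exp (t * drift n f (\<xi> n \<omega>) + t * (Wc (Suc n) f (\<xi> (Suc n) \<omega>) - drift n f (\<xi> n \<omega>)))) \<partial>P)"
    by (simp add: algebra_simps)
  also have "\<dots> = (\<integral>\<^sup>+\<omega>. ennreal (exp (t * drift n f (\<xi> n \<omega>))) *
        (\<Prod>i<N. \<integral>\<^sup>+y. ennreal (exp (?\<theta> * (f y - (\<integral>z. f z \<partial>kern n (\<xi> n \<omega>) i)))) \<partial>kern n (\<xi> n \<omega>) i) \<partial>P)"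
    by (rule Wc_mgf_Suc[OF bfun_cmult[OF drift_bfun[OF f]] f])
  also have "\<dots> = (\<integral>\<^sup>+\<omega>. ennreal (exp (t * drift n f (\<xi> n \<omega>) + (\<Sum>i<N. lnm n f ?\<theta> (\<xi> n \<omega>) i))) \<partial>P)"
  proof (intro nn_integral_cong)
    fix \<omega> assume \<omega>: "\<omega> \<in> space P"
    have "(\<integral>\<^sup>+y. ennreal (exp (?\<theta> * (f y - (\<integral>z. f z \<partial>kern n (\<xi> n \<omega>) i)))) \<partial>kern n (\<xi> n \<omega>) i)
      = ennreal (exp (lnm n f ?\<theta> (\<xi> n \<omega>) i))" if i: "i < N" for i
    proof -
      note k = kern_probs[OF \<xi>_space[OF \<omega>] i]
      interpret prob_space "kern n (\<xi> n \<omega>) i" using k by (rule probs_prob_space)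
      have e: "(\<lambda>y. ?\<theta> * (f y - (\<integral>z. f z \<partial>kern n (\<xi> n \<omega>) i))) \<in> bfun (E (Suc n))"
        by (intro bfun_cmult bfun_diff bfun_const f)
      show ?thesis unfolding lnm_def exp_ln[OF probs_exp_integral_pos[OF k e]]
        using bfun_exp[OF e] by (intro nn_integral_bfun) (auto simp: probs_bfun[OF k])
    qed
    then show "ennreal (exp (t * drift n f (\<xi> n \<omega>))) *
        (\<Prod>i<N. \<integral>\<^sup>+y. ennreal (exp (?\<theta> * (f y - (\<integral>z. f z \<partial>kern n (\<xi> n \<omega>) i)))) \<partial>kern n (\<xi> n \<omega>) i)
      = ennreal (exp (t * drift n f (\<xi> n \<omega>) + (\<Sum>i<N. lnm n f ?\<theta> (\<xi> n \<omega>) i)))"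
      by (simp add: prod_ennreal exp_add exp_sum ennreal_mult prod_nonneg)
  qed
  also have "\<dots> = ennreal (\<integral>\<omega>. exp (t * drift n f (\<xi> n \<omega>) + (\<Sum>i<N. lnm n f ?\<theta> (\<xi> n \<omega>) i)) \<partial>P)"
    using b2 by (intro P.nn_integral_bfun) auto
  finally show ?thesis by (simp add: integral_nonneg_AE)
qed

lemma kern_dev_bfun:
  assumes f: "f \<in> bfun (E (Suc n))"
  shows "kern_dev n f \<in> bfun (config n)"
  unfolding kern_dev_def[abs_def] diff_int_def
  using f by (intro bfun_cmult bfun_divide bfun_sum bfun_abs bfun_diff kern_bfun
      config_component_bfun[OF _ K_bfun[OF flow_probs]]) auto

lemma kern_dev_le:
  assumes x: "x \<in> space (config n)"
  shows "ennreal (kern_dev n f x) \<le> ennreal (sqrt N) *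
    sup_norm (E n) (\<lambda>z. diff_int (K (Suc n) (emp n x) z) (K (Suc n) (\<eta> n) z) f)"
proof -
  let ?d = "\<lambda>i. \<bar>diff_int (kern n x i) (K (Suc n) (\<eta> n) (x i)) f\<bar>"
  let ?s = "sup_norm (E n) (\<lambda>z. diff_int (K (Suc n) (emp n x) z) (K (Suc n) (\<eta> n) z) f)"
  have d: "ennreal (?d i) \<le> ?s" if "i < N" for i
    unfolding sup_norm_def using config_space[OF x that] by (rule SUP_upper)
  show ?thesis
  proof (cases "?s = \<infinity>")
    case True
    then show ?thesis using N_pos by (simp add: ennreal_mult_top)
  next
    case False
    then obtain a where a: "?s = ennreal a" "0 \<le> a" by (cases ?s) auto
    have "?d i \<le> a" if "i < N" for i using d[OF that] a by (simp add: ennreal_le_iff)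
    then have "(\<Sum>i<N. ?d i) \<le> (\<Sum>i<N. a)" by (intro sum_mono) simp
    then have "(\<Sum>i<N. ?d i) / N \<le> a" using N_pos by (simp add: pos_divide_le_eq mult.commute)
    then have "kern_dev n f x \<le> sqrt N * a" unfolding kern_dev_def using N_pos by (intro mult_left_mono) auto
    then show ?thesis using a by (simp add: ennreal_mult[symmetric] ennreal_leI)
  qed
qed

text \<open>Three errors are collected: the third order term of the logarithms, the replacement of
  the kernel at the empirical measure by the kernel at \<open>\<eta> n\<close>, and the deviation of
  the particle average of \<open>v\<close> from its mean. The last two are fluctuations divided by
  \<open>sqrt N\<close>, which explains the prefactor.\<close>

lemma step_bound:
  assumes f: "f \<in> bfun (E (Suc n))" and C: "0 \<le> C" "\<And>y. y \<in> space (E (Suc n)) \<Longrightarrow> \<bar>f y\<bar> \<le> C"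
    and t: "\<bar>t / sqrt N\<bar> * (2 * C) \<le> 1 / 2" and x: "x \<in> space (config n)"
    and v: "v = (\<lambda>z. (\<integral>y. (f y)\<^sup>2 \<partial>K (Suc n) (\<eta> n) z) - (\<integral>y. f y \<partial>K (Suc n) (\<eta> n) z)\<^sup>2)"
  shows "\<bar>(\<Sum>i<N. lnm n f (t / sqrt N) x i) - t\<^sup>2 / 2 * local_cov K \<eta>0 (Suc n) f f\<bar>
    \<le> t\<^sup>2 / 2 / sqrt N * (\<bar>Wc n v x\<bar> + kern_dev n (\<lambda>y. (f y)\<^sup>2) x + 2 * C * kern_dev n f x)
      + 2 * real N * (\<bar>t / sqrt N\<bar> * (2 * C)) ^ 3"
proof -
  let ?\<theta> = "t / sqrt N"
  define var where "var = (\<lambda>i. (\<integral>y. (f y)\<^sup>2 \<partial>kern n x i) - (\<integral>y. f y \<partial>kern n x i)\<^sup>2)"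
  have f2: "(\<lambda>y. (f y)\<^sup>2) \<in> bfun (E (Suc n))" by (rule bfun_power2[OF f])
  have vb: "v \<in> bfun (E n)" unfolding v by (intro bfun_diff bfun_power2 K_bfun flow_probs f f2)
  have L: "local_cov K \<eta>0 (Suc n) f f = (\<integral>z. v z \<partial>\<eta> n)"
    unfolding v local_cov_Suc[OF f f] by (simp add: power2_eq_square)
  have ln: "\<bar>lnm n f ?\<theta> x i - ?\<theta>\<^sup>2 / 2 * var i\<bar> \<le> 2 * (\<bar>?\<theta>\<bar> * (2 * C)) ^ 3" if i: "i < N" for i
  proof -
    note k = kern_probs[OF x i]
    interpret prob_space "kern n x i" using k by (rule probs_prob_space)
    have "f \<in> borel_measurable (kern n x i)"
      using bfun_measurable[of f "kern n x i"] f by (simp add: probs_bfun[OF k])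
    moreover have "\<bar>f y - expectation f\<bar> \<le> 2 * C" if "y \<in> space (kern n x i)" for y
    proof -
      have "y \<in> space (E (Suc n))" using that by (simp add: probs_space[OF k])
      then show ?thesis
        using C(2) probs_abs_integral_le[OF k f C(2)] by (smt (verit))
    qed
    ultimately have "\<bar>ln (expectation (\<lambda>y. exp (?\<theta> * (f y - expectation f))))
        - ?\<theta>\<^sup>2 / 2 * expectation (\<lambda>y. (f y - expectation f)\<^sup>2)\<bar> \<le> 2 * (\<bar>?\<theta>\<bar> * (2 * C)) ^ 3"
      using t by (intro ln_mgf_expansion(2)) auto
    moreover have "expectation (\<lambda>y. (f y - expectation f)\<^sup>2) = var i"
      using probs_covariance[OF k f f] unfolding var_def by (simp add: power2_eq_square)
    ultimately show ?thesis unfolding lnm_def by simp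
  qed
  \<comment> \<open>Second moments differ by one \<open>diff_int\<close>; squared means differ by
    the difference of the means times their sum, which is at most \<open>2 * C\<close> in absolute
    value.\<close>
  have var_le: "\<bar>var i - v (x i)\<bar> \<le> \<bar>diff_int (kern n x i) (K (Suc n) (\<eta> n) (x i)) (\<lambda>y. (f y)\<^sup>2)\<bar>
      + 2 * C * \<bar>diff_int (kern n x i) (K (Suc n) (\<eta> n) (x i)) f\<bar>" if i: "i < N" for i
  proof -
    define a where "a = (\<integral>y. f y \<partial>kern n x i)"
    define b where "b = (\<integral>y. f y \<partial>K (Suc n) (\<eta> n) (x i))"
    have ab: "\<bar>a\<bar> \<le> C" "\<bar>b\<bar> \<le> C"
      unfolding a_def b_def using C(2) f
      by (auto intro!: probs_abs_integral_le[OF kern_probs[OF x i]] probs_abs_integral_le[OF K_probs[OF flow_probs config_space[OF x i]]])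
    have "a\<^sup>2 - b\<^sup>2 = (a + b) * (a - b)" by (simp add: power2_eq_square algebra_simps)
    then have "\<bar>a\<^sup>2 - b\<^sup>2\<bar> = \<bar>a + b\<bar> * \<bar>a - b\<bar>" by (simp add: abs_mult)
    also have "\<dots> \<le> (2 * C) * \<bar>a - b\<bar>" using ab by (intro mult_right_mono) auto
    finally have "\<bar>a\<^sup>2 - b\<^sup>2\<bar> \<le> 2 * C * \<bar>a - b\<bar>" .
    moreover have "var i - v (x i) = diff_int (kern n x i) (K (Suc n) (\<eta> n) (x i)) (\<lambda>y. (f y)\<^sup>2) - (a\<^sup>2 - b\<^sup>2)"
      unfolding var_def v a_def b_def diff_int_def by simp
    moreover have "a - b = diff_int (kern n x i) (K (Suc n) (\<eta> n) (x i)) f"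
      unfolding a_def b_def diff_int_def ..
    ultimately show ?thesis by (smt (verit))
  qed
  have \<theta>2: "?\<theta>\<^sup>2 = t\<^sup>2 / N" using N_pos by (simp add: power_divide)
  \<comment> \<open>Telescoping through the sums of \<open>var i\<close> and of
    \<open>v (x i)\<close>.\<close>
  have "(\<Sum>i<N. lnm n f ?\<theta> x i) - t\<^sup>2 / 2 * (\<integral>z. v z \<partial>\<eta> n)
    = (\<Sum>i<N. lnm n f ?\<theta> x i - ?\<theta>\<^sup>2 / 2 * var i) + ?\<theta>\<^sup>2 / 2 * (\<Sum>i<N. var i - v (x i))
      + t\<^sup>2 / 2 * ((\<Sum>i<N. v (x i)) / N - (\<integral>z. v z \<partial>\<eta> n))"
  proof -
    have "u - t\<^sup>2 / 2 * i = (u - t\<^sup>2 / N / 2 * a) + t\<^sup>2 / N / 2 * (a - b) + t\<^sup>2 / 2 * (b / N - i)" for u a b i :: real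
      by (simp add: right_diff_distrib)
    then show ?thesis unfolding \<theta>2 sum_subtractf sum_distrib_left[symmetric] .
  qed
  also have "(\<Sum>i<N. v (x i)) / N - (\<integral>z. v z \<partial>\<eta> n) = Wc n v x / sqrt N"
    unfolding Wc_eq[OF x vb] using N_pos by simp
  finally have eq: "(\<Sum>i<N. lnm n f ?\<theta> x i) - t\<^sup>2 / 2 * local_cov K \<eta>0 (Suc n) f f
    = (\<Sum>i<N. lnm n f ?\<theta> x i - ?\<theta>\<^sup>2 / 2 * var i) + ?\<theta>\<^sup>2 / 2 * (\<Sum>i<N. var i - v (x i))
      + t\<^sup>2 / 2 * (Wc n v x / sqrt N)" unfolding L .
  have "\<bar>\<Sum>i<N. lnm n f ?\<theta> x i - ?\<theta>\<^sup>2 / 2 * var i\<bar> \<le> (\<Sum>i<N. 2 * (\<bar>?\<theta>\<bar> * (2 * C)) ^ 3)"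
    using ln by (intro order_trans[OF sum_abs] sum_mono) auto
  then have 1: "\<bar>\<Sum>i<N. lnm n f ?\<theta> x i - ?\<theta>\<^sup>2 / 2 * var i\<bar> \<le> 2 * real N * (\<bar>?\<theta>\<bar> * (2 * C)) ^ 3"
    by (simp add: mult_ac)
  have "\<bar>\<Sum>i<N. var i - v (x i)\<bar> \<le> (\<Sum>i<N. \<bar>diff_int (kern n x i) (K (Suc n) (\<eta> n) (x i)) (\<lambda>y. (f y)\<^sup>2)\<bar>
      + 2 * C * \<bar>diff_int (kern n x i) (K (Suc n) (\<eta> n) (x i)) f\<bar>)"
    using var_le by (intro order_trans[OF sum_abs] sum_mono) auto
  also have "\<dots> = sqrt N * (kern_dev n (\<lambda>y. (f y)\<^sup>2) x + 2 * C * kern_dev n f x)"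
  proof -
    have "sqrt N * (sqrt N * (u / N) + 2 * C * (sqrt N * (w / N))) = u + 2 * C * w" for u w :: real
    proof -
      have "sqrt N * (sqrt N * (u / N) + 2 * C * (sqrt N * (w / N))) = (sqrt N * sqrt N) * (u / N + 2 * C * (w / N))"
        by (simp only: distrib_left ac_simps)
      then show ?thesis using N_pos by (simp add: distrib_left)
    qed
    then show ?thesis unfolding kern_dev_def sum.distrib sum_distrib_left[symmetric] by (rule sym)
  qed
  finally have "?\<theta>\<^sup>2 / 2 * \<bar>\<Sum>i<N. var i - v (x i)\<bar> \<le> ?\<theta>\<^sup>2 / 2 * (sqrt N * (kern_dev n (\<lambda>y. (f y)\<^sup>2) x + 2 * C * kern_dev n f x))"
    by (intro mult_left_mono) auto
  also have "\<dots> = t\<^sup>2 / 2 / sqrt N * (kern_dev n (\<lambda>y. (f y)\<^sup>2) x + 2 * C * kern_dev n f x)"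
  proof -
    have "sqrt N / N = 1 / sqrt N" using N_pos by (simp add: real_div_sqrt field_simps)
    then have "t\<^sup>2 / N / 2 * (sqrt N * u) = t\<^sup>2 / 2 / sqrt N * u" for u :: real
    proof -
      have "t\<^sup>2 / N / 2 * (sqrt N * u) = t\<^sup>2 / 2 * (sqrt N / N) * u" using N_pos by (simp add: field_simps)
      then show ?thesis using \<open>sqrt N / N = 1 / sqrt N\<close> by simp
    qed
    then show ?thesis unfolding \<theta>2 .
  qed
  finally have 2: "\<bar>?\<theta>\<^sup>2 / 2 * (\<Sum>i<N. var i - v (x i))\<bar> \<le> t\<^sup>2 / 2 / sqrt N * (kern_dev n (\<lambda>y. (f y)\<^sup>2) x + 2 * C * kern_dev n f x)"
    by (simp add: abs_mult)
  have 3: "\<bar>t\<^sup>2 / 2 * (Wc n v x / sqrt N)\<bar> = t\<^sup>2 / 2 / sqrt N * \<bar>Wc n v x\<bar>"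
    by (simp add: abs_mult)
  have "\<bar>(\<Sum>i<N. lnm n f ?\<theta> x i) - t\<^sup>2 / 2 * local_cov K \<eta>0 (Suc n) f f\<bar>
    \<le> 2 * real N * (\<bar>?\<theta>\<bar> * (2 * C)) ^ 3 + t\<^sup>2 / 2 / sqrt N * (kern_dev n (\<lambda>y. (f y)\<^sup>2) x + 2 * C * kern_dev n f x)
      + t\<^sup>2 / 2 / sqrt N * \<bar>Wc n v x\<bar>"
    unfolding eq using 1 2 3 by linarith
  also have "\<dots> = t\<^sup>2 / 2 / sqrt N * (\<bar>Wc n v x\<bar> + kern_dev n (\<lambda>y. (f y)\<^sup>2) x + 2 * C * kern_dev n f x)
      + 2 * real N * (\<bar>?\<theta>\<bar> * (2 * C)) ^ 3"
    by (simp add: distrib_left)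
  finally show ?thesis .
qed

end

text \<open>Adds the whole sequence of particle systems; facts about a single \<open>N\<close> are
  obtained by interpreting \<open>mean_field_particles\<close> inside the proofs.\<close>

locale mean_field_mdp = mean_field_flow E K \<eta>0 D
  for E :: "nat \<Rightarrow> 'a measure" and K \<eta>0 D +
  fixes P :: "nat \<Rightarrow> 'w measure" and \<xi> :: "nat \<Rightarrow> nat \<Rightarrow> 'w \<Rightarrow> nat \<Rightarrow> 'a" and \<alpha> :: "nat \<Rightarrow> real"
  assumes particles: "\<And>N. 1 \<le> N \<Longrightarrow> particle_system E K \<eta>0 N (P N) (\<xi> N)"
    and \<alpha>_pos: "\<And>N. 1 \<le> N \<Longrightarrow> 0 < \<alpha> N"
    and \<alpha>_infinity: "filterlim \<alpha> at_top sequentially"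
    and \<alpha>_small: "(\<lambda>N. \<alpha> N / real N) \<longlonglongrightarrow> 0"
begin

abbreviation "WW N n f \<omega> \<equiv> WN E K \<eta>0 N (\<xi> N) n f \<omega>"

lemma mean_field_particles: "1 \<le> N \<Longrightarrow> mean_field_particles E K \<eta>0 D N (P N) (\<xi> N)"
  using particles by unfold_locales auto

lemma prob: "1 \<le> N \<Longrightarrow> prob_space (P N)"
  using particles unfolding particle_system_def by blast

lemma WN_bfun: "1 \<le> N \<Longrightarrow> f \<in> bfun (E n) \<Longrightarrow> WW N n f \<in> bfun (P N)"
proof -
  assume N: "1 \<le> N" and f: "f \<in> bfun (E n)"
  interpret mp: mean_field_particles E K \<eta>0 D N "P N" "\<xi> N" using N by (rule mean_field_particles)
  show "WW N n f \<in> bfun (P N)"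
    using bfun_comp[OF mp.Wc_bfun[OF f] mp.\<xi>_measurable] by (simp add: mp.WN_Wc[abs_def])
qed

text \<open>The same constant serves as prefactor and in the exponent, so the induction carries one
  parameter; it is quantified before \<open>N\<close>, \<open>g\<close> and
  \<open>s\<close>.\<close>

lemma subgaussian_Osc1:
  "\<exists>c\<ge>1. \<forall>N\<ge>1. \<forall>g\<in>Osc1 (E n). \<forall>s\<ge>0.
     (\<integral>\<^sup>+\<omega>. ennreal (exp (s * \<bar>WW N n g \<omega>\<bar>)) \<partial>P N) \<le> ennreal (c * exp (c * s\<^sup>2))"
proof (induction n)
  case 0
  show ?case
  proof (intro exI[of _ 2] conjI allI ballI impI)
    fix N :: nat and g and s :: real
    assume N: "1 \<le> N" and g: "g \<in> Osc1 (E 0)" and s: "0 \<le> s"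
    interpret mp: mean_field_particles E K \<eta>0 D N "P N" "\<xi> N" using N by (rule mean_field_particles)
    have "(\<integral>\<^sup>+\<omega>. ennreal (exp (s * \<bar>WW N 0 g \<omega>\<bar>)) \<partial>P N) \<le> ennreal (2 * exp (s\<^sup>2 / 2))"
      unfolding mp.WN_Wc by (rule mp.subgaussian_0[OF g])
    also have "\<dots> \<le> ennreal (2 * exp (2 * s\<^sup>2))" by (intro ennreal_leI) simp
    finally show "(\<integral>\<^sup>+\<omega>. ennreal (exp (s * \<bar>WW N 0 g \<omega>\<bar>)) \<partial>P N) \<le> ennreal (2 * exp (2 * s\<^sup>2))" .
  qed simp
next
  case (Suc n)
  then obtain c where c: "1 \<le> c" and IH: "\<And>N g s. 1 \<le> N \<Longrightarrow> g \<in> Osc1 (E n) \<Longrightarrow> 0 \<le> s \<Longrightarrow>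
     (\<integral>\<^sup>+\<omega>. ennreal (exp (s * \<bar>WW N n g \<omega>\<bar>)) \<partial>P N) \<le> ennreal (c * exp (c * s\<^sup>2))" by blast
  obtain b where b: "1 \<le> b" "\<And>\<mu> f. \<mu> \<in> probs (E n) \<Longrightarrow> f \<in> Osc1 (E (Suc n)) \<Longrightarrow> osc (E n) (D (Suc n) \<mu> f) \<le> ennreal b"
    using D_beta[of n] by blast
  obtain m where m: "0 \<le> m" and R: "\<forall>f\<in>bfun (E (Suc n)). \<forall>a\<ge>0. osc (E (Suc n)) f \<le> ennreal a \<longrightarrow>
     (\<exists>R. measure_on_tensors (E n) R \<and>
       (\<integral>\<^sup>+(g1, g2). osc (E n) g1 * osc (E n) g2 \<partial>R) \<le> ennreal (a * m) \<and>
       (\<forall>\<mu>\<in>probs (E n). ennreal \<bar>remainder (Phi K (Suc n)) (D (Suc n)) \<mu> (\<eta> n) f\<bar>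
          \<le> (\<integral>\<^sup>+(g1, g2). ennreal \<bar>diff_int \<mu> (\<eta> n) g1 * diff_int \<mu> (\<eta> n) g2\<bar> \<partial>R)))"
    using remainder_bound[of n] by blast
  \<comment> \<open>\<open>c\<close>, \<open>b\<close> and \<open>m\<close> are fixed before
    \<open>N\<close>, \<open>g\<close> and \<open>s\<close>, so \<open>C\<close> is uniform.\<close>
  define C where "C = 2 + 2 * c + 16 * c * (b\<^sup>2 + m\<^sup>2)"
  have "0 \<le> 16 * c * (b\<^sup>2 + m\<^sup>2)" using c by simp
  then have C1: "1 \<le> C" using c unfolding C_def by linarith
  show ?case
  proof (intro exI[of _ C] conjI allI ballI impI C1)
    fix N :: nat and g and s :: real
    assume N: "1 \<le> N" and g: "g \<in> Osc1 (E (Suc n))" and s: "0 \<le> s"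
    interpret mp: mean_field_particles E K \<eta>0 D N "P N" "\<xi> N" using N by (rule mean_field_particles)
    have "g \<in> bfun (E (Suc n))" "osc (E (Suc n)) g \<le> ennreal 1"
      using g Osc1_bfun by (auto simp: Osc1_def)
    from R[rule_format, OF this(1) _ this(2)] obtain R where
      R: "measure_on_tensors (E n) R" "(\<integral>\<^sup>+(g1, g2). osc (E n) g1 * osc (E n) g2 \<partial>R) \<le> ennreal m"
       "\<And>\<mu>. \<mu> \<in> probs (E n) \<Longrightarrow> ennreal \<bar>remainder (Phi K (Suc n)) (D (Suc n)) \<mu> (\<eta> n) g\<bar>
          \<le> (\<integral>\<^sup>+(g1, g2). ennreal \<bar>diff_int \<mu> (\<eta> n) g1 * diff_int \<mu> (\<eta> n) g2\<bar> \<partial>R)" by auto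
    show "(\<integral>\<^sup>+\<omega>. ennreal (exp (s * \<bar>WW N (Suc n) g \<omega>\<bar>)) \<partial>P N) \<le> ennreal (C * exp (C * s\<^sup>2))"
      unfolding mp.WN_Wc
      by (rule mp.subgaussian_Suc[OF c IH[OF N, unfolded mp.WN_Wc] b(1) b(2)[OF flow_probs g] R(1) m R(2,3) g s C_def])
  qed
qed

text \<open>Sub-Gaussian bounds make a small multiple of the square exponentially integrable, and
  the product of two fluctuations is at most the larger square.\<close>

lemma square_moment:
  "\<exists>t>0. \<exists>C\<ge>1. \<forall>N\<ge>1. \<forall>g1\<in>Osc1 (E n). \<forall>g2\<in>Osc1 (E n).
     (\<integral>\<^sup>+\<omega>. ennreal (exp (t * (\<bar>WW N n g1 \<omega>\<bar> * \<bar>WW N n g2 \<omega>\<bar>))) \<partial>P N) \<le> ennreal C"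
proof -
  obtain c where c: "1 \<le> c" and sg: "\<And>N g s. 1 \<le> N \<Longrightarrow> g \<in> Osc1 (E n) \<Longrightarrow> 0 \<le> s \<Longrightarrow>
     (\<integral>\<^sup>+\<omega>. ennreal (exp (s * \<bar>WW N n g \<omega>\<bar>)) \<partial>P N) \<le> ennreal (c * exp (c * s\<^sup>2))"
    using subgaussian_Osc1[of n] by blast
  define t where "t = 1 / (8 * (c + 1))"
  define C0 where "C0 = exp (2 * (c + 1)) * c * (\<Sum>k. exp (- real k))"
  have t: "0 < t" using c by (simp add: t_def)
  have sq: "(\<integral>\<^sup>+\<omega>. ennreal (exp (t * (WW N n g \<omega>)\<^sup>2)) \<partial>P N) \<le> ennreal C0" if N: "1 \<le> N" and g: "g \<in> Osc1 (E n)" for N g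
  proof -
    interpret prob_space "P N" using prob[OF N] .
    have gb: "g \<in> bfun (E n)" using g Osc1_bfun by blast
    have "t * (WW N n g \<omega>)\<^sup>2 = (WW N n g \<omega>)\<^sup>2 / (8 * (c + 1))" for \<omega> by (simp add: t_def)
    then show ?thesis unfolding C0_def
      using exp_square_moment[OF bfun_measurable[OF WN_bfun[OF N gb]] c sg[OF N g]] by simp
  qed
  show ?thesis
  \<comment> \<open>The absolute value and the added 1 give a constant of at least 1 without
    evaluating the series in \<open>C0\<close>.\<close>
  proof (rule exI[of _ t], intro conjI t, rule exI[of _ "2 * \<bar>C0\<bar> + 1"], intro conjI allI ballI impI)
    fix N :: nat and g1 g2 assume N: "1 \<le> N" and g: "g1 \<in> Osc1 (E n)" "g2 \<in> Osc1 (E n)"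
    have gb: "g1 \<in> bfun (E n)" "g2 \<in> bfun (E n)" using g Osc1_bfun by blast+
    note [measurable] = bfun_measurable[OF WN_bfun[OF N gb(1)]] bfun_measurable[OF WN_bfun[OF N gb(2)]]
    have pt: "exp (t * (\<bar>a\<bar> * \<bar>b\<bar>)) \<le> exp (t * a\<^sup>2) + exp (t * b\<^sup>2)" for a b :: real
    proof -
      have "\<bar>a\<bar> * \<bar>b\<bar> \<le> max (a\<^sup>2) (b\<^sup>2)"
      proof (cases "\<bar>a\<bar> \<le> \<bar>b\<bar>")
        case True
        then have "\<bar>a\<bar> * \<bar>b\<bar> \<le> \<bar>b\<bar> * \<bar>b\<bar>" by (intro mult_right_mono) auto
        then show ?thesis by (simp add: power2_eq_square)
      next
        case False
        then have "\<bar>a\<bar> * \<bar>b\<bar> \<le> \<bar>a\<bar> * \<bar>a\<bar>" by (intro mult_left_mono) auto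
        then show ?thesis by (simp add: power2_eq_square)
      qed
      then have "t * (\<bar>a\<bar> * \<bar>b\<bar>) \<le> t * max (a\<^sup>2) (b\<^sup>2)" using t by (intro mult_left_mono) auto
      then have "exp (t * (\<bar>a\<bar> * \<bar>b\<bar>)) \<le> exp (t * max (a\<^sup>2) (b\<^sup>2))" by simp
      also have "\<dots> \<le> exp (t * a\<^sup>2) + exp (t * b\<^sup>2)" by (simp add: max_def)
      finally show ?thesis .
    qed
    have "(\<integral>\<^sup>+\<omega>. ennreal (exp (t * (\<bar>WW N n g1 \<omega>\<bar> * \<bar>WW N n g2 \<omega>\<bar>))) \<partial>P N)
      \<le> (\<integral>\<^sup>+\<omega>. ennreal (exp (t * (WW N n g1 \<omega>)\<^sup>2)) + ennreal (exp (t * (WW N n g2 \<omega>)\<^sup>2)) \<partial>P N)"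
      using pt by (intro nn_integral_mono) (simp add: ennreal_plus[symmetric] del: ennreal_plus)
    also have "\<dots> = (\<integral>\<^sup>+\<omega>. ennreal (exp (t * (WW N n g1 \<omega>)\<^sup>2)) \<partial>P N) + (\<integral>\<^sup>+\<omega>. ennreal (exp (t * (WW N n g2 \<omega>)\<^sup>2)) \<partial>P N)"
      by (rule nn_integral_add) measurable
    also have "\<dots> \<le> ennreal C0 + ennreal C0" by (intro add_mono sq N g)
    also have "\<dots> \<le> ennreal \<bar>C0\<bar> + ennreal \<bar>C0\<bar>" by (intro add_mono ennreal_leI) auto
    also have "\<dots> \<le> ennreal (2 * \<bar>C0\<bar> + 1)" by (subst ennreal_plus[symmetric]) (auto intro!: ennreal_leI)
    finally show "(\<integral>\<^sup>+\<omega>. ennreal (exp (t * (\<bar>WW N n g1 \<omega>\<bar> * \<bar>WW N n g2 \<omega>\<bar>))) \<partial>P N) \<le> ennreal (2 * \<bar>C0\<bar> + 1)" .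
  qed simp
qed

lemma subgaussian_bfun:
  assumes f: "f \<in> bfun (E n)"
  shows "\<exists>C. \<forall>N\<ge>1. \<forall>s\<ge>0. (\<integral>\<^sup>+\<omega>. ennreal (exp (s * \<bar>WW N n f \<omega>\<bar>)) \<partial>P N) \<le> ennreal (C * exp (C * s\<^sup>2))"
proof -
  obtain c where c: "1 \<le> c" and sg: "\<And>N g s. 1 \<le> N \<Longrightarrow> g \<in> Osc1 (E n) \<Longrightarrow> 0 \<le> s \<Longrightarrow>
     (\<integral>\<^sup>+\<omega>. ennreal (exp (s * \<bar>WW N n g \<omega>\<bar>)) \<partial>P N) \<le> ennreal (c * exp (c * s\<^sup>2))"
    using subgaussian_Osc1[of n] by blast
  obtain a0 where a0: "0 \<le> a0" "\<And>x y. x \<in> space (E n) \<Longrightarrow> y \<in> space (E n) \<Longrightarrow> \<bar>f x - f y\<bar> \<le> a0"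
    using f by (rule bfun_osc) blast
  \<comment> \<open>The added 1 makes the divisor positive even for constant \<open>f\<close> and
    gives \<open>a\<^sup>2 \<ge> 1\<close>, by which the prefactor \<open>c\<close> is
    enlarged.\<close>
  define a where "a = a0 + 1"
  have a: "1 \<le> a" using a0 by (simp add: a_def)
  have g: "(\<lambda>x. f x / a) \<in> Osc1 (E n)"
  proof (rule Osc1_scale[OF f])
    show "\<bar>f x - f y\<bar> \<le> a" if "x \<in> space (E n)" "y \<in> space (E n)" for x y
      using a0(2)[OF that] by (simp add: a_def)
  qed (use a in simp)
  show ?thesis
  proof (intro exI[of _ "c * a\<^sup>2"] allI impI)
    fix N :: nat and s :: real assume N: "1 \<le> N" and s: "0 \<le> s"
    have eq: "s * \<bar>WW N n f \<omega>\<bar> = (s * a) * \<bar>WW N n (\<lambda>x. f x / a) \<omega>\<bar>" for \<omega>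
      using a by (simp add: WN_def diff_int_divide abs_mult)
    have "(\<integral>\<^sup>+\<omega>. ennreal (exp (s * \<bar>WW N n f \<omega>\<bar>)) \<partial>P N) \<le> ennreal (c * exp (c * (s * a)\<^sup>2))"
      unfolding eq using s a by (intro sg[OF N g]) simp
    also have "\<dots> \<le> ennreal (c * a\<^sup>2 * exp (c * a\<^sup>2 * s\<^sup>2))"
    proof (rule ennreal_leI)
      have "1 \<le> a\<^sup>2" using a by simp
      then have "c * 1 \<le> c * a\<^sup>2" using c by (intro mult_left_mono) auto
      then have "c * exp (c * (s * a)\<^sup>2) \<le> c * a\<^sup>2 * exp (c * (s * a)\<^sup>2)" by (intro mult_right_mono) auto
      then show "c * exp (c * (s * a)\<^sup>2) \<le> c * a\<^sup>2 * exp (c * a\<^sup>2 * s\<^sup>2)" by (simp add: power_mult_distrib mult_ac)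
    qed
    finally show "(\<integral>\<^sup>+\<omega>. ennreal (exp (s * \<bar>WW N n f \<omega>\<bar>)) \<partial>P N) \<le> ennreal (c * a\<^sup>2 * exp (c * a\<^sup>2 * s\<^sup>2))" .
  qed
qed

abbreviation "kdev N n f \<omega> \<equiv> mean_field_particles.kern_dev E K \<eta>0 N n f (\<xi> N n \<omega>)"

text \<open>Condition (K) dominates the average change of kernel by an integral of fluctuations at
  time \<open>n\<close>, whose sub-Gaussian bound it inherits. The scaling by \<open>a\<close>
  brings \<open>f\<close> into \<open>Osc1\<close>, the class for which (K) is stated.\<close>

lemma kdev_subgaussian:
  assumes f: "f \<in> bfun (E (Suc n))"
  shows "\<exists>C. \<forall>N\<ge>1. \<forall>s\<ge>0. (\<integral>\<^sup>+\<omega>. ennreal (exp (s * \<bar>kdev N n f \<omega>\<bar>)) \<partial>P N) \<le> ennreal (C * exp (C * s\<^sup>2))"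
proof -
  obtain c where c: "1 \<le> c" and sg: "\<And>N g s. 1 \<le> N \<Longrightarrow> g \<in> Osc1 (E n) \<Longrightarrow> 0 \<le> s \<Longrightarrow>
     (\<integral>\<^sup>+\<omega>. ennreal (exp (s * \<bar>WW N n g \<omega>\<bar>)) \<partial>P N) \<le> ennreal (c * exp (c * s\<^sup>2))"
    using subgaussian_Osc1[of n] by blast
  obtain a0 where a0: "0 \<le> a0" "\<And>x y. x \<in> space (E (Suc n)) \<Longrightarrow> y \<in> space (E (Suc n)) \<Longrightarrow> \<bar>f x - f y\<bar> \<le> a0"
    using f by (rule bfun_osc) blast
  define a where "a = a0 + 1"
  have a: "1 \<le> a" using a0 by (simp add: a_def)
  have g: "(\<lambda>x. f x / a) \<in> Osc1 (E (Suc n))"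
  proof (rule Osc1_scale[OF f])
    show "\<bar>f x - f y\<bar> \<le> a" if "x \<in> space (E (Suc n))" "y \<in> space (E (Suc n))" for x y
      using a0(2)[OF that] by (simp add: a_def)
  qed (use a in simp)
  obtain m where m: "0 \<le> m" and T: "\<forall>f\<in>Osc1 (E (Suc n)).
     \<exists>T. measure_on_bfun (E n) T \<and> (\<integral>\<^sup>+h. osc (E n) h \<partial>T) \<le> ennreal m \<and>
       (\<forall>\<mu>\<in>probs (E n). sup_norm (E n) (\<lambda>x. diff_int (K (Suc n) \<mu> x) (K (Suc n) (\<eta> n) x) f)
          \<le> (\<integral>\<^sup>+h. ennreal \<bar>diff_int \<mu> (\<eta> n) h\<bar> \<partial>T))"
    using kernel_bound[of n] by blast
  from T g obtain T where T: "measure_on_bfun (E n) T" "(\<integral>\<^sup>+h. osc (E n) h \<partial>T) \<le> ennreal m"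
       "\<And>\<mu>. \<mu> \<in> probs (E n) \<Longrightarrow> sup_norm (E n) (\<lambda>x. diff_int (K (Suc n) \<mu> x) (K (Suc n) (\<eta> n) x) (\<lambda>x. f x / a))
          \<le> (\<integral>\<^sup>+h. ennreal \<bar>diff_int \<mu> (\<eta> n) h\<bar> \<partial>T)" by blast
  define C where "C = c * (1 + a\<^sup>2 * m\<^sup>2)"
  show ?thesis
  proof (intro exI[of _ C] allI impI)
    fix N :: nat and s :: real assume N: "1 \<le> N" and s: "0 \<le> s"
    interpret mp: mean_field_particles E K \<eta>0 D N "P N" "\<xi> N" using N by (rule mean_field_particles)
    have "1 \<le> exp (c * (s * a * m)\<^sup>2)" using c by simp
    then have "1 * 1 \<le> c * exp (c * (s * a * m)\<^sup>2)" using c by (intro mult_mono) auto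
    then have C1: "1 \<le> c * exp (c * (s * a * m)\<^sup>2)" by simp
    have eq: "s * \<bar>mp.kern_dev n f x\<bar> = (s * a) * \<bar>mp.kern_dev n (\<lambda>x. f x / a) x\<bar>" for x
      using a by (simp add: mp.kern_dev_def diff_int_divide sum_divide_distrib[symmetric] abs_mult)
    have "(\<integral>\<^sup>+\<omega>. ennreal (exp (s * \<bar>kdev N n f \<omega>\<bar>)) \<partial>P N)
       = (\<integral>\<^sup>+\<omega>. ennreal (exp (s * a * \<bar>mp.kern_dev n (\<lambda>x. f x / a) (\<xi> N n \<omega>)\<bar>)) \<partial>P N)" unfolding eq ..
    also have "\<dots> \<le> ennreal (c * exp (c * (s * a * m)\<^sup>2))"
    proof (rule mp.kernel_moment[OF T(1,2) m T(3) _ C1])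
      show "(\<integral>\<^sup>+\<omega>. ennreal (exp (s * a * m * \<bar>mp.Wc n h (\<xi> N n \<omega>)\<bar>)) \<partial>P N) \<le> ennreal (c * exp (c * (s * a * m)\<^sup>2))"
        if "h \<in> Osc1 (E n)" for h
        using sg[OF N that, of "s * a * m"] s a m unfolding mp.WN_Wc by simp
      show "ennreal \<bar>mp.kern_dev n (\<lambda>x. f x / a) (\<xi> N n \<omega>)\<bar> \<le> ennreal (sqrt N) *
          sup_norm (E n) (\<lambda>x. diff_int (K (Suc n) (empirical (E n) N (\<xi> N n \<omega>)) x) (K (Suc n) (\<eta> n) x) (\<lambda>x. f x / a))"
        if "\<omega> \<in> space (P N)" for \<omega>
      proof -
        have "0 \<le> mp.kern_dev n (\<lambda>x. f x / a) (\<xi> N n \<omega>)"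
          unfolding mp.kern_dev_def by (intro mult_nonneg_nonneg divide_nonneg_nonneg sum_nonneg) auto
        then show ?thesis using mp.kern_dev_le[OF mp.\<xi>_space[OF that]] by simp
      qed
    qed (use s a in auto)
    also have "\<dots> \<le> ennreal (C * exp (C * s\<^sup>2))"
    proof (rule ennreal_leI)
      have "0 \<le> c * (a\<^sup>2 * m\<^sup>2)" "0 \<le> c * s\<^sup>2" using c by auto
      then have "c \<le> C" "c * (s * a * m)\<^sup>2 \<le> C * s\<^sup>2" "0 \<le> C"
        using c unfolding C_def by (auto simp: distrib_left distrib_right power_mult_distrib mult_ac)
      then show "c * exp (c * (s * a * m)\<^sup>2) \<le> C * exp (C * s\<^sup>2)" by (intro mult_mono) auto
    qed
    finally show "(\<integral>\<^sup>+\<omega>. ennreal (exp (s * \<bar>kdev N n f \<omega>\<bar>)) \<partial>P N) \<le> ennreal (C * exp (C * s\<^sup>2))" .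
  qed
qed

text \<open>The exponent becomes a multiple of \<open>(\<alpha> N)\<^sup>2 / N\<close>, that is
  \<alpha> N times a multiple of \<open>\<alpha> N / N\<close>, and the last ratio tends to
  0.\<close>

lemma negligible_linear:
  assumes "\<exists>C. \<forall>N\<ge>1. \<forall>s\<ge>0. (\<integral>\<^sup>+\<omega>. ennreal (exp (s * \<bar>X N \<omega>\<bar>)) \<partial>P N) \<le> ennreal (C * exp (C * s\<^sup>2))"
  shows "exp_negligible P \<alpha> (\<lambda>N \<omega>. k * (\<alpha> N / sqrt N) * X N \<omega>)"
proof -
  obtain C where C: "\<And>N s. 1 \<le> N \<Longrightarrow> 0 \<le> s \<Longrightarrow> (\<integral>\<^sup>+\<omega>. ennreal (exp (s * \<bar>X N \<omega>\<bar>)) \<partial>P N) \<le> ennreal (C * exp (C * s\<^sup>2))"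
    using assms by blast
  show ?thesis
  proof (rule exp_negligible_moment[OF \<alpha>_infinity, where b = "\<lambda>s N. C * s\<^sup>2 * k\<^sup>2 * ((\<alpha> N)\<^sup>2 / N)"])
    fix s :: real assume s: "0 < s"
    show "\<exists>C'. eventually (\<lambda>N. (\<integral>\<^sup>+\<omega>. ennreal (exp (s * \<bar>k * (\<alpha> N / sqrt N) * X N \<omega>\<bar>)) \<partial>P N)
       \<le> ennreal (C' * exp (C * s\<^sup>2 * k\<^sup>2 * ((\<alpha> N)\<^sup>2 / N)))) sequentially"
    proof (intro exI[of _ C] eventually_mono[OF eventually_ge_at_top[of 1]])
      fix N :: nat assume N: "1 \<le> N"
      let ?s = "s * \<bar>k\<bar> * (\<alpha> N / sqrt N)"
      have eq: "s * \<bar>k * (\<alpha> N / sqrt N) * X N \<omega>\<bar> = ?s * \<bar>X N \<omega>\<bar>" for \<omega>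
        using \<alpha>_pos[OF N] by (simp add: abs_mult)
      have s2: "C * ?s\<^sup>2 = C * s\<^sup>2 * k\<^sup>2 * ((\<alpha> N)\<^sup>2 / N)"
        by (simp add: power_mult_distrib power_divide)
      have "0 \<le> ?s" using s \<alpha>_pos[OF N] by simp
      from C[OF N this] show "(\<integral>\<^sup>+\<omega>. ennreal (exp (s * \<bar>k * (\<alpha> N / sqrt N) * X N \<omega>\<bar>)) \<partial>P N)
        \<le> ennreal (C * exp (C * s\<^sup>2 * k\<^sup>2 * ((\<alpha> N)\<^sup>2 / N)))"
        unfolding eq s2 .
    qed
    have "(\<lambda>N. C * s\<^sup>2 * k\<^sup>2 * (\<alpha> N / N)) \<longlonglongrightarrow> C * s\<^sup>2 * k\<^sup>2 * 0"
      by (intro tendsto_mult tendsto_const \<alpha>_small)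
    moreover have "eventually (\<lambda>N. C * s\<^sup>2 * k\<^sup>2 * (\<alpha> N / N) = C * s\<^sup>2 * k\<^sup>2 * ((\<alpha> N)\<^sup>2 / N) / \<alpha> N) sequentially"
      using eventually_ge_at_top[of 1] by eventually_elim (use \<alpha>_pos in \<open>auto simp: power2_eq_square\<close>)
    ultimately show "(\<lambda>N. C * s\<^sup>2 * k\<^sup>2 * ((\<alpha> N)\<^sup>2 / N) / \<alpha> N) \<longlonglongrightarrow> 0"
      by (simp add: filterlim_cong[OF refl refl])
  qed
qed

lemma sqrt_\<alpha>_small: "(\<lambda>N. sqrt (\<alpha> N / N)) \<longlonglongrightarrow> 0"
  using tendsto_real_sqrt[OF \<alpha>_small] by simp

text \<open>\<open>sqrt (\<alpha> N) * sqrt N\<close> equals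
  \<open>sqrt (\<alpha> N / N) * N\<close>, and \<open>N\<close> times the remainder has a bounded
  exponential moment at a small fixed parameter. As \<open>sqrt (\<alpha> N / N)\<close> tends to 0,
  every multiple \<open>s\<close> eventually falls below that parameter.\<close>

lemma remainder_negligible:
  assumes f: "f \<in> bfun (E (Suc n))"
  shows "exp_negligible P \<alpha> (\<lambda>N \<omega>. k * sqrt (\<alpha> N) *
    (sqrt N * remainder (Phi K (Suc n)) (D (Suc n)) (empirical (E n) N (\<xi> N n \<omega>)) (\<eta> n) f))"
proof -
  let ?r = "\<lambda>N \<omega>. remainder (Phi K (Suc n)) (D (Suc n)) (empirical (E n) N (\<xi> N n \<omega>)) (\<eta> n) f"
  obtain a where a: "0 \<le> a" "osc (E (Suc n)) f = ennreal a" using f by (rule bfun_osc) blast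
  obtain m where m: "0 \<le> m" and R: "\<forall>f\<in>bfun (E (Suc n)). \<forall>a\<ge>0. osc (E (Suc n)) f \<le> ennreal a \<longrightarrow>
     (\<exists>R. measure_on_tensors (E n) R \<and>
       (\<integral>\<^sup>+(g1, g2). osc (E n) g1 * osc (E n) g2 \<partial>R) \<le> ennreal (a * m) \<and>
       (\<forall>\<mu>\<in>probs (E n). ennreal \<bar>remainder (Phi K (Suc n)) (D (Suc n)) \<mu> (\<eta> n) f\<bar>
          \<le> (\<integral>\<^sup>+(g1, g2). ennreal \<bar>diff_int \<mu> (\<eta> n) g1 * diff_int \<mu> (\<eta> n) g2\<bar> \<partial>R)))"
    using remainder_bound[of n] by blast
  from R[rule_format, OF f a(1) eq_refl[OF a(2)]] obtain R where
      R: "measure_on_tensors (E n) R" "(\<integral>\<^sup>+(g1, g2). osc (E n) g1 * osc (E n) g2 \<partial>R) \<le> ennreal (a * m)"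
       "\<And>\<mu>. \<mu> \<in> probs (E n) \<Longrightarrow> ennreal \<bar>remainder (Phi K (Suc n)) (D (Suc n)) \<mu> (\<eta> n) f\<bar>
          \<le> (\<integral>\<^sup>+(g1, g2). ennreal \<bar>diff_int \<mu> (\<eta> n) g1 * diff_int \<mu> (\<eta> n) g2\<bar> \<partial>R)" by auto
  obtain t C where t: "0 < t" and C: "1 \<le> C" and sq: "\<And>N g1 g2. 1 \<le> N \<Longrightarrow> g1 \<in> Osc1 (E n) \<Longrightarrow> g2 \<in> Osc1 (E n) \<Longrightarrow>
     (\<integral>\<^sup>+\<omega>. ennreal (exp (t * (\<bar>WW N n g1 \<omega>\<bar> * \<bar>WW N n g2 \<omega>\<bar>))) \<partial>P N) \<le> ennreal C"
    using square_moment[of n] by blast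
  have am: "0 \<le> a * m" using a m by simp
  show ?thesis
  \<comment> \<open>The growth term is 0: the moments are eventually bounded by a constant, which
    any \<epsilon> absorbs.\<close>
  proof (rule exp_negligible_moment[OF \<alpha>_infinity, where b = "\<lambda>s N. 0"])
    fix s :: real assume s: "0 < s"
    have "(\<lambda>N. s * \<bar>k\<bar> * sqrt (\<alpha> N / N) * (a * m)) \<longlonglongrightarrow> s * \<bar>k\<bar> * 0 * (a * m)"
      by (intro tendsto_mult tendsto_const sqrt_\<alpha>_small)
    then have "eventually (\<lambda>N. s * \<bar>k\<bar> * sqrt (\<alpha> N / N) * (a * m) < t) sequentially"
      using t by (intro order_tendstoD(2)) auto
    then have "eventually (\<lambda>N. (\<integral>\<^sup>+\<omega>. ennreal (exp (s * \<bar>k * sqrt (\<alpha> N) * (sqrt N * ?r N \<omega>)\<bar>)) \<partial>P N) \<le> ennreal (C * exp 0)) sequentially"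
      using eventually_ge_at_top[of 1]
    proof eventually_elim
      case (elim N)
      note N = elim(2)
      interpret mp: mean_field_particles E K \<eta>0 D N "P N" "\<xi> N" using N by (rule mean_field_particles)
      let ?s = "s * \<bar>k\<bar> * sqrt (\<alpha> N / N)"
      have eq: "s * \<bar>k * sqrt (\<alpha> N) * (sqrt N * x)\<bar> = ?s * \<bar>N * x\<bar>" for x :: real
      proof -
        have "sqrt (\<alpha> N) * sqrt N = sqrt (\<alpha> N / N) * N"
        proof -
          have "sqrt (\<alpha> N / N) * N = sqrt (\<alpha> N) * (N / sqrt N)" by (simp add: real_sqrt_divide)
          then show ?thesis by (simp only: real_div_sqrt of_nat_0_le_iff)
        qed
        then have "s * \<bar>k\<bar> * (sqrt (\<alpha> N) * sqrt N) * \<bar>x\<bar> = s * \<bar>k\<bar> * (sqrt (\<alpha> N / N) * N) * \<bar>x\<bar>" by simp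
        then show ?thesis using \<alpha>_pos[OF N] by (simp add: abs_mult mult.assoc)
      qed
      have "(\<integral>\<^sup>+\<omega>. ennreal (exp (?s * \<bar>N * ?r N \<omega>\<bar>)) \<partial>P N) \<le> ennreal C"
      proof (rule mp.remainder_moment[OF R(1,2) am R(3) _ C])
        fix g1 g2 assume g: "g1 \<in> Osc1 (E n)" "g2 \<in> Osc1 (E n)"
        have "(\<integral>\<^sup>+\<omega>. ennreal (exp (?s * (a * m) * (\<bar>mp.Wc n g1 (\<xi> N n \<omega>)\<bar> * \<bar>mp.Wc n g2 (\<xi> N n \<omega>)\<bar>))) \<partial>P N)
          \<le> (\<integral>\<^sup>+\<omega>. ennreal (exp (t * (\<bar>mp.Wc n g1 (\<xi> N n \<omega>)\<bar> * \<bar>mp.Wc n g2 (\<xi> N n \<omega>)\<bar>))) \<partial>P N)"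
          using elim(1) by (intro nn_integral_mono ennreal_leI iffD2[OF exp_le_cancel_iff] mult_right_mono) auto
        also have "\<dots> \<le> ennreal C" using sq[OF N g] unfolding mp.WN_Wc .
        finally show "(\<integral>\<^sup>+\<omega>. ennreal (exp (?s * (a * m) * (\<bar>mp.Wc n g1 (\<xi> N n \<omega>)\<bar> * \<bar>mp.Wc n g2 (\<xi> N n \<omega>)\<bar>))) \<partial>P N) \<le> ennreal C" .
      qed (use s \<alpha>_pos[OF N] in auto)
      then show ?case unfolding eq by simp
    qed
    then show "\<exists>C. eventually (\<lambda>N. (\<integral>\<^sup>+\<omega>. ennreal (exp (s * \<bar>k * sqrt (\<alpha> N) * (sqrt N * ?r N \<omega>)\<bar>)) \<partial>P N) \<le> ennreal (C * exp 0)) sequentially"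
      by blast
  qed simp
qed

end

section \<open>Logarithmic Laplace limits of the fluctuations\<close>

context mean_field_mdp
begin

text \<open>\<open>N\<close> errors of order (\<alpha> N / N)^(3/2), divided by \<alpha> N, leave
  \<open>sqrt (\<alpha> N / N)\<close>.\<close>

lemma cube_small:
  "(\<lambda>N. 2 * real N * (\<bar>s * sqrt (\<alpha> N) / sqrt N\<bar> * c) ^ 3 / \<alpha> N) \<longlonglongrightarrow> 0"
proof -
  have "(\<lambda>N. 2 * (\<bar>s\<bar> * c) ^ 3 * sqrt (\<alpha> N / N)) \<longlonglongrightarrow> 2 * (\<bar>s\<bar> * c) ^ 3 * 0"
    by (intro tendsto_mult tendsto_const sqrt_\<alpha>_small)
  moreover have "eventually (\<lambda>N. 2 * (\<bar>s\<bar> * c) ^ 3 * sqrt (\<alpha> N / N)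
      = 2 * real N * (\<bar>s * sqrt (\<alpha> N) / sqrt N\<bar> * c) ^ 3 / \<alpha> N) sequentially"
    using eventually_ge_at_top[of 1]
  proof eventually_elim
    case (elim N)
    have a: "0 < \<alpha> N" "0 < real N" using \<alpha>_pos elim by auto
    let ?q = "sqrt (\<alpha> N / N)"
    have q2: "?q * ?q = \<alpha> N / N" using a by simp
    have "\<bar>s * sqrt (\<alpha> N) / sqrt N\<bar> * c = \<bar>s\<bar> * c * ?q"
      using a by (simp add: abs_mult real_sqrt_divide)
    then have "(\<bar>s * sqrt (\<alpha> N) / sqrt N\<bar> * c) ^ 3 = (\<bar>s\<bar> * c) ^ 3 * ?q ^ 3"
      by (simp only: power_mult_distrib)
    also have "?q ^ 3 = (\<alpha> N / N) * ?q" using q2 by (simp add: eval_nat_numeral)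
    finally have "2 * real N * (\<bar>s * sqrt (\<alpha> N) / sqrt N\<bar> * c) ^ 3 / \<alpha> N
      = 2 * real N * ((\<bar>s\<bar> * c) ^ 3 * ((\<alpha> N / N) * ?q)) / \<alpha> N" by simp
    also have "\<dots> = 2 * (\<bar>s\<bar> * c) ^ 3 * ?q" using a by (simp add: field_simps)
    finally show ?case ..
  qed
  ultimately show ?thesis by (simp add: filterlim_cong[OF refl refl])
qed

text \<open>For large \<open>N\<close> the parameter enters the range in which
  \<open>ln_mgf_expansion\<close> applies.\<close>

lemma step_small: "eventually (\<lambda>N. \<bar>s * sqrt (\<alpha> N) / sqrt N\<bar> * c \<le> 1 / 2) sequentially"
proof -
  have "(\<lambda>N. \<bar>s\<bar> * sqrt (\<alpha> N / N) * c) \<longlonglongrightarrow> \<bar>s\<bar> * 0 * c"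
    by (intro tendsto_mult tendsto_const sqrt_\<alpha>_small)
  then have "eventually (\<lambda>N. \<bar>s\<bar> * sqrt (\<alpha> N / N) * c < 1 / 2) sequentially"
    by (rule order_tendstoD(2)) simp
  then show ?thesis using eventually_ge_at_top[of 1]
  proof eventually_elim
    case (elim N)
    then show ?case using \<alpha>_pos[of N] by (simp add: abs_mult real_sqrt_divide)
  qed
qed

text \<open>The initial particles are i.i.d., so the Laplace transform is an N-th power, and the
  expansion of a single logarithm, multiplied by \<open>N\<close>, gives the limit with a cubic
  error.\<close>

lemma log_laplace_0:
  assumes f: "f \<in> bfun (E 0)"
  shows "(\<lambda>N. ln (\<integral>\<omega>. exp (s * sqrt (\<alpha> N) * WW N 0 f \<omega>) \<partial>P N) / \<alpha> N) \<longlonglongrightarrow> s\<^sup>2 / 2 * limit_var 0 f"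
proof -
  note \<eta>0 = flow_probs[of 0]
  interpret \<eta>0: prob_space "\<eta> 0" using \<eta>0 by (rule probs_prob_space)
  obtain C where C: "0 \<le> C" "\<And>x. x \<in> space (E 0) \<Longrightarrow> \<bar>f x\<bar> \<le> C" using f by (rule bfunE) blast
  let ?c = "2 * C"
  let ?t = "\<lambda>N. s * sqrt (\<alpha> N)"
  have dev: "\<bar>f y - \<eta>0.expectation f\<bar> \<le> ?c" if "y \<in> space (\<eta> 0)" for y
  proof -
    have "y \<in> space (E 0)" using that by (simp only: probs_space[OF \<eta>0])
    then show ?thesis using C(2) probs_abs_integral_le[OF \<eta>0 f C(2)] by (smt (verit))
  qed
  have L: "\<eta>0.expectation (\<lambda>y. (f y - \<eta>0.expectation f)\<^sup>2) = limit_var 0 f"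
    by (simp add: limit_var_0 power2_eq_square)
  have fm: "f \<in> borel_measurable (\<eta> 0)" using bfun_measurable[of f "\<eta> 0"] f by (simp only: probs_bfun[OF \<eta>0])
  have eq: "(\<integral>\<omega>. exp (?t N * WW N 0 f \<omega>) \<partial>P N)
      = \<eta>0.expectation (\<lambda>y. exp (?t N / sqrt N * (f y - \<eta>0.expectation f))) ^ N" if N: "1 \<le> N" for N
  proof -
    interpret mp: mean_field_particles E K \<eta>0 D N "P N" "\<xi> N" using N by (rule mean_field_particles)
    have e: "(\<lambda>y. exp (?t N / sqrt N * (f y - \<eta>0.expectation f))) \<in> bfun (\<eta> 0)"
      unfolding probs_bfun[OF \<eta>0] by (intro bfun_exp bfun_cmult bfun_diff bfun_const f)
    have "ennreal (\<integral>\<omega>. exp (?t N * WW N 0 f \<omega>) \<partial>P N) = (\<integral>\<^sup>+\<omega>. ennreal (exp (?t N * WW N 0 f \<omega>)) \<partial>P N)"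
      by (intro mp.P.nn_integral_bfun[symmetric] bfun_exp bfun_cmult WN_bfun N f) simp
    also have "\<dots> = (\<integral>\<^sup>+y. ennreal (exp (?t N / sqrt N * (f y - \<eta>0.expectation f))) \<partial>\<eta> 0) ^ N"
      unfolding mp.WN_Wc by (rule mp.Wc_mgf_0[OF f])
    also have "\<dots> = ennreal (\<eta>0.expectation (\<lambda>y. exp (?t N / sqrt N * (f y - \<eta>0.expectation f)))) ^ N"
      by (subst \<eta>0.nn_integral_bfun[OF e]) auto
    finally show ?thesis by (simp add: ennreal_power integral_nonneg_AE del: flow.simps)
  qed
  have "(\<lambda>N. ln (\<integral>\<omega>. exp (?t N * WW N 0 f \<omega>) \<partial>P N) / \<alpha> N - s\<^sup>2 / 2 * limit_var 0 f) \<longlonglongrightarrow> 0"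
  proof (rule Lim_null_comparison[OF _ cube_small[of s ?c]])
    show "eventually (\<lambda>N. norm (ln (\<integral>\<omega>. exp (?t N * WW N 0 f \<omega>) \<partial>P N) / \<alpha> N - s\<^sup>2 / 2 * limit_var 0 f)
      \<le> 2 * real N * (\<bar>?t N / sqrt N\<bar> * ?c) ^ 3 / \<alpha> N) sequentially"
      using step_small[of s ?c] eventually_ge_at_top[of 1]
    proof eventually_elim
      case (elim N)
      have a: "0 < \<alpha> N" "0 < real N" using \<alpha>_pos elim by auto
      let ?\<theta> = "?t N / sqrt N"
      let ?m = "\<eta>0.expectation (\<lambda>y. exp (?\<theta> * (f y - \<eta>0.expectation f)))"
      note mgf = \<eta>0.ln_mgf_expansion[OF fm dev elim(1), unfolded L]
      have \<theta>2: "?\<theta>\<^sup>2 = s\<^sup>2 * \<alpha> N / N" using a by (simp add: power_divide power_mult_distrib)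
      have e: "ln (?m ^ N) / \<alpha> N - s\<^sup>2 / 2 * limit_var 0 f = N / \<alpha> N * (ln ?m - ?\<theta>\<^sup>2 / 2 * limit_var 0 f)"
        unfolding \<theta>2 using mgf(1) a by (simp add: ln_realpow right_diff_distrib)
      have "\<bar>N / \<alpha> N * d\<bar> \<le> 2 * real N * x / \<alpha> N" if "\<bar>d\<bar> \<le> 2 * x" for d x :: real
      proof -
        have "\<bar>N / \<alpha> N * d\<bar> = N / \<alpha> N * \<bar>d\<bar>" using a by (simp add: abs_mult)
        also have "\<dots> \<le> N / \<alpha> N * (2 * x)" using that a by (intro mult_left_mono) auto
        finally show ?thesis by (simp add: mult_ac)
      qed
      from this[OF mgf(2)] show ?case unfolding eq[OF elim(2)] real_norm_def e .
    qed
  qed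
  then show ?thesis by (simp add: LIM_zero_iff)
qed

lemma log_laplace_Suc:
  assumes f: "f \<in> bfun (E (Suc n))"
    and IH: "\<And>s. (\<lambda>N. ln (\<integral>\<omega>. exp (s * sqrt (\<alpha> N) * WW N n (D (Suc n) (\<eta> n) f) \<omega>) \<partial>P N) / \<alpha> N)
        \<longlonglongrightarrow> s\<^sup>2 / 2 * limit_var n (D (Suc n) (\<eta> n) f)"
  shows "(\<lambda>N. ln (\<integral>\<omega>. exp (s * sqrt (\<alpha> N) * WW N (Suc n) f \<omega>) \<partial>P N) / \<alpha> N)
        \<longlonglongrightarrow> s\<^sup>2 / 2 * limit_var (Suc n) f"
proof -
  let ?h = "D (Suc n) (\<eta> n) f"
  let ?t = "\<lambda>N. s * sqrt (\<alpha> N)"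
  have h: "?h \<in> bfun (E n)" by (rule D_bfun[OF flow_probs f])
  define L where "L = local_cov K \<eta>0 (Suc n) f f"
  obtain C where C: "0 \<le> C" "\<And>y. y \<in> space (E (Suc n)) \<Longrightarrow> \<bar>f y\<bar> \<le> C" using f by (rule bfunE) blast
  have f2: "(\<lambda>y. (f y)\<^sup>2) \<in> bfun (E (Suc n))" by (rule bfun_power2[OF f])
  define v where "v = (\<lambda>z. (\<integral>y. (f y)\<^sup>2 \<partial>K (Suc n) (\<eta> n) z) - (\<integral>y. f y \<partial>K (Suc n) (\<eta> n) z)\<^sup>2)"
  have v: "v \<in> bfun (E n)" unfolding v_def by (intro bfun_diff bfun_power2 K_bfun flow_probs f f2)
  define r where "r = (\<lambda>N \<omega>. sqrt N * remainder (Phi K (Suc n)) (D (Suc n)) (empirical (E n) N (\<xi> N n \<omega>)) (\<eta> n) f)"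
  define l where "l = (\<lambda>N \<omega>. (\<Sum>i<N. mean_field_particles.lnm E K N n f (?t N / sqrt N) (\<xi> N n \<omega>) i))"
  \<comment> \<open>\<open>A\<close> is the term to which the induction hypothesis applies, at every
    multiple of \<open>s\<close>. \<open>B\<close> collects the remainder and the deviation of the
    summed cumulants from the deterministic variance.\<close>
  define A where "A = (\<lambda>N \<omega>. ?t N * WW N n ?h \<omega>)"
  define B where "B = (\<lambda>N \<omega>. ?t N * r N \<omega> + (l N \<omega> - (?t N)\<^sup>2 / 2 * L))"
  have t2: "(?t N)\<^sup>2 = s\<^sup>2 * \<alpha> N" if "1 \<le> N" for N
    using \<alpha>_pos[OF that] by (simp add: power_mult_distrib)
  have Ab: "A N \<in> bfun (P N)" if "1 \<le> N" for N
    unfolding A_def by (intro bfun_cmult WN_bfun that h)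
  have rb: "r N \<in> bfun (P N)" if N: "1 \<le> N" for N
  proof -
    interpret mp: mean_field_particles E K \<eta>0 D N "P N" "\<xi> N" using N by (rule mean_field_particles)
    have "(\<lambda>\<omega>. mp.drift n f (\<xi> N n \<omega>) - mp.Wc n ?h (\<xi> N n \<omega>)) \<in> bfun (P N)"
      by (intro bfun_diff bfun_comp[OF mp.drift_bfun[OF f] mp.\<xi>_measurable] bfun_comp[OF mp.Wc_bfun[OF h] mp.\<xi>_measurable])
    then show ?thesis unfolding mp.drift_eq r_def by simp
  qed
  have lb: "l N \<in> bfun (P N)" if N: "1 \<le> N" for N
  proof -
    interpret mp: mean_field_particles E K \<eta>0 D N "P N" "\<xi> N" using N by (rule mean_field_particles)
    show ?thesis unfolding l_def
      by (intro bfun_sum bfun_comp[OF mp.lnm_bfun[OF _ f] mp.\<xi>_measurable]) simp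
  qed
  have kb: "kdev N n g \<in> bfun (P N)" if N: "1 \<le> N" and g: "g \<in> bfun (E (Suc n))" for N g
  proof -
    interpret mp: mean_field_particles E K \<eta>0 D N "P N" "\<xi> N" using N by (rule mean_field_particles)
    show ?thesis by (rule bfun_comp[OF mp.kern_dev_bfun[OF g] mp.\<xi>_measurable])
  qed
  have Bb: "B N \<in> bfun (P N)" if "1 \<le> N" for N
    unfolding B_def by (intro bfun_add bfun_diff bfun_cmult bfun_const rb lb that)
  have neg: "exp_negligible P \<alpha> B"
  proof (rule exp_negligible_mono)
    \<comment> \<open>One term for each error: the remainder, the deviation of the average of
      \<open>v\<close>, the changes of kernel for the square of \<open>f\<close> and for
      \<open>f\<close>, and the deterministic third order bound.\<close>
    let ?T1 = "\<lambda>N \<omega>. \<bar>?t N * r N \<omega>\<bar>"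
    let ?T2 = "\<lambda>N \<omega>. \<bar>s\<^sup>2 / 2 * (\<alpha> N / sqrt N) * WW N n v \<omega>\<bar>"
    let ?T3 = "\<lambda>N \<omega>. s\<^sup>2 / 2 * (\<alpha> N / sqrt N) * kdev N n (\<lambda>y. (f y)\<^sup>2) \<omega>"
    let ?T4 = "\<lambda>N \<omega>. s\<^sup>2 / 2 * (2 * C) * (\<alpha> N / sqrt N) * kdev N n f \<omega>"
    let ?T5 = "\<lambda>N (\<omega>::'w). 2 * real N * (\<bar>?t N / sqrt N\<bar> * (2 * C)) ^ 3"
    have T1: "exp_negligible P \<alpha> ?T1"
      using remainder_negligible[OF f, of s] unfolding r_def by (rule exp_negligible_mono) simp
    have T2: "exp_negligible P \<alpha> ?T2"
      using negligible_linear[OF subgaussian_bfun[OF v], of "s\<^sup>2 / 2"] by (rule exp_negligible_mono) simp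
    have T3: "exp_negligible P \<alpha> ?T3"
      by (rule negligible_linear[OF kdev_subgaussian[OF f2]])
    have T4: "exp_negligible P \<alpha> ?T4"
      by (rule negligible_linear[OF kdev_subgaussian[OF f]])
    have T5: "exp_negligible P \<alpha> ?T5"
      by (rule exp_negligible_bounded[OF prob \<alpha>_pos cube_small])
    have m: "?T1 N \<in> borel_measurable (P N)" "?T2 N \<in> borel_measurable (P N)" "?T3 N \<in> borel_measurable (P N)"
      "?T4 N \<in> borel_measurable (P N)" "?T5 N \<in> borel_measurable (P N)" if "1 \<le> N" for N
      by (intro bfun_measurable bfun_abs bfun_cmult bfun_const rb WN_bfun v kb f f2 that)+
    show "exp_negligible P \<alpha> (\<lambda>N \<omega>. ?T1 N \<omega> + (?T2 N \<omega> + (?T3 N \<omega> + (?T4 N \<omega> + ?T5 N \<omega>))))"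
      by (intro exp_negligible_add[OF \<alpha>_infinity] T1 T2 T3 T4 T5 borel_measurable_add m)
    show "eventually (\<lambda>N. \<forall>\<omega>\<in>space (P N). \<bar>B N \<omega>\<bar> \<le> \<bar>?T1 N \<omega> + (?T2 N \<omega> + (?T3 N \<omega> + (?T4 N \<omega> + ?T5 N \<omega>)))\<bar>) sequentially"
      using step_small[of s "2 * C"] eventually_ge_at_top[of 1]
    proof eventually_elim
      case (elim N)
      note N = elim(2)
      interpret mp: mean_field_particles E K \<eta>0 D N "P N" "\<xi> N" using N by (rule mean_field_particles)
      show ?case
      proof
        fix \<omega> assume \<omega>: "\<omega> \<in> space (P N)"
        let ?x = "\<xi> N n \<omega>"
        have "\<bar>l N \<omega> - (?t N)\<^sup>2 / 2 * L\<bar> \<le> (?t N)\<^sup>2 / 2 / sqrt N *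
            (\<bar>mp.Wc n v ?x\<bar> + mp.kern_dev n (\<lambda>y. (f y)\<^sup>2) ?x + 2 * C * mp.kern_dev n f ?x) + ?T5 N \<omega>"
          unfolding l_def L_def
          using mp.step_bound[OF f C elim(1) mp.\<xi>_space[OF \<omega>] v_def] by simp
        also have "\<dots> = ?T2 N \<omega> + (?T3 N \<omega> + (?T4 N \<omega> + ?T5 N \<omega>))"
          using \<alpha>_pos[OF N] unfolding t2[OF N] mp.WN_Wc
          by (simp add: abs_mult distrib_left add_divide_distrib mult_ac)
        finally have "\<bar>l N \<omega> - (?t N)\<^sup>2 / 2 * L\<bar> \<le> ?T2 N \<omega> + (?T3 N \<omega> + (?T4 N \<omega> + ?T5 N \<omega>))" .
        then show "\<bar>B N \<omega>\<bar> \<le> \<bar>?T1 N \<omega> + (?T2 N \<omega> + (?T3 N \<omega> + (?T4 N \<omega> + ?T5 N \<omega>)))\<bar>"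
          unfolding B_def by linarith
      qed
    qed
  qed
  have "(\<lambda>N. ln (\<integral>\<omega>. exp (A N \<omega> + B N \<omega>) \<partial>P N) / \<alpha> N) \<longlonglongrightarrow> s\<^sup>2 / 2 * limit_var n ?h"
  proof (rule log_laplace_perturb[OF prob \<alpha>_pos \<alpha>_infinity Ab Bb neg])
    \<comment> \<open>\<open>A\<close> is linear in \<open>s\<close>: the factor \<open>p\<close>
      becomes the parameter \<open>p * s\<close>, whose limit carries
      \<open>p\<^sup>2\<close>.\<close>
    show "(\<lambda>N. ln (\<integral>\<omega>. exp (p * A N \<omega>) \<partial>P N) / \<alpha> N) \<longlonglongrightarrow> p\<^sup>2 * (s\<^sup>2 / 2 * limit_var n ?h)" for p
      using IH[of "p * s"] unfolding A_def by (simp add: mult.assoc power_mult_distrib)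
  qed
  then have lim: "(\<lambda>N. s\<^sup>2 / 2 * L + ln (\<integral>\<omega>. exp (A N \<omega> + B N \<omega>) \<partial>P N) / \<alpha> N)
     \<longlonglongrightarrow> s\<^sup>2 / 2 * L + s\<^sup>2 / 2 * limit_var n ?h"
    by (intro tendsto_add tendsto_const)
  have lv: "s\<^sup>2 / 2 * L + s\<^sup>2 / 2 * limit_var n ?h = s\<^sup>2 / 2 * limit_var (Suc n) f"
    unfolding L_def limit_var_Suc by (simp add: distrib_left)
  have "eventually (\<lambda>N. s\<^sup>2 / 2 * L + ln (\<integral>\<omega>. exp (A N \<omega> + B N \<omega>) \<partial>P N) / \<alpha> N
    = ln (\<integral>\<omega>. exp (?t N * WW N (Suc n) f \<omega>) \<partial>P N) / \<alpha> N) sequentially"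
    using eventually_ge_at_top[of 1]
  proof eventually_elim
    case (elim N)
    interpret mp: mean_field_particles E K \<eta>0 D N "P N" "\<xi> N" using elim by (rule mean_field_particles)
    \<comment> \<open>The deterministic variance is taken out of the expectation; divided by
      \<alpha> N it becomes \<open>s\<^sup>2 / 2 * L\<close>, the new term in the recursion of
      \<open>limit_var\<close>.\<close>
    have "?t N * mp.drift n f (\<xi> N n \<omega>) + l N \<omega> = (?t N)\<^sup>2 / 2 * L + (A N \<omega> + B N \<omega>)" for \<omega>
      unfolding mp.drift_eq A_def B_def mp.WN_Wc r_def by (simp add: distrib_left)
    then have "(\<integral>\<omega>. exp (?t N * WW N (Suc n) f \<omega>) \<partial>P N) = (\<integral>\<omega>. exp ((?t N)\<^sup>2 / 2 * L + (A N \<omega> + B N \<omega>)) \<partial>P N)"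
      unfolding mp.WN_Wc mp.step_laplace[OF f] l_def by simp
    also have "\<dots> = exp ((?t N)\<^sup>2 / 2 * L) * (\<integral>\<omega>. exp (A N \<omega> + B N \<omega>) \<partial>P N)"
      by (subst exp_add) simp
    finally have "ln (\<integral>\<omega>. exp (?t N * WW N (Suc n) f \<omega>) \<partial>P N)
      = (?t N)\<^sup>2 / 2 * L + ln (\<integral>\<omega>. exp (A N \<omega> + B N \<omega>) \<partial>P N)"
      using mp.P.expectation_exp_pos[OF bfun_add[OF Ab[OF elim] Bb[OF elim]]] by (simp add: ln_mult)
    then show ?case unfolding t2[OF elim] using \<alpha>_pos[OF elim] by (simp add: add_divide_distrib)
  qed
  from Lim_transform_eventually[OF lim this] show ?thesis unfolding lv .
qed

text \<open>\<open>f\<close> and \<open>s\<close> are generalised because the step replaces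
  \<open>f\<close> by \<open>D (Suc n) (\<eta> n) f\<close> and calls on all multiples of
  \<open>s\<close>.\<close>

lemma log_laplace:
  "f \<in> bfun (E n) \<Longrightarrow> (\<lambda>N. ln (\<integral>\<omega>. exp (s * sqrt (\<alpha> N) * WW N n f \<omega>) \<partial>P N) / \<alpha> N)
        \<longlonglongrightarrow> s\<^sup>2 / 2 * limit_var n f"
proof (induction n arbitrary: f s)
  case 0
  then show ?case by (rule log_laplace_0)
next
  case (Suc n)
  then show ?case using D_bfun[OF flow_probs] by (intro log_laplace_Suc) auto
qed

end

context mean_field_flow
begin

text \<open>Joins the two sides of the argument: one identity names the limit of the Laplace
  transforms of the particles, the other the quadratic term of the rate function, both through the
  same covariance matrix.\<close>

lemma W_quadratic_form:
  fixes f :: "'d::finite \<Rightarrow> 'a \<Rightarrow> real" and u :: "real ^ 'd"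
  assumes V: "limit_fields E K \<eta>0 Q V" and f: "\<And>i. f i \<in> bfun (E n)"
  shows "u \<bullet> (cov_W K \<eta>0 D Q V n f *v u) = limit_var n (\<lambda>x. \<Sum>i\<in>UNIV. u $ i * f i x)"
    and "(\<integral>\<omega>. (\<Sum>i\<in>UNIV. u $ i * W K \<eta>0 D V n (f i) \<omega>)\<^sup>2 \<partial>Q) = u \<bullet> (cov_W K \<eta>0 D Q V n f *v u)"
proof -
  let ?W = "\<lambda>i \<omega>. W K \<eta>0 D V n (f i) \<omega>"
  have form: "u \<bullet> (cov_W K \<eta>0 D Q V n f *v u) = (\<Sum>i\<in>UNIV. \<Sum>j\<in>UNIV. u $ i * u $ j * (\<integral>\<omega>. ?W i \<omega> * ?W j \<omega> \<partial>Q))"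
    by (simp add: inner_vec_def matrix_vector_mult_def cov_W_def sum_distrib_left mult_ac)
  then show "u \<bullet> (cov_W K \<eta>0 D Q V n f *v u) = limit_var n (\<lambda>x. \<Sum>i\<in>UNIV. u $ i * f i x)"
    using f by (simp add: W_covariance(2)[OF V] limit_var_sum)
  have i: "integrable Q (\<lambda>\<omega>. u $ i * u $ j * (?W i \<omega> * ?W j \<omega>))" for i j
    using W_covariance(1)[OF V f f] by (intro integrable_mult_right)
  have "(\<integral>\<omega>. (\<Sum>i\<in>UNIV. u $ i * ?W i \<omega>)\<^sup>2 \<partial>Q) = (\<integral>\<omega>. (\<Sum>i\<in>UNIV. \<Sum>j\<in>UNIV. u $ i * u $ j * (?W i \<omega> * ?W j \<omega>)) \<partial>Q)"
    by (simp add: power2_eq_square sum_product mult_ac)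
  also have "\<dots> = (\<Sum>i\<in>UNIV. \<integral>\<omega>. (\<Sum>j\<in>UNIV. u $ i * u $ j * (?W i \<omega> * ?W j \<omega>)) \<partial>Q)"
    by (intro Bochner_Integration.integral_sum Bochner_Integration.integrable_sum i)
  also have "\<dots> = (\<Sum>i\<in>UNIV. \<Sum>j\<in>UNIV. \<integral>\<omega>. u $ i * u $ j * (?W i \<omega> * ?W j \<omega>) \<partial>Q)"
    by (intro sum.cong refl Bochner_Integration.integral_sum i)
  finally show "(\<integral>\<omega>. (\<Sum>i\<in>UNIV. u $ i * ?W i \<omega>)\<^sup>2 \<partial>Q) = u \<bullet> (cov_W K \<eta>0 D Q V n f *v u)"
    unfolding form by simp
qed

end

theorem corollary2p5:
  fixes E :: "nat \<Rightarrow> 'a measure"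
    and K :: "nat \<Rightarrow> 'a measure \<Rightarrow> 'a \<Rightarrow> 'a measure"
    and \<eta>0 :: "'a measure"
    and D :: "nat \<Rightarrow> 'a measure \<Rightarrow> ('a \<Rightarrow> real) \<Rightarrow> ('a \<Rightarrow> real)"
    and P :: "nat \<Rightarrow> 'w measure"
    and \<xi> :: "nat \<Rightarrow> nat \<Rightarrow> 'w \<Rightarrow> nat \<Rightarrow> 'a"
    and Q :: "'v measure"
    and V :: "nat \<Rightarrow> ('a \<Rightarrow> real) \<Rightarrow> 'v \<Rightarrow> real"
    and n :: nat
    and f :: "'d::finite \<Rightarrow> 'a \<Rightarrow> real"
    and \<alpha> :: "nat \<Rightarrow> real"
  assumes model: "mean_field_model E K \<eta>0"
    and H1_K: "\<And>k. cond_K (E k) (E (Suc k)) (K (Suc k))"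
    and H1_Phi: "\<And>k. upsilon (E k) (E (Suc k)) (Phi K (Suc k)) (D (Suc k))"
    and particles: "\<And>N. N \<ge> 1 \<Longrightarrow> particle_system E K \<eta>0 N (P N) (\<xi> N)"
    and fields: "limit_fields E K \<eta>0 Q V"
    and f: "\<And>i. f i \<in> bfun (E n)"
    and alpha_pos: "\<And>N. N \<ge> 1 \<Longrightarrow> \<alpha> N > 0"
    and alpha_mono: "\<And>M N. 1 \<le> M \<Longrightarrow> M \<le> N \<Longrightarrow> \<alpha> M \<le> \<alpha> N"
    and alpha_infinity: "filterlim \<alpha> at_top sequentially"
    and alpha_small: "(\<lambda>N. \<alpha> N / real N) \<longlonglongrightarrow> 0"
  shows "MDP P borel (\<lambda>N \<omega>. \<chi> i. WN E K \<eta>0 N (\<xi> N) n (f i) \<omega>) \<alpha> (rate_W K \<eta>0 D Q V n f)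
    \<and> (invertible (cov_W K \<eta>0 D Q V n f) \<longrightarrow>
        (\<forall>v. rate_W K \<eta>0 D Q V n f v
             = ereal (1 / 2 * (v \<bullet> (matrix_inv (cov_W K \<eta>0 D Q V n f) *v v)))))"
proof -
  interpret mean_field_mdp E K \<eta>0 D P \<xi> \<alpha>
    by unfold_locales (fact model H1_K H1_Phi particles alpha_pos alpha_infinity alpha_small)+
  let ?C = "cov_W K \<eta>0 D Q V n f"
  note form = W_quadratic_form[OF fields f]
  have rate: "rate_W K \<eta>0 D Q V n f = (\<lambda>v. SUP u::real ^ 'd. ereal (u \<bullet> v - 1 / 2 * (u \<bullet> (?C *v u))))"
    unfolding rate_W_def[abs_def] form(2) ..
  have sym: "transpose ?C = ?C"
    by (simp add: transpose_def cov_W_def mult.commute)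
  \<comment> \<open>The form is the second moment of a real linear combination of the limit
    variables.\<close>
  have psd: "0 \<le> u \<bullet> (?C *v u)" for u
    unfolding form(2)[symmetric] by simp
  let ?Y = "\<lambda>N \<omega>. (\<chi> i. WW N n (f i) \<omega>) /\<^sub>R sqrt (\<alpha> N)"
  define fu where "fu = (\<lambda>u :: real ^ 'd. \<lambda>x. \<Sum>i\<in>UNIV. u $ i * f i x)"
  have fu: "fu u \<in> bfun (E n)" for u unfolding fu_def by (intro bfun_sum bfun_cmult f)
  \<comment> \<open>The normalisation in \<open>MDP\<close> turns the Laplace exponent of the vector
    at speed \<alpha> N into that of one scalar fluctuation, of the linear combination
    \<open>fu u\<close>, at scale \<open>sqrt (\<alpha> N)\<close>.\<close>
  have inner: "\<alpha> N * (u \<bullet> ?Y N \<omega>) = sqrt (\<alpha> N) * WW N n (fu u) \<omega>" if N: "1 \<le> N" and \<omega>: "\<omega> \<in> space (P N)" for N u \<omega>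
  proof -
    interpret mp: mean_field_particles E K \<eta>0 D N "P N" "\<xi> N" using N by (rule mean_field_particles)
    have "diff_int (mp.emp n (\<xi> N n \<omega>)) (\<eta> n) (fu u)
        = (\<Sum>i\<in>UNIV. u $ i * diff_int (mp.emp n (\<xi> N n \<omega>)) (\<eta> n) (f i))"
      unfolding diff_int_def fu_def
        probs_integral_sum[OF mp.emp_probs[OF mp.\<xi>_space[OF \<omega>]] f refl] probs_integral_sum[OF flow_probs f refl]
      by (simp add: right_diff_distrib sum_subtractf)
    then have "WW N n (fu u) \<omega> = u \<bullet> (\<chi> i. WW N n (f i) \<omega>)"
      by (simp add: WN_def inner_vec_def sum_distrib_left mult_ac)
    moreover have "\<alpha> N / sqrt (\<alpha> N) = sqrt (\<alpha> N)" using \<alpha>_pos[OF N] by (simp add: real_div_sqrt)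
    ultimately show ?thesis by (simp add: divide_inverse)
  qed
  have "LDP P borel ?Y \<alpha> (\<lambda>v. SUP u::real ^ 'd. ereal (u \<bullet> v - 1 / 2 * (u \<bullet> (?C *v u))))"
  proof (rule gartner_ellis_quadratic[OF sym prob _ \<alpha>_pos \<alpha>_infinity])
    fix N :: nat assume N: "1 \<le> N"
    interpret P: prob_space "P N" using prob[OF N] .
    have [measurable]: "WW N n (f i) \<in> borel_measurable (P N)" for i
      by (rule bfun_measurable[OF WN_bfun[OF N f]])
    show "?Y N \<in> P N \<rightarrow>\<^sub>M borel"
    proof (subst borel_measurable_euclidean_space, intro ballI)
      fix b :: "real ^ 'd" assume "b \<in> Basis"
      then obtain i where "b = axis i 1" by (auto simp: Basis_vec_def)
      then show "(\<lambda>\<omega>. ?Y N \<omega> \<bullet> b) \<in> borel_measurable (P N)" by (simp add: inner_axis)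
    qed
    show "integrable (P N) (\<lambda>\<omega>. exp (\<alpha> N * (u \<bullet> ?Y N \<omega>)))" for u
    proof -
      have "integrable (P N) (\<lambda>\<omega>. exp (\<alpha> N * (u \<bullet> ?Y N \<omega>)))
          \<longleftrightarrow> integrable (P N) (\<lambda>\<omega>. exp (sqrt (\<alpha> N) * WW N n (fu u) \<omega>))"
        by (intro Bochner_Integration.integrable_cong refl) (simp only: inner[OF N])
      then show ?thesis
        by (simp only: P.integrable_bfun[OF bfun_exp[OF bfun_cmult[OF WN_bfun[OF N fu]]]])
    qed
  next
    fix u :: "real ^ 'd"
    \<comment> \<open>The direction \<open>u\<close> is absorbed into \<open>fu u\<close>, so the
      scalar limit is taken at parameter 1.\<close>
    have "(\<lambda>N. ln (\<integral>\<omega>. exp (1 * sqrt (\<alpha> N) * WW N n (fu u) \<omega>) \<partial>P N) / \<alpha> N) \<longlonglongrightarrow> 1\<^sup>2 / 2 * limit_var n (fu u)"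
      by (rule log_laplace[OF fu])
    moreover have "eventually (\<lambda>N. ln (\<integral>\<omega>. exp (1 * sqrt (\<alpha> N) * WW N n (fu u) \<omega>) \<partial>P N) / \<alpha> N
        = ln (\<integral>\<omega>. exp (\<alpha> N * (u \<bullet> ?Y N \<omega>)) \<partial>P N) / \<alpha> N) sequentially"
      using eventually_ge_at_top[of 1]
    proof eventually_elim
      case (elim N)
      have "(\<integral>\<omega>. exp (1 * sqrt (\<alpha> N) * WW N n (fu u) \<omega>) \<partial>P N) = (\<integral>\<omega>. exp (\<alpha> N * (u \<bullet> ?Y N \<omega>)) \<partial>P N)"
        by (intro Bochner_Integration.integral_cong refl) (simp only: inner[OF elim] mult_1)
      then show ?case by simp
    qed
    ultimately have "(\<lambda>N. ln (\<integral>\<omega>. exp (\<alpha> N * (u \<bullet> ?Y N \<omega>)) \<partial>P N) / \<alpha> N) \<longlonglongrightarrow> 1\<^sup>2 / 2 * limit_var n (fu u)"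
      by (rule Lim_transform_eventually)
    then show "(\<lambda>N. ln (\<integral>\<omega>. exp (\<alpha> N * (u \<bullet> ?Y N \<omega>)) \<partial>P N) / \<alpha> N) \<longlonglongrightarrow> 1 / 2 * (u \<bullet> (?C *v u))"
      unfolding form(1) fu_def by simp
  qed
  then have "MDP P borel (\<lambda>N \<omega>. \<chi> i. WW N n (f i) \<omega>) \<alpha> (rate_W K \<eta>0 D Q V n f)"
    unfolding MDP_def rate .
  moreover have "rate_W K \<eta>0 D Q V n f v = ereal (1 / 2 * (v \<bullet> (matrix_inv ?C *v v)))" if "invertible ?C" for v
    unfolding rate by (rule quadratic_conjugate_invertible[OF sym psd that])
  ultimately show ?thesis by blast
qed

end
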